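(* Let $n\ge2$, let $r$ be a positive integer not divisible by $n$, let $k=r/n$, and let $d=\gcd(r,n)$. Let $M_k=\mathbb{C}[\mathfrak{h}]$ with $\mathfrak{h}=\mathbb{C}^n/\Delta$ be the polynomial representation of the rational Cherednik algebra $H_k(n)$ of type $A$, let $I_k\subset M_k$ be the $H_k(n)$-submodule generated by the functions $$f_i(x_1,\dots,x_n)=\mathrm{Res}_\infty\,[(z-x_1)\cdots(z-x_n)]^{\frac rn}\frac{dz}{z-x_i},\qquad i=1,\dots,n,$$ and let $V_k=M_k/I_k$, regarded as a $\mathbb{C}[\mathfrak{h}]$-module. Then the (set-theoretical) support of $V_k$ is the union of the $S_n$-translates of the subspace of $\mathbb{C}^n/\Delta$ defined by the equations $$x_1=x_2=\dots=x_{\frac nd};\quad x_{\frac nd+1}=\dots=x_{2\frac nd};\quad\dots;\quad x_{(d-1)\frac nd+1}=\dots=x_n.$$ In particular, the Gelfand-Kirillov dimension of $V_k$ is $d-1$.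
   Context: $\Delta\subset\mathbb{C}^n$ is the diagonal line, so $\mathbb{C}[\mathfrak{h}]$ is the algebra of polynomials in $x_1,\dots,x_n$ invariant under simultaneous translation $x_i\mapsto x_i+a$; $\mathfrak{h}$ is the reflection representation of $S_n$. $H_k(n)=H_{1,k}(S_n)$ is the quotient of $\mathbb{C}S_n\ltimes\mathbf{T}(\mathfrak{h}\oplus\mathfrak{h}^* )$ by $[x,x']=0$, $[y,y']=0$, $[y,x]=(y,x)-k\sum_{s}(y,\alpha_s)(x,\alpha_s^\vee)s$ for $x,x'\in\mathfrak{h}^*$, $y,y'\in\mathfrak{h}$, the sum being over transpositions $s$, with $\alpha_s\in\mathfrak{h}^*$, $\alpha_s^\vee\in\mathfrak{h}$ the $(-1)$-eigenvectors of $s$ normalized by $(\alpha_s,\alpha_s^\vee)=2$. In the polynomial representation $M_k=\mathbb{C}[\mathfrak{h}]$, $S_n$ and $\mathfrak{h}^*$ act in the obvious way (permutations and multiplication) and $y\in\mathfrak{h}$ acts by the Dunkl operator $\partial_y-k\sum_s\frac{\alpha_s(y)}{\alpha_s}(1-s)$. $\mathrm{Res}_\infty$ denotes the residue at $z=\infty$, where $[(z-x_1)\cdots(z-x_n)]^{r/n}$ is expanded near infinity as $z^r\prod_j(1-x_j/z)^{r/n}$. The $f_i$ are homogeneous of degree $r$, span a copy of the reflection representation, and are killed by all $y\in\mathfrak{h}$. *)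

theory Defs
  imports Complex_Main
    "HOL-Library.Poly_Mapping"
    "HOL-Library.Extended_Real"
    "HOL-Library.Liminf_Limsup"
    "HOL-Combinatorics.Permutations"
    "HOL-Computational_Algebra.Formal_Laurent_Series"
    "HOL-Algebra.QuotRing"
    "HOL-Algebra.Module"
begin

section \<open>Polynomials in \<open>x\<^sub>1, \<dots>, x\<^sub>n\<close>\<close>

type_synonym mpoly = "(nat \<Rightarrow>\<^sub>0 nat) \<Rightarrow>\<^sub>0 complex"

definition mvar :: "nat \<Rightarrow> mpoly" where
  "mvar i = Poly_Mapping.single (Poly_Mapping.single i 1) 1"

definition mconst :: "complex \<Rightarrow> mpoly" where
  "mconst c = Poly_Mapping.single 0 c"

text \<open>Substitution of \<open>g i\<close> for \<open>x\<^sub>i\<close>, the coefficients being mapped through \<open>\<phi>\<close>.\<close>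

definition msubst :: "(complex \<Rightarrow> 'r) \<Rightarrow> (nat \<Rightarrow> 'r) \<Rightarrow> mpoly \<Rightarrow> 'r::comm_semiring_1" where
  "msubst \<phi> g p = (\<Sum>m\<in>Poly_Mapping.keys p. \<phi> (Poly_Mapping.lookup p m) *
      (\<Prod>i\<in>Poly_Mapping.keys m. g i ^ Poly_Mapping.lookup m i))"

definition peval :: "(nat \<Rightarrow> complex) \<Rightarrow> mpoly \<Rightarrow> complex" where
  "peval = msubst (\<lambda>c. c)"

definition pderiv_var :: "nat \<Rightarrow> mpoly \<Rightarrow> mpoly" where
  "pderiv_var i p = (\<Sum>m\<in>Poly_Mapping.keys p.
      Poly_Mapping.single (m - Poly_Mapping.single i 1)
        (of_nat (Poly_Mapping.lookup m i) * Poly_Mapping.lookup p m))"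

definition polys :: "nat \<Rightarrow> mpoly set" where
  "polys n = {p. \<forall>m\<in>Poly_Mapping.keys p. Poly_Mapping.keys m \<subseteq> {1..n}}"

section \<open>The reflection representation \<open>\<hh> = \<complex>\<^sup>n/\<Delta>\<close>\<close>

text \<open>Vectors of \<open>\<complex>\<^sup>n\<close> are functions vanishing outside \<open>{1..n}\<close>.\<close>

definition cvec :: "nat \<Rightarrow> (nat \<Rightarrow> complex) set" where
  "cvec n = {v. \<forall>i. i \<notin> {1..n} \<longrightarrow> v i = 0}"

definition diag_rel :: "nat \<Rightarrow> ((nat \<Rightarrow> complex) \<times> (nat \<Rightarrow> complex)) set" where
  "diag_rel n = {(u, v). u \<in> cvec n \<and> v \<in> cvec n \<and> (\<exists>a. \<forall>i\<in>{1..n}. u i - v i = a)}"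

definition hspace :: "nat \<Rightarrow> (nat \<Rightarrow> complex) set set" where
  "hspace n = cvec n // diag_rel n"

definition hclass :: "nat \<Rightarrow> (nat \<Rightarrow> complex) \<Rightarrow> (nat \<Rightarrow> complex) set" where
  "hclass n v = diag_rel n `` {v}"

definition perm_vec :: "(nat \<Rightarrow> nat) \<Rightarrow> (nat \<Rightarrow> complex) \<Rightarrow> nat \<Rightarrow> complex" where
  "perm_vec w v = (\<lambda>i. v (inv_into UNIV w i))"

definition perm_poly :: "(nat \<Rightarrow> nat) \<Rightarrow> mpoly \<Rightarrow> mpoly" where
  "perm_poly w = msubst mconst (\<lambda>i. mvar (w i))"

text \<open>\<open>\<complex>[\<hh>]\<close>: the polynomials invariant under \<open>x\<^sub>i \<mapsto> x\<^sub>i + a\<close>.\<close>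

definition Ch :: "nat \<Rightarrow> mpoly set" where
  "Ch n = {p \<in> polys n. \<forall>a. msubst mconst (\<lambda>i. mvar i + mconst a) p = p}"

text \<open>\<open>\<hh>\<^sup>*\<close> as a subspace of \<open>\<complex>[\<hh>]\<close>.\<close>

definition hdual :: "nat \<Rightarrow> mpoly set" where
  "hdual n = {\<Sum>i\<in>{1..n}. mconst (c i) * mvar i | c. (\<Sum>i\<in>{1..n}. c i) = 0}"

text \<open>For the transposition \<open>s = (i j)\<close>: \<open>\<alpha>\<^sub>s = x\<^sub>i - x\<^sub>j\<close>, and \<open>\<alpha>\<^sub>s\<^sup>\<or>\<close> is the class of
  \<open>e\<^sub>i - e\<^sub>j\<close>. Both change sign when \<open>i\<close> and \<open>j\<close> are exchanged; only products of the two,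
  or ratios of values of \<open>\<alpha>\<^sub>s\<close>, are used.\<close>

definition alpha :: "nat \<Rightarrow> nat \<Rightarrow> mpoly" where
  "alpha i j = mvar i - mvar j"

definition coalpha :: "nat \<Rightarrow> nat \<Rightarrow> nat \<Rightarrow> complex" where
  "coalpha i j = (\<lambda>m. if m = i then 1 else if m = j then - 1 else 0)"

definition transp_pairs :: "nat \<Rightarrow> (nat \<times> nat) set" where
  "transp_pairs n = {(i, j). 1 \<le> i \<and> i < j \<and> j \<le> n}"

section \<open>Free associative algebras\<close>

datatype 'g word = Word (letters: "'g list")

instantiation word :: (type) monoid_add
begin
definition zero_word :: "'a word" where "zero_word = Word []"
definition plus_word :: "'a word \<Rightarrow> 'a word \<Rightarrow> 'a word" where
  "plus_word u v = Word (letters u @ letters v)"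
instance
  by standard (simp_all add: zero_word_def plus_word_def)
end

text \<open>Convolution over the monoid of words makes this the free \<open>\<complex>\<close>-algebra on \<open>'g\<close>.\<close>

type_synonym 'g free_alg = "'g word \<Rightarrow>\<^sub>0 complex"

definition fgen :: "'g \<Rightarrow> 'g free_alg" where
  "fgen g = Poly_Mapping.single (Word [g]) 1"

definition fconst :: "complex \<Rightarrow> 'g free_alg" where
  "fconst c = Poly_Mapping.single 0 c"

definition free_algebra :: "'g set \<Rightarrow> 'g free_alg ring" where
  "free_algebra G = \<lparr>carrier = {a. \<forall>w\<in>Poly_Mapping.keys a. set (letters w) \<subseteq> G},
     mult = (*), one = 1, zero = 0, add = (+)\<rparr>"

section \<open>The rational Cherednik algebra \<open>H\<^sub>k(n)\<close>\<close>

datatype cgen = GPerm "nat \<Rightarrow> nat" | GVec "(nat \<Rightarrow> complex) set" | GCovec mpoly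

definition cgens :: "nat \<Rightarrow> cgen set" where
  "cgens n = GPerm ` {w. w permutes {1..n}} \<union> GVec ` hspace n \<union> GCovec ` hdual n"

abbreviation "Wg w \<equiv> fgen (GPerm w)"
abbreviation "Yg n v \<equiv> fgen (GVec (hclass n v))"
abbreviation "Xg x \<equiv> fgen (GCovec x)"

text \<open>The first two groups of relations present \<open>\<complex>S\<^sub>n \<ltimes> T(\<hh> \<oplus> \<hh>\<^sup>*)\<close> as a quotient of the
  free algebra on the disjoint union of \<open>S\<^sub>n\<close>, \<open>\<hh>\<close> and \<open>\<hh>\<^sup>*\<close>.\<close>

definition smash_relations :: "nat \<Rightarrow> cgen free_alg set" where
  "smash_relations n =
     {Wg id - 1}
   \<union> {Wg u * Wg w - Wg (u \<circ> w) | u w. u permutes {1..n} \<and> w permutes {1..n}}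
   \<union> {Yg n (\<lambda>i. u i + v i) - (Yg n u + Yg n v) | u v. u \<in> cvec n \<and> v \<in> cvec n}
   \<union> {Yg n (\<lambda>i. c * v i) - fconst c * Yg n v | c v. v \<in> cvec n}
   \<union> {Xg (x + x') - (Xg x + Xg x') | x x'. x \<in> hdual n \<and> x' \<in> hdual n}
   \<union> {Xg (mconst c * x) - fconst c * Xg x | c x. x \<in> hdual n}
   \<union> {Wg w * Yg n v - Yg n (perm_vec w v) * Wg w | w v. w permutes {1..n} \<and> v \<in> cvec n}
   \<union> {Wg w * Xg x - Xg (perm_poly w x) * Wg w | w x. w permutes {1..n} \<and> x \<in> hdual n}"

definition cherednik_relations :: "nat \<Rightarrow> complex \<Rightarrow> cgen free_alg set" where
  "cherednik_relations n k =
     {Xg x * Xg x' - Xg x' * Xg x | x x'. x \<in> hdual n \<and> x' \<in> hdual n}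
   \<union> {Yg n v * Yg n v' - Yg n v' * Yg n v | v v'. v \<in> cvec n \<and> v' \<in> cvec n}
   \<union> {Yg n v * Xg x - Xg x * Yg n v
        - (fconst (peval v x)
           - fconst k * (\<Sum>(i, j)\<in>transp_pairs n.
               fconst (peval v (alpha i j) * peval (coalpha i j) x) * Wg (transpose i j)))
       | v x. v \<in> cvec n \<and> x \<in> hdual n}"

definition cherednik :: "nat \<Rightarrow> complex \<Rightarrow> cgen free_alg set ring" where
  "cherednik n k = (let F = free_algebra (cgens n) in
     F Quot (genideal F (smash_relations n \<union> cherednik_relations n k)))"

section \<open>The polynomial representation \<open>M\<^sub>k\<close>\<close>

text \<open>\<open>(1 - s)p/\<alpha>\<^sub>s\<close> for \<open>s = (i j)\<close>; the quotient is a polynomial and is unique because the polynomial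
  ring is a domain.\<close>

definition divdiff :: "nat \<Rightarrow> nat \<Rightarrow> mpoly \<Rightarrow> mpoly" where
  "divdiff i j p = (THE q. alpha i j * q = p - perm_poly (transpose i j) p)"

definition dunkl :: "nat \<Rightarrow> complex \<Rightarrow> (nat \<Rightarrow> complex) \<Rightarrow> mpoly \<Rightarrow> mpoly" where
  "dunkl n k v p = (\<Sum>i\<in>{1..n}. mconst (v i) * pderiv_var i p)
     - mconst k * (\<Sum>(i, j)\<in>transp_pairs n. mconst (peval v (alpha i j)) * divdiff i j p)"

text \<open>On \<open>\<complex>[\<hh>]\<close> the operator \<open>dunkl n k v\<close> depends only on the class of \<open>v\<close> modulo \<open>\<Delta>\<close>.\<close>

primrec gen_act :: "nat \<Rightarrow> complex \<Rightarrow> cgen \<Rightarrow> mpoly \<Rightarrow> mpoly" where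
  "gen_act n k (GPerm w) p = perm_poly w p"
| "gen_act n k (GVec y) p = dunkl n k (SOME v. v \<in> y) p"
| "gen_act n k (GCovec x) p = x * p"

definition free_act :: "nat \<Rightarrow> complex \<Rightarrow> cgen free_alg \<Rightarrow> mpoly \<Rightarrow> mpoly" where
  "free_act n k a p = (\<Sum>w\<in>Poly_Mapping.keys a.
      mconst (Poly_Mapping.lookup a w) * foldr (gen_act n k) (letters w) p)"

text \<open>An element of \<open>H\<^sub>k(n)\<close> is a coset \<open>h\<close> of the ideal of relations. The relations act by zero on
  \<open>\<complex>[\<hh>]\<close>, so for \<open>p\<close> in \<open>\<complex>[\<hh>]\<close> all members of \<open>h\<close> send \<open>p\<close> to the same polynomial.\<close>

definition cherednik_act :: "nat \<Rightarrow> complex \<Rightarrow> cgen free_alg set \<Rightarrow> mpoly \<Rightarrow> mpoly" where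
  "cherednik_act n k h p = the_elem ((\<lambda>a. free_act n k a p) ` h)"

definition cherednik_submodule :: "nat \<Rightarrow> complex \<Rightarrow> mpoly set \<Rightarrow> bool" where
  "cherednik_submodule n k N \<longleftrightarrow> N \<subseteq> Ch n \<and> 0 \<in> N \<and> (\<forall>p\<in>N. \<forall>q\<in>N. p + q \<in> N) \<and>
     (\<forall>h\<in>carrier (cherednik n k). \<forall>p\<in>N. cherednik_act n k h p \<in> N)"

definition cherednik_span :: "nat \<Rightarrow> complex \<Rightarrow> mpoly set \<Rightarrow> mpoly set" where
  "cherednik_span n k F = \<Inter>{N. cherednik_submodule n k N \<and> F \<subseteq> N}"

section \<open>The functions \<open>f\<^sub>i\<close>\<close>

text \<open>Forms \<open>F(z) dz\<close> near \<open>z = \<infinity>\<close> are given by the Laurent expansion of \<open>F\<close> in \<open>u = 1/z\<close>. Their residue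
  at infinity is minus the coefficient of \<open>z\<^sup>-\<^sup>1 = u\<close>.\<close>

definition res_infinity :: "mpoly fls \<Rightarrow> mpoly" where
  "res_infinity F = - fls_nth F 1"

text \<open>The binomial series \<open>(1 - x u)\<^sup>a\<close>.\<close>

definition one_minus_power :: "mpoly \<Rightarrow> complex \<Rightarrow> mpoly fps" where
  "one_minus_power x a = Abs_fps (\<lambda>m. mconst (a gchoose m) * (- x) ^ m)"

text \<open>\<open>[(z - x\<^sub>1)\<cdots>(z - x\<^sub>n)]\<^bsup>r/n\<^esup> = u\<^bsup>-r\<^esup> \<Prod>\<^sub>j (1 - x\<^sub>j u)\<^bsup>r/n\<^esup>\<close> and
  \<open>1/(z - x\<^sub>i) = u (1 - x\<^sub>i u)\<^sup>-\<^sup>1\<close>.\<close>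

definition fpoly :: "nat \<Rightarrow> nat \<Rightarrow> nat \<Rightarrow> mpoly" where
  "fpoly n r i = res_infinity
     (fls_X_intpow (- int r)
        * fps_to_fls (\<Prod>j\<in>{1..n}. one_minus_power (mvar j) (of_nat r / of_nat n))
        * (fls_X * fps_to_fls (one_minus_power (mvar i) (- 1))))"

section \<open>\<open>\<complex>[\<hh>]\<close>-modules\<close>

definition Ch_ring :: "nat \<Rightarrow> mpoly ring" where
  "Ch_ring n = \<lparr>carrier = Ch n, mult = (*), one = 1, zero = 0, add = (+)\<rparr>"

definition Ch_module :: "nat \<Rightarrow> (mpoly, mpoly) module" where
  "Ch_module n = \<lparr>carrier = Ch n, mult = (*), one = 1, zero = 0, add = (+), smult = (*)\<rparr>"

text \<open>The ring fields \<open>mult\<close> and \<open>one\<close> of a module record carry no meaning.\<close>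

definition quotient_module :: "('r, 'm) module \<Rightarrow> 'm set \<Rightarrow> ('r, 'm set) module" where
  "quotient_module M N = \<lparr>carrier = a_rcosets\<^bsub>M\<^esub> N, mult = rcoset_mult M N,
     one = N +>\<^bsub>M\<^esub> \<one>\<^bsub>M\<^esub>, zero = N, add = set_add M,
     smult = (\<lambda>r C. \<Union>m\<in>C. N +>\<^bsub>M\<^esub> (r \<odot>\<^bsub>M\<^esub> m))\<rparr>"

definition Vmod :: "nat \<Rightarrow> mpoly set \<Rightarrow> (mpoly, mpoly set) module" where
  "Vmod n I = quotient_module (Ch_module n) I"

subsection \<open>Support\<close>

text \<open>Localization of a module at a prime ideal \<open>P\<close>, as classes of fractions \<open>(m, s)\<close> with
  \<open>s \<notin> P\<close>.\<close>

definition loc_rel :: "('r, 'a) ring_scheme \<Rightarrow> ('r, 'm) module \<Rightarrow> 'r set \<Rightarrow> (('m \<times> 'r) \<times> ('m \<times> 'r)) set" where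
  "loc_rel R M P = {((m, s), (m', s')). m \<in> carrier M \<and> m' \<in> carrier M \<and>
     s \<in> carrier R - P \<and> s' \<in> carrier R - P \<and>
     (\<exists>t\<in>carrier R - P. t \<odot>\<^bsub>M\<^esub> (s' \<odot>\<^bsub>M\<^esub> m) = t \<odot>\<^bsub>M\<^esub> (s \<odot>\<^bsub>M\<^esub> m'))}"

definition localization :: "('r, 'a) ring_scheme \<Rightarrow> ('r, 'm) module \<Rightarrow> 'r set \<Rightarrow> ('m \<times> 'r) set set" where
  "localization R M P = (carrier M \<times> (carrier R - P)) // loc_rel R M P"

definition localization_zero :: "('r, 'a) ring_scheme \<Rightarrow> ('r, 'm) module \<Rightarrow> 'r set \<Rightarrow> ('m \<times> 'r) set" where
  "localization_zero R M P = loc_rel R M P `` {(\<zero>\<^bsub>M\<^esub>, \<one>\<^bsub>R\<^esub>)}"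

definition max_ideal_at :: "nat \<Rightarrow> (nat \<Rightarrow> complex) set \<Rightarrow> mpoly set" where
  "max_ideal_at n y = {p \<in> Ch n. \<forall>v\<in>y. peval v p = 0}"

text \<open>The support as a set of closed points of \<open>\<hh>\<close>, a point corresponding to the maximal ideal of
  functions vanishing there.\<close>

definition supp :: "nat \<Rightarrow> (mpoly, 'm) module \<Rightarrow> (nat \<Rightarrow> complex) set set" where
  "supp n M = {y \<in> hspace n. localization (Ch_ring n) M (max_ideal_at n y)
      \<noteq> {localization_zero (Ch_ring n) M (max_ideal_at n y)}}"

subsection \<open>Gelfand-Kirillov dimension\<close>

inductive_set cspan :: "(mpoly, 'm) module \<Rightarrow> 'm set \<Rightarrow> 'm set"
  for M :: "(mpoly, 'm) module" and B :: "'m set" where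
  zero: "\<zero>\<^bsub>M\<^esub> \<in> cspan M B"
| add: "b \<in> B \<Longrightarrow> v \<in> cspan M B \<Longrightarrow> (mconst c \<odot>\<^bsub>M\<^esub> b) \<oplus>\<^bsub>M\<^esub> v \<in> cspan M B"

definition cbasis :: "(mpoly, 'm) module \<Rightarrow> 'm set \<Rightarrow> 'm set \<Rightarrow> bool" where
  "cbasis M W B \<longleftrightarrow> B \<subseteq> carrier M \<and> cspan M B = W \<and> (\<forall>b\<in>B. b \<notin> cspan M (B - {b}))"

definition cdim :: "(mpoly, 'm) module \<Rightarrow> 'm set \<Rightarrow> nat" where
  "cdim M W = card (SOME B. cbasis M W B)"

text \<open>The span \<open>A\<^sup>m F\<close> of all \<open>a\<^sub>1 \<cdots> a\<^sub>m f\<close> with \<open>a\<^sub>i \<in> A\<close>, \<open>f \<in> F\<close>.\<close>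

definition growth_space :: "(mpoly, 'm) module \<Rightarrow> mpoly set \<Rightarrow> 'm set \<Rightarrow> nat \<Rightarrow> 'm set" where
  "growth_space M A F m =
     cspan M {foldr (smult M) as f | as f. length as = m \<and> set as \<subseteq> A \<and> f \<in> F}"

text \<open>Supremum over the finite-dimensional subspaces \<open>\<langle>A\<rangle> \<ni> 1\<close> of the algebra and \<open>\<langle>F\<rangle>\<close> of the
  module of \<open>limsup log\<^sub>m dim (A\<^sup>m F)\<close>, where \<open>log 0 = -\<infinity>\<close>.\<close>

definition GK_dim :: "(mpoly, 'a) ring_scheme \<Rightarrow> (mpoly, 'm) module \<Rightarrow> ereal" where
  "GK_dim R M = (SUP (A, F) \<in> {(A, F). finite A \<and> \<one>\<^bsub>R\<^esub> \<in> A \<and> A \<subseteq> carrier R \<and>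
                                       finite F \<and> F \<subseteq> carrier M}.
     limsup (\<lambda>m. let d = cdim M (growth_space M A F m) in
        if d = 0 then - \<infinity> else ereal (ln (real d) / ln (real m))))"

section \<open>The subspace arrangement\<close>

text \<open>Consecutive blocks of length \<open>q = n/d\<close>: \<open>x\<^bsub>bq+1\<^esub> = \<dots> = x\<^bsub>(b+1)q\<^esub>\<close> for \<open>0 \<le> b < d\<close>.\<close>

definition block_subspace :: "nat \<Rightarrow> nat \<Rightarrow> (nat \<Rightarrow> complex) set set" where
  "block_subspace n d = hclass n ` {v \<in> cvec n. \<forall>b<d.
     \<forall>i\<in>{b * (n div d) + 1..(b + 1) * (n div d)}. \<forall>j\<in>{b * (n div d) + 1..(b + 1) * (n div d)}. v i = v j}"

definition perm_hspace :: "(nat \<Rightarrow> nat) \<Rightarrow> (nat \<Rightarrow> complex) set \<Rightarrow> (nat \<Rightarrow> complex) set" where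
  "perm_hspace w y = perm_vec w ` y"

end

theory Submission
  imports Defs
    "HOL-Number_Theory.Cong"
    "HOL-Real_Asymp.Real_Asymp"
begin

text \<open>The \<open>f\<^sub>i\<close> are permuted by \<open>S\<^sub>n\<close> and killed by the Dunkl operators, so \<open>I\<^sub>k\<close> is the ideal of \<open>\<complex>[\<hh>]\<close>
  they generate, and the support of \<open>V\<^sub>k\<close> is their zero set. Put \<open>G\<^sub>s = \<Prod>\<^sub>j (1 - x\<^sub>j u)\<^sup>s\<close>; up to sign
  \<open>f\<^sub>i\<close> is the coefficient of \<open>u\<^sup>r\<close> in \<open>Y\<^sub>i = G\<^sub>k / (1 - x\<^sub>i u)\<close>. The \<open>Y\<^sub>i\<close> satisfy
  \<open>(1 - x\<^sub>i u) Y\<^sub>i' = x\<^sub>i Y\<^sub>i - k \<Sum>\<^sub>j x\<^sub>j Y\<^sub>j\<close>, so modulo the \<open>f\<^sub>i\<close> all coefficients beyond \<open>u\<^sup>r\<close>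
  vanish. At a common zero \<open>G\<^sub>k\<close> is therefore a polynomial with \<open>G\<^sub>k\<^sup>n = \<Prod>\<^sub>j (1 - x\<^sub>j u)\<^sup>r\<close>, and comparing
  orders of vanishing shows that every coordinate has multiplicity divisible by \<open>n/d\<close>.

  For the dimension, kill also the power sums \<open>p\<^sub>1, \<dots>, p\<^sub>d\<close>. Then the coefficient of \<open>u\<^sup>t\<close> in \<open>G\<^sub>s\<close> is a
  polynomial in \<open>s\<close> of degree at most \<open>t/(d+1)\<close>, while it vanishes for about \<open>t/d\<close> values of \<open>s\<close>, those for which
  \<open>G\<^sub>s\<close> is a product of powers of \<open>G\<^sub>1\<close> and \<open>G\<^sub>k\<close>. So it vanishes for all \<open>s\<close> when \<open>t\<close> is large, and
  \<open>s = -1\<close> shows that the \<open>x\<^sub>i\<close> are nilpotent. Hence \<open>V\<^sub>k\<close> is finite over the polynomials in the \<open>d - 1\<close>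
  centred power sums \<open>p\<^sub>2, \<dots>, p\<^sub>d\<close>, which bounds its growth from above; the functions on one component of the support
  bound it from below.\<close>


section \<open>Polynomials\<close>

text \<open>Why d power sums: let q = n/d and e = r/d. Every integer N >= q e has the form a q + b e
  with a, b >= 0, and then G_{N/q} = G_1^a G_k^b has degree at most n a + r b = d N modulo the f_i.
  So the coefficient of u^t vanishes at roughly t/d values s = N/q. Once p_1, ..., p_d are removed,
  Newton's recurrence lowers t by at least d + 1 for each factor of s, and the degree t/(d+1) falls
  below that count; removing only d - 1 of them would not suffice for this count. The obstacle is
  that power sums and generating functions are not translation invariant. Nilpotency is therefore
  proved in the full polynomial ring and carried to C[h] by substituting centred coordinates, which
  fixes every f_i and kills p_1; this leaves d - 1 parameters. The growth estimate also needs
  degrees to be under control, so the relations are replaced by their homogeneous parts.\<close>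

lemma poly_mapping_expand:
  fixes p :: "'a \<Rightarrow>\<^sub>0 'b::comm_monoid_add"
  assumes "finite A" "Poly_Mapping.keys p \<subseteq> A"
  shows "p = (\<Sum>m\<in>A. Poly_Mapping.single m (Poly_Mapping.lookup p m))"
proof (rule poly_mapping_eqI)
  fix k
  have "(\<Sum>m\<in>A. Poly_Mapping.lookup p m when m = k) = (if k \<in> A then Poly_Mapping.lookup p k else 0)"
    using assms(1) by (simp add: when_def if_distrib sum.delta cong: if_cong)
  then show "Poly_Mapping.lookup p k =
      Poly_Mapping.lookup (\<Sum>m\<in>A. Poly_Mapping.single m (Poly_Mapping.lookup p m)) k"
    using assms(2) by (auto simp: lookup_sum lookup_single in_keys_iff)
qed

lemma poly_mapping_induct [case_names single add]:
  fixes p :: "'a \<Rightarrow>\<^sub>0 'b::comm_monoid_add"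
  assumes single: "\<And>m c. P (Poly_Mapping.single m c)"
    and add: "\<And>p q. P p \<Longrightarrow> P q \<Longrightarrow> P (p + q)"
  shows "P p"
proof -
  have "P (\<Sum>m\<in>A. Poly_Mapping.single m (f m))" if "finite A" for A and f :: "'a \<Rightarrow> 'b"
    using that single[of undefined 0] by (induction A) (auto intro: add single)
  then show ?thesis
    using poly_mapping_expand[of "Poly_Mapping.keys p" p] by (metis finite_keys subset_refl)
qed

definition mon :: "(nat \<Rightarrow> 'r::comm_monoid_mult) \<Rightarrow> (nat \<Rightarrow>\<^sub>0 nat) \<Rightarrow> 'r" where
  "mon g m = (\<Prod>i\<in>Poly_Mapping.keys m. g i ^ Poly_Mapping.lookup m i)"

lemma mon_superset:
  assumes "finite A" "Poly_Mapping.keys m \<subseteq> A"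
  shows "mon g m = (\<Prod>i\<in>A. g i ^ Poly_Mapping.lookup m i)"
  unfolding mon_def by (rule prod.mono_neutral_left) (use assms in \<open>auto simp: in_keys_iff\<close>)

lemma mon_0 [simp]: "mon g 0 = 1"
  by (simp add: mon_def)

lemma mon_single [simp]: "mon g (Poly_Mapping.single i a) = g i ^ a"
  by (cases "a = 0") (auto simp: mon_def)

lemma mon_add: "mon g (m + m') = mon g m * mon g m'"
proof -
  let ?A = "Poly_Mapping.keys m \<union> Poly_Mapping.keys m'"
  have A: "finite ?A" "Poly_Mapping.keys m \<subseteq> ?A" "Poly_Mapping.keys m' \<subseteq> ?A"
    "Poly_Mapping.keys (m + m') \<subseteq> ?A"
    using keys_add[of m m'] by auto
  show ?thesis
    unfolding mon_superset[OF A(1) A(2)] mon_superset[OF A(1) A(3)] mon_superset[OF A(1) A(4)]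
    by (simp add: lookup_add power_add prod.distrib)
qed

lemma mon_mult: "mon (\<lambda>i. g i * h i) m = mon g m * mon h m"
  by (simp add: mon_def power_mult_distrib prod.distrib)

text \<open>Unital ring homomorphisms on the coefficients. Evaluation at a point, substitution of
  polynomials, restriction to a line and the grading are all \<open>msubst\<close> for such a
  \<phi>, so its rules are proved once.\<close>

definition coeff_hom :: "(complex \<Rightarrow> 'r::comm_ring_1) \<Rightarrow> bool" where
  "coeff_hom \<phi> \<longleftrightarrow> \<phi> 1 = 1 \<and> (\<forall>a b. \<phi> (a + b) = \<phi> a + \<phi> b) \<and> (\<forall>a b. \<phi> (a * b) = \<phi> a * \<phi> b)"

lemma coeff_hom_simps:
  assumes "coeff_hom \<phi>"
  shows "\<phi> 1 = 1" "\<phi> (a + b) = \<phi> a + \<phi> b" "\<phi> (a * b) = \<phi> a * \<phi> b" "\<phi> 0 = 0"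
    "\<phi> (- a) = - \<phi> a" "\<phi> (a - b) = \<phi> a - \<phi> b"
proof -
  show 1: "\<phi> 1 = 1" and 2: "\<phi> (a + b) = \<phi> a + \<phi> b" for a b
    using assms by (auto simp: coeff_hom_def)
  show "\<phi> (a * b) = \<phi> a * \<phi> b"
    using assms by (auto simp: coeff_hom_def)
  show 0: "\<phi> 0 = 0"
    using 2[of 0 0] by simp
  show 3: "\<phi> (- a) = - \<phi> a" for a
    using 2[of a "- a"] 0 by (simp add: eq_neg_iff_add_eq_0 add.commute)
  show "\<phi> (a - b) = \<phi> a - \<phi> b"
    using 2[of a "- b"] 3[of b] by simp
qed

lemma coeff_hom_id: "coeff_hom (\<lambda>c. c)"
  by (simp add: coeff_hom_def)

lemma mconst_add: "mconst (a + b) = mconst a + mconst b"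
  by (simp add: mconst_def single_add)

lemma mconst_mult: "mconst (a * b) = mconst a * mconst b"
  by (simp add: mconst_def mult_single)

lemma mconst_1 [simp]: "mconst 1 = 1"
  by (simp add: mconst_def)

lemma coeff_hom_mconst: "coeff_hom mconst"
  by (simp add: coeff_hom_def mconst_add mconst_mult)

lemmas mconst_simps = coeff_hom_simps[OF coeff_hom_mconst]

lemma mconst_0 [simp]: "mconst 0 = 0"
  by (simp add: mconst_def)

lemma mconst_uminus: "mconst (- a) = - mconst a"
  by (rule mconst_simps)

lemma mconst_diff: "mconst (a - b) = mconst a - mconst b"
  by (rule mconst_simps)

lemma mconst_of_nat: "mconst (of_nat j) = of_nat j"
  by (induction j) (simp_all add: mconst_add)

lemma mconst_sum: "mconst (sum f A) = (\<Sum>i\<in>A. mconst (f i))"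
  by (induction A rule: infinite_finite_induct) (simp_all add: mconst_add)

lemma mconst_inverse_cancel:
  assumes "c \<noteq> 0"
  shows "mconst (inverse c) * (mconst c * p) = p"
proof -
  have "mconst (inverse c) * mconst c = 1"
    using assms by (simp flip: mconst_mult)
  then show ?thesis
    by (simp add: mult.assoc [symmetric])
qed

lemma mconst_mult_single: "mconst c * Poly_Mapping.single m a = Poly_Mapping.single m (c * a)"
  by (simp add: mconst_def mult_single)

lemma lookup_mconst_mult: "Poly_Mapping.lookup (mconst c * p) m = c * Poly_Mapping.lookup p m"
proof -
  have "mconst c * p = (\<Sum>m\<in>Poly_Mapping.keys p. Poly_Mapping.single m (c * Poly_Mapping.lookup p m))"
    by (subst poly_mapping_expand[of "Poly_Mapping.keys p" p])
      (simp_all add: sum_distrib_left mconst_mult_single del: Poly_Mapping.lookup_mult)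
  then show ?thesis
    by (auto simp: lookup_sum lookup_single when_def sum.delta in_keys_iff)
qed

lemma single_eq_mconst_mon: "Poly_Mapping.single m c = mconst c * mon mvar m"
proof -
  have pow: "mvar i ^ a = Poly_Mapping.single (Poly_Mapping.single i a) 1" for i a
    by (induction a) (simp_all add: mvar_def mult_single flip: single_add)
  have pr: "(\<Prod>i\<in>A. Poly_Mapping.single (f i) (1::complex)) = Poly_Mapping.single (sum f A) 1"
    if "finite A" for A and f :: "nat \<Rightarrow> nat \<Rightarrow>\<^sub>0 nat"
    using that by (induction A) (simp_all add: mult_single)
  have "mon mvar m = Poly_Mapping.single (\<Sum>i\<in>Poly_Mapping.keys m. Poly_Mapping.single i (Poly_Mapping.lookup m i)) 1"
    by (simp add: mon_def pow pr)
  also have "(\<Sum>i\<in>Poly_Mapping.keys m. Poly_Mapping.single i (Poly_Mapping.lookup m i)) = m"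
    using poly_mapping_expand[of "Poly_Mapping.keys m" m] by simp
  finally show ?thesis
    by (simp add: mconst_def mult_single)
qed

text \<open>Arbitrary index sets: \<open>{1..n}\<close> for the representation, \<open>UNIV\<close>
  where the variables are unrestricted, \<open>{1..<d}\<close> for the parameter polynomials in the
  lower bound on growth.\<close>

definition polys_in :: "nat set \<Rightarrow> mpoly set" where
  "polys_in S = {p. \<forall>m\<in>Poly_Mapping.keys p. Poly_Mapping.keys m \<subseteq> S}"

lemma polys_eq_polys_in: "polys n = polys_in {1..n}"
  by (simp add: polys_def polys_in_def)

lemma polys_in_UNIV [simp]: "p \<in> polys_in UNIV"
  by (simp add: polys_in_def)

lemma polys_in_add: "p \<in> polys_in S \<Longrightarrow> q \<in> polys_in S \<Longrightarrow> p + q \<in> polys_in S"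
  using keys_add[of p q] by (fastforce simp: polys_in_def)

lemma polys_in_mult:
  assumes "p \<in> polys_in S" "q \<in> polys_in S"
  shows "p * q \<in> polys_in S"
  unfolding polys_in_def
proof (clarify)
  fix m i
  assume "m \<in> Poly_Mapping.keys (p * q)" and i: "i \<in> Poly_Mapping.keys m"
  then obtain a b where "m = a + b" "a \<in> Poly_Mapping.keys p" "b \<in> Poly_Mapping.keys q"
    using keys_mult[of p q] by auto
  then show "i \<in> S"
    using i keys_add[of a b] assms by (auto simp: polys_in_def)
qed

lemma polys_in_mconst [simp]: "mconst c \<in> polys_in S"
  by (simp add: polys_in_def mconst_def)

lemma polys_in_0 [simp]: "0 \<in> polys_in S"
  using polys_in_mconst[of 0 S] by simp

lemma polys_in_1 [simp]: "1 \<in> polys_in S"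
  using polys_in_mconst[of 1 S] by simp

lemma polys_in_mvar: "i \<in> S \<Longrightarrow> mvar i \<in> polys_in S"
  by (simp add: polys_in_def mvar_def)

lemma polys_in_uminus:
  assumes "p \<in> polys_in S" shows "- p \<in> polys_in S"
  using polys_in_mult[OF polys_in_mconst[of "- 1" S] assms] by (simp add: mconst_uminus)

lemma polys_in_diff: "p \<in> polys_in S \<Longrightarrow> q \<in> polys_in S \<Longrightarrow> p - q \<in> polys_in S"
  using polys_in_add[of p S "- q"] polys_in_uminus[of q S] by simp

lemma polys_in_sum: "(\<And>i. i \<in> A \<Longrightarrow> f i \<in> polys_in S) \<Longrightarrow> sum f A \<in> polys_in S"
  by (induction A rule: infinite_finite_induct) (simp_all add: polys_in_add)

lemma polys_in_prod: "(\<And>i. i \<in> A \<Longrightarrow> f i \<in> polys_in S) \<Longrightarrow> prod f A \<in> polys_in S"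
  by (induction A rule: infinite_finite_induct) (simp_all add: polys_in_mult)

lemma polys_in_power: "p \<in> polys_in S \<Longrightarrow> p ^ j \<in> polys_in S"
  by (induction j) (simp_all add: polys_in_mult)

lemma polys_in_induct [consumes 1, case_names const var add mult]:
  assumes "p \<in> polys_in S"
    and const: "\<And>c. P (mconst c)"
    and var: "\<And>i. i \<in> S \<Longrightarrow> P (mvar i)"
    and add: "\<And>p q. p \<in> polys_in S \<Longrightarrow> q \<in> polys_in S \<Longrightarrow> P p \<Longrightarrow> P q \<Longrightarrow> P (p + q)"
    and mult: "\<And>p q. p \<in> polys_in S \<Longrightarrow> q \<in> polys_in S \<Longrightarrow> P p \<Longrightarrow> P q \<Longrightarrow> P (p * q)"
  shows "P p"
proof -
  have pw: "P (mvar i ^ j)" if "i \<in> S" for i j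
    using that const[of 1] by (induction j) (auto intro!: mult polys_in_power polys_in_mvar var)
  have pr: "P (\<Prod>i\<in>A. mvar i ^ f i)" if "finite A" "A \<subseteq> S" for A f
    using that const[of 1]
    by (induction A) (auto intro!: mult polys_in_power polys_in_mvar polys_in_prod pw)
  have mo: "P (Poly_Mapping.single m c) \<and> Poly_Mapping.single m c \<in> polys_in S"
    if "Poly_Mapping.keys m \<subseteq> S" for m c
    unfolding single_eq_mconst_mon using that
    by (auto simp: mon_def intro!: mult const polys_in_mult pr polys_in_prod polys_in_power polys_in_mvar)
  have s: "P (\<Sum>m\<in>A. Poly_Mapping.single m (f m)) \<and> (\<Sum>m\<in>A. Poly_Mapping.single m (f m)) \<in> polys_in S"
    if "finite A" "\<forall>m\<in>A. Poly_Mapping.keys m \<subseteq> S" for A f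
    using that const[of 0] by (induction A) (auto intro!: add polys_in_add simp: mo)
  show ?thesis
    using assms(1) s[of "Poly_Mapping.keys p" "Poly_Mapping.lookup p"]
      poly_mapping_expand[of "Poly_Mapping.keys p" p] by (simp add: polys_in_def)
qed

lemmas mpoly_induct = polys_in_induct[of _ UNIV, simplified, case_names const var add mult]

subsection \<open>Substitution\<close>

lemma msubst_superset:
  assumes "coeff_hom \<phi>" "finite A" "Poly_Mapping.keys p \<subseteq> A"
  shows "msubst \<phi> g p = (\<Sum>m\<in>A. \<phi> (Poly_Mapping.lookup p m) * mon g m)"
  unfolding msubst_def mon_def[symmetric]
  by (rule sum.mono_neutral_left) (use assms in \<open>auto simp: in_keys_iff coeff_hom_simps\<close>)

lemma msubst_single:
  assumes "coeff_hom \<phi>"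
  shows "msubst \<phi> g (Poly_Mapping.single m c) = \<phi> c * mon g m"
  using msubst_superset[OF assms, of "{m}" "Poly_Mapping.single m c" g] by simp

lemma msubst_add:
  assumes "coeff_hom \<phi>"
  shows "msubst \<phi> g (p + q) = msubst \<phi> g p + msubst \<phi> g q"
proof -
  let ?A = "Poly_Mapping.keys p \<union> Poly_Mapping.keys q"
  have A: "finite ?A" "Poly_Mapping.keys p \<subseteq> ?A" "Poly_Mapping.keys q \<subseteq> ?A"
    "Poly_Mapping.keys (p + q) \<subseteq> ?A"
    using keys_add[of p q] by auto
  show ?thesis
    unfolding msubst_superset[OF assms A(1) A(2)] msubst_superset[OF assms A(1) A(3)]
      msubst_superset[OF assms A(1) A(4)]
    by (simp add: lookup_add coeff_hom_simps[OF assms] algebra_simps sum.distrib)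
qed

lemma msubst_0: "coeff_hom \<phi> \<Longrightarrow> msubst \<phi> g 0 = 0"
  by (simp add: msubst_def)

lemma msubst_sum:
  "coeff_hom \<phi> \<Longrightarrow> msubst \<phi> g (sum f A) = (\<Sum>i\<in>A. msubst \<phi> g (f i))"
  by (induction A rule: infinite_finite_induct) (simp_all add: msubst_0 msubst_add)

lemma msubst_mult:
  assumes "coeff_hom \<phi>"
  shows "msubst \<phi> g (p * q) = msubst \<phi> g p * msubst \<phi> g q"
proof -
  have "msubst \<phi> g (Poly_Mapping.single m c * q) = msubst \<phi> g (Poly_Mapping.single m c) * msubst \<phi> g q" for m c
    by (induction q rule: poly_mapping_induct)
      (simp_all add: msubst_single[OF assms] msubst_add[OF assms] mult_single mon_add
        coeff_hom_simps(3)[OF assms] algebra_simps)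
  then show ?thesis
    by (induction p rule: poly_mapping_induct) (simp_all add: msubst_add[OF assms] distrib_right)
qed

lemma msubst_const:
  assumes "coeff_hom \<phi>"
  shows "msubst \<phi> g (mconst c) = \<phi> c"
  using msubst_single[OF assms, of g 0 c] by (simp add: mconst_def)

lemma msubst_var:
  assumes "coeff_hom \<phi>"
  shows "msubst \<phi> g (mvar i) = g i"
  using msubst_single[OF assms, of g "Poly_Mapping.single i 1" 1]
  by (simp add: mvar_def coeff_hom_simps[OF assms])

lemma msubst_1: "coeff_hom \<phi> \<Longrightarrow> msubst \<phi> g 1 = 1"
  using msubst_const[of \<phi> g 1] by (simp add: coeff_hom_simps)

lemma msubst_uminus:
  assumes "coeff_hom \<phi>"
  shows "msubst \<phi> g (- p) = - msubst \<phi> g p"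
  using msubst_add[OF assms, of g p "- p"]
  by (simp add: msubst_0[OF assms] eq_neg_iff_add_eq_0 add.commute)

lemma msubst_diff:
  assumes "coeff_hom \<phi>"
  shows "msubst \<phi> g (p - q) = msubst \<phi> g p - msubst \<phi> g q"
  using msubst_add[OF assms, of g p "- q"] by (simp add: msubst_uminus[OF assms])

lemma msubst_prod:
  "coeff_hom \<phi> \<Longrightarrow> msubst \<phi> g (prod f A) = (\<Prod>i\<in>A. msubst \<phi> g (f i))"
  by (induction A rule: infinite_finite_induct) (simp_all add: msubst_1 msubst_mult)

lemma msubst_power: "coeff_hom \<phi> \<Longrightarrow> msubst \<phi> g (p ^ j) = msubst \<phi> g p ^ j"
  by (induction j) (simp_all add: msubst_1 msubst_mult)

lemmas msubst_simps = msubst_add msubst_mult msubst_const msubst_var msubst_diff msubst_uminus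
  msubst_0 msubst_1 msubst_sum msubst_prod msubst_power

lemmas tsubst_simps = msubst_simps[OF coeff_hom_mconst]

lemma msubst_cong:
  assumes "p \<in> polys_in S" "\<And>i. i \<in> S \<Longrightarrow> g i = h i"
  shows "msubst \<phi> g p = msubst \<phi> h p"
  unfolding msubst_def
proof (intro sum.cong refl arg_cong2[where f = "(*)"] prod.cong)
  fix m i assume "m \<in> Poly_Mapping.keys p" "i \<in> Poly_Mapping.keys m"
  then have "g i = h i" using assms by (auto simp: polys_in_def)
  then show "g i ^ Poly_Mapping.lookup m i = h i ^ Poly_Mapping.lookup m i" by simp
qed

lemma msubst_msubst:
  assumes "coeff_hom \<phi>"
  shows "msubst \<phi> h (msubst mconst g p) = msubst \<phi> (\<lambda>i. msubst \<phi> h (g i)) p"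
  by (induction p rule: mpoly_induct) (simp_all add: tsubst_simps msubst_simps[OF assms])

lemma msubst_mvar: "msubst mconst mvar p = p"
  by (induction p rule: mpoly_induct) (simp_all add: tsubst_simps)

lemma msubst_in_polys_in:
  assumes "p \<in> polys_in S" "\<And>i. i \<in> S \<Longrightarrow> g i \<in> polys_in T"
  shows "msubst mconst g p \<in> polys_in T"
  using assms(1)
  by (induction rule: polys_in_induct) (simp_all add: tsubst_simps assms(2) polys_in_add polys_in_mult)

lemma peval_eq: "peval v p = msubst (\<lambda>c. c) v p"
  by (simp add: peval_def)

lemma peval_simps:
  "peval v (p + q) = peval v p + peval v q"
  "peval v (p * q) = peval v p * peval v q"
  "peval v (mconst c) = c"
  "peval v (mvar i) = v i"
  "peval v (p - q) = peval v p - peval v q"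
  "peval v (- p) = - peval v p"
  "peval v 0 = 0"
  "peval v 1 = 1"
  "peval v (sum f A) = (\<Sum>i\<in>A. peval v (f i))"
  "peval v (prod f A) = (\<Prod>i\<in>A. peval v (f i))"
  "peval v (p ^ j) = peval v p ^ j"
  by (simp_all add: peval_eq msubst_simps[OF coeff_hom_id])

lemma peval_msubst: "peval v (msubst mconst g p) = peval (\<lambda>i. peval v (g i)) p"
  by (simp add: peval_eq msubst_msubst[OF coeff_hom_id])

lemma peval_cong:
  "p \<in> polys_in S \<Longrightarrow> (\<And>i. i \<in> S \<Longrightarrow> v i = w i) \<Longrightarrow> peval v p = peval w p"
  unfolding peval_def by (rule msubst_cong)

lemma peval_expand: "peval v p = (\<Sum>m\<in>Poly_Mapping.keys p. Poly_Mapping.lookup p m * mon v m)"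
  by (simp add: peval_eq msubst_def mon_def)

text \<open>Monomials are distinct characters of the multiplicative monoid of points, hence linearly
  independent.\<close>

lemma mpoly_eq_0I:
  assumes "\<And>v. peval v p = 0"
  shows "p = 0"
  using assms
proof (induction "card (Poly_Mapping.keys p)" arbitrary: p rule: less_induct)
  case less
  show ?case
  proof (rule ccontr)
    assume "p \<noteq> 0"
    then obtain m1 where m1: "m1 \<in> Poly_Mapping.keys p"
      by (metis ex_in_conv keys_eq_empty)
    have only: "m = m1" if m: "m \<in> Poly_Mapping.keys p" for m
    proof (rule ccontr)
      assume "m \<noteq> m1"
      then obtain i where i: "Poly_Mapping.lookup m i \<noteq> Poly_Mapping.lookup m1 i"
        using poly_mapping_eqI[of m m1] by metis
      define v0 :: "nat \<Rightarrow> complex" where "v0 = (\<lambda>j. if j = i then 2 else 1)"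
      have mon0: "mon v0 m' = 2 ^ Poly_Mapping.lookup m' i" for m'
      proof -
        have "mon v0 m' = (\<Prod>j\<in>insert i (Poly_Mapping.keys m'). if j = i then 2 ^ Poly_Mapping.lookup m' i else 1)"
          unfolding mon_superset[of "insert i (Poly_Mapping.keys m')", OF finite.insertI[OF finite_keys] subset_insertI]
          by (rule prod.cong) (auto simp: v0_def)
        then show ?thesis by (simp add: prod.delta)
      qed
      \<comment> \<open>The polynomial p(v0 v) - \<open>mon v0 m1\<close> p(v), which again vanishes
        everywhere. It loses the term at \<open>m1\<close>, so it has fewer terms, while the
        coefficient at \<open>m\<close> is multiplied by a nonzero number because \<open>v0\<close>
        separates the exponents of x_i.\<close>
      define q where "q = (\<Sum>m'\<in>Poly_Mapping.keys p - {m1}. Poly_Mapping.single m'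
          ((mon v0 m' - mon v0 m1) * Poly_Mapping.lookup p m'))"
      have lq: "Poly_Mapping.lookup q m' = (mon v0 m' - mon v0 m1) * Poly_Mapping.lookup p m'" for m'
      proof -
        have "Poly_Mapping.lookup q m' = (if m' \<in> Poly_Mapping.keys p - {m1}
            then (mon v0 m' - mon v0 m1) * Poly_Mapping.lookup p m' else 0)"
          unfolding q_def lookup_sum lookup_single when_def by (rule sum.delta) simp
        then show ?thesis
          by (cases "m' = m1") (simp_all add: in_keys_iff)
      qed
      have "Poly_Mapping.keys q \<subseteq> Poly_Mapping.keys p - {m1}"
        by (auto simp: in_keys_iff lq)
      then have "card (Poly_Mapping.keys q) < card (Poly_Mapping.keys p)"
        by (intro psubset_card_mono finite_keys) (use m1 in blast)
      moreover have "peval v q = 0" for v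
      proof -
        have "peval v q = (\<Sum>m\<in>Poly_Mapping.keys p. Poly_Mapping.lookup q m * mon v m)"
          unfolding peval_eq
          by (rule msubst_superset[OF coeff_hom_id]) (auto simp: in_keys_iff lq)
        also have "\<dots> = peval (\<lambda>i. v0 i * v i) p - mon v0 m1 * peval v p"
          by (simp add: peval_expand lq mon_mult sum_distrib_left flip: sum_subtractf)
            (simp add: algebra_simps)
        finally show ?thesis using less.prems by simp
      qed
      ultimately have "q = 0"
        using less.hyps by blast
      then have "(mon v0 m - mon v0 m1) * Poly_Mapping.lookup p m = 0"
        using lq[of m] by simp
      moreover have "(2::complex) ^ a \<noteq> 2 ^ b" if "a \<noteq> b" for a b :: nat
      proof
        assume "(2::complex) ^ a = 2 ^ b"
        then have "(of_nat (2 ^ a) :: complex) = of_nat (2 ^ b)" by simp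
        then show False using that unfolding of_nat_eq_iff by simp
      qed
      ultimately show False
        using i m by (auto simp: mon0 in_keys_iff)
    qed
    have "Poly_Mapping.keys p = {m1}"
      using m1 only by blast
    then have "peval (\<lambda>i. 1) p = Poly_Mapping.lookup p m1"
      by (simp add: peval_expand mon_def)
    then show False
      using m1 less.prems by (simp add: in_keys_iff)
  qed
qed

lemma mpoly_eqI: "(\<And>v. peval v p = peval v q) \<Longrightarrow> p = q"
  using mpoly_eq_0I[of "p - q"] by (simp add: peval_simps)

subsection \<open>Derivatives\<close>

lemma pderiv_var_superset:
  assumes "finite A" "Poly_Mapping.keys p \<subseteq> A"
  shows "pderiv_var i p = (\<Sum>m\<in>A. Poly_Mapping.single (m - Poly_Mapping.single i 1)
        (of_nat (Poly_Mapping.lookup m i) * Poly_Mapping.lookup p m))"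
  unfolding pderiv_var_def
  by (rule sum.mono_neutral_left) (use assms in \<open>auto simp: in_keys_iff\<close>)

lemma pderiv_var_single:
  "pderiv_var i (Poly_Mapping.single m c) =
    Poly_Mapping.single (m - Poly_Mapping.single i 1) (of_nat (Poly_Mapping.lookup m i) * c)"
  using pderiv_var_superset[of "{m}" "Poly_Mapping.single m c" i] by simp

lemma pderiv_var_add: "pderiv_var i (p + q) = pderiv_var i p + pderiv_var i q"
proof -
  let ?A = "Poly_Mapping.keys p \<union> Poly_Mapping.keys q"
  have A: "finite ?A" "Poly_Mapping.keys p \<subseteq> ?A" "Poly_Mapping.keys q \<subseteq> ?A"
    "Poly_Mapping.keys (p + q) \<subseteq> ?A"
    using keys_add[of p q] by auto
  show ?thesis
    unfolding pderiv_var_superset[OF A(1) A(2)] pderiv_var_superset[OF A(1) A(3)]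
      pderiv_var_superset[OF A(1) A(4)]
    by (simp add: lookup_add algebra_simps sum.distrib single_add)
qed

lemma pderiv_var_0 [simp]: "pderiv_var i 0 = 0"
  by (simp add: pderiv_var_def)

lemma pderiv_var_sum: "pderiv_var i (sum f A) = (\<Sum>j\<in>A. pderiv_var i (f j))"
  by (induction A rule: infinite_finite_induct) (simp_all add: pderiv_var_add)

lemma pderiv_var_mult: "pderiv_var i (p * q) = pderiv_var i p * q + p * pderiv_var i q"
proof -
  let ?e = "Poly_Mapping.single i (Suc 0)"
  have sh: "m + m' - ?e = (m - ?e) + m'" if "Poly_Mapping.lookup m i \<noteq> 0" for m m' :: "nat \<Rightarrow>\<^sub>0 nat"
    using that by (intro poly_mapping_eqI) (auto simp: lookup_add lookup_minus lookup_single when_def)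
  have single: "pderiv_var i (Poly_Mapping.single m c * Poly_Mapping.single m' c') =
      pderiv_var i (Poly_Mapping.single m c) * Poly_Mapping.single m' c' +
      Poly_Mapping.single m c * pderiv_var i (Poly_Mapping.single m' c')" for m m' c c'
  proof -
    have 1: "Poly_Mapping.single (m + m' - ?e) (of_nat (Poly_Mapping.lookup m i) * (c * c')) =
      Poly_Mapping.single ((m - ?e) + m') (of_nat (Poly_Mapping.lookup m i) * (c * c'))"
      by (cases "Poly_Mapping.lookup m i = 0") (simp_all add: sh)
    have 2: "Poly_Mapping.single (m + m' - ?e) (of_nat (Poly_Mapping.lookup m' i) * (c * c')) =
      Poly_Mapping.single (m + (m' - ?e)) (of_nat (Poly_Mapping.lookup m' i) * (c * c'))"
      using sh[of m' m] by (cases "Poly_Mapping.lookup m' i = 0") (simp_all add: add.commute)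
    show ?thesis
      by (simp add: mult_single pderiv_var_single lookup_add algebra_simps single_add)
        (use 1 2 in \<open>simp add: algebra_simps\<close>)
  qed
  have "pderiv_var i (Poly_Mapping.single m c * q) =
      pderiv_var i (Poly_Mapping.single m c) * q + Poly_Mapping.single m c * pderiv_var i q" for m c
    by (induction q rule: poly_mapping_induct) (simp_all only: single pderiv_var_add distrib_left add_ac)
  then show ?thesis
    by (induction p rule: poly_mapping_induct) (simp_all only: pderiv_var_add distrib_right add_ac)
qed

lemma pderiv_var_mconst [simp]: "pderiv_var i (mconst c) = 0"
  by (simp add: mconst_def pderiv_var_single)

lemma pderiv_var_1 [simp]: "pderiv_var i 1 = 0"
  using pderiv_var_mconst[of i 1] by simp

lemma pderiv_var_mvar: "pderiv_var i (mvar j) = (if i = j then 1 else 0)"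
  by (simp add: mvar_def pderiv_var_single lookup_single when_def)

lemma pderiv_var_uminus: "pderiv_var i (- p) = - pderiv_var i p"
  using pderiv_var_add[of i p "- p"] by (simp add: eq_neg_iff_add_eq_0 add.commute)

lemma pderiv_var_diff: "pderiv_var i (p - q) = pderiv_var i p - pderiv_var i q"
  using pderiv_var_add[of i p "- q"] by (simp add: pderiv_var_uminus)

lemma pderiv_var_power_mvar:
  "pderiv_var i ((- mvar j) ^ m) = (if i = j then - of_nat m * (- mvar j) ^ (m - 1) else 0)"
proof (induction m)
  case (Suc m)
  then show ?case
    by (cases m) (auto simp: pderiv_var_mult pderiv_var_uminus pderiv_var_mvar algebra_simps)
qed simp

lemmas pderiv_var_simps = pderiv_var_add pderiv_var_mult pderiv_var_mvar pderiv_var_uminus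
  pderiv_var_diff pderiv_var_sum

lemma pderiv_var_in_polys_in:
  assumes "p \<in> polys_in S" shows "pderiv_var i p \<in> polys_in S"
  using assms
  by (induction rule: polys_in_induct)
    (simp_all add: pderiv_var_simps polys_in_add polys_in_mult)

text \<open>The chain rule for any derivation of the target ring that kills the constants. It serves
  partial derivatives after permuting or translating the variables, and the derivative along the
  diagonal.\<close>

lemma derivation_msubst:
  assumes \<phi>: "coeff_hom \<phi>"
    and add: "\<And>a b. \<delta> (a + b) = \<delta> a + \<delta> b"
    and mult: "\<And>a b. \<delta> (a * b) = \<delta> a * b + a * \<delta> b"
    and const: "\<And>c. \<delta> (\<phi> c) = 0"
    and "finite S" "p \<in> polys_in S"
  shows "\<delta> (msubst \<phi> g p) = (\<Sum>i\<in>S. msubst \<phi> g (pderiv_var i p) * \<delta> (g i))"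
  using \<open>p \<in> polys_in S\<close>
proof (induction rule: polys_in_induct)
  case (var j)
  then show ?case
    using \<open>finite S\<close>
    by (simp add: pderiv_var_mvar msubst_simps[OF \<phi>] if_distrib[of "msubst \<phi> g"] if_distrib[of "\<lambda>a. a * _"]
      sum.delta cong: if_cong)
next
  case (mult p q)
  then show ?case
    by (simp add: pderiv_var_simps msubst_simps[OF \<phi>] assms(3) algebra_simps sum.distrib sum_distrib_left)
qed (simp_all add: pderiv_var_simps msubst_simps[OF \<phi>] const add algebra_simps sum.distrib)

section \<open>Dunkl operators\<close>

lemma perm_poly_simps:
  "perm_poly w (p + q) = perm_poly w p + perm_poly w q"
  "perm_poly w (p * q) = perm_poly w p * perm_poly w q"
  "perm_poly w (mconst c) = mconst c"
  "perm_poly w (mvar i) = mvar (w i)"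
  "perm_poly w (p - q) = perm_poly w p - perm_poly w q"
  "perm_poly w (- p) = - perm_poly w p"
  "perm_poly w 0 = 0"
  "perm_poly w 1 = 1"
  "perm_poly w (sum f A) = (\<Sum>i\<in>A. perm_poly w (f i))"
  by (simp_all add: perm_poly_def tsubst_simps)

lemma perm_poly_perm_poly: "perm_poly u (perm_poly w p) = perm_poly (u \<circ> w) p"
  by (simp add: perm_poly_def msubst_msubst[OF coeff_hom_mconst] tsubst_simps)

lemma perm_poly_id [simp]: "perm_poly id p = p"
  by (simp add: perm_poly_def msubst_mvar)

lemma perm_poly_in_polys_in: "p \<in> polys_in S \<Longrightarrow> w ` S \<subseteq> T \<Longrightarrow> perm_poly w p \<in> polys_in T"
  unfolding perm_poly_def by (rule msubst_in_polys_in) (auto intro: polys_in_mvar)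

lemma perm_poly_permutes: "w permutes S \<Longrightarrow> p \<in> polys_in S \<Longrightarrow> perm_poly w p \<in> polys_in S"
  by (rule perm_poly_in_polys_in[where S = S]) (simp_all add: permutes_image)

lemma peval_perm_poly: "peval v (perm_poly w p) = peval (v \<circ> w) p"
  by (simp add: perm_poly_def peval_msubst peval_simps comp_def)

section \<open>Divided differences along transpositions\<close>

lemma peval_alpha: "peval v (alpha i j) = v i - v j"
  by (simp add: alpha_def peval_simps)

lemma alpha_nonzero: "i \<noteq> j \<Longrightarrow> alpha i j \<noteq> 0"
  using peval_alpha[of "\<lambda>l. if l = i then 1 else 0" i j] by (auto simp: peval_simps)

text \<open>Divisibility by \<open>alpha i j\<close> passes to products through the twisted Leibniz
  rule p q - s(p q) = (p - s p) q + s(p) (q - s q). Existence is proved inside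
  \<open>polys_in S\<close>, so the quotient brings in no new variables.\<close>

lemma divdiff_exists:
  assumes "p \<in> polys_in S" "i \<in> S" "j \<in> S"
  shows "\<exists>q\<in>polys_in S. alpha i j * q = p - perm_poly (transpose i j) p"
  using assms(1)
proof (induction rule: polys_in_induct)
  case (const c)
  then show ?case by (intro bexI[of _ 0]) (simp_all add: perm_poly_simps)
next
  case (var l)
  have "alpha i j * (if l = i then 1 else if l = j then - 1 else 0) =
      mvar l - perm_poly (transpose i j) (mvar l)"
    by (auto simp: perm_poly_simps alpha_def transpose_def)
  then show ?case by (intro bexI) (auto simp: polys_in_uminus)
next
  case (add p q)
  then obtain p' q' where "p' \<in> polys_in S" "q' \<in> polys_in S"
    "alpha i j * p' = p - perm_poly (transpose i j) p" "alpha i j * q' = q - perm_poly (transpose i j) q"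
    by blast
  then show ?case
    by (intro bexI[of _ "p' + q'"]) (simp_all add: perm_poly_simps distrib_left polys_in_add)
next
  case (mult p q)
  then obtain p' q' where pq: "p' \<in> polys_in S" "q' \<in> polys_in S"
    "alpha i j * p' = p - perm_poly (transpose i j) p" "alpha i j * q' = q - perm_poly (transpose i j) q"
    by blast
  have "alpha i j * (p' * q + perm_poly (transpose i j) p * q') =
      (alpha i j * p') * q + perm_poly (transpose i j) p * (alpha i j * q')"
    by (simp add: algebra_simps)
  also have "\<dots> = p * q - perm_poly (transpose i j) (p * q)"
    unfolding pq by (simp add: perm_poly_simps algebra_simps)
  finally show ?case
    using pq mult assms
    by (intro bexI[of _ "p' * q + perm_poly (transpose i j) p * q'"])
      (auto intro!: polys_in_add polys_in_mult perm_poly_permutes permutes_swap_id)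
qed

lemma divdiffI:
  assumes "i \<noteq> j" "alpha i j * q = p - perm_poly (transpose i j) p"
  shows "divdiff i j p = q"
  unfolding divdiff_def
proof (rule the_equality)
  fix q' assume "alpha i j * q' = p - perm_poly (transpose i j) p"
  then show "q' = q"
    using assms alpha_nonzero[of i j] by (metis mult_left_cancel)
qed fact

lemma alpha_mult_divdiff:
  assumes "i \<noteq> j"
  shows "alpha i j * divdiff i j p = p - perm_poly (transpose i j) p"
  using divdiff_exists[of p UNIV i j] divdiffI[OF assms] by auto

lemma divdiff_in_polys_in:
  assumes "i \<noteq> j" "p \<in> polys_in S" "i \<in> S" "j \<in> S"
  shows "divdiff i j p \<in> polys_in S"
  using divdiff_exists[of p S i j] assms divdiffI by auto

lemma divdiff_add: "i \<noteq> j \<Longrightarrow> divdiff i j (p + q) = divdiff i j p + divdiff i j q"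
  by (rule divdiffI) (simp_all add: distrib_left alpha_mult_divdiff perm_poly_simps)

lemma divdiff_mult:
  assumes "i \<noteq> j"
  shows "divdiff i j (p * q) = p * divdiff i j q + divdiff i j p * perm_poly (transpose i j) q"
proof (rule divdiffI)
  have "alpha i j * (p * divdiff i j q + divdiff i j p * perm_poly (transpose i j) q) =
    p * (alpha i j * divdiff i j q) + (alpha i j * divdiff i j p) * perm_poly (transpose i j) q"
    by (simp add: algebra_simps)
  then show "alpha i j * (p * divdiff i j q + divdiff i j p * perm_poly (transpose i j) q) =
      p * q - perm_poly (transpose i j) (p * q)"
    by (simp add: alpha_mult_divdiff assms perm_poly_simps algebra_simps)
qed fact

lemma divdiff_mconst: "i \<noteq> j \<Longrightarrow> divdiff i j (mconst c) = 0"
  by (rule divdiffI) (simp_all add: perm_poly_simps)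

lemma divdiff_mconst_mult: "i \<noteq> j \<Longrightarrow> divdiff i j (mconst c * p) = mconst c * divdiff i j p"
  by (simp add: divdiff_mult divdiff_mconst)

lemma divdiff_0: "i \<noteq> j \<Longrightarrow> divdiff i j 0 = 0"
  using divdiff_mconst[of i j 0] by simp

lemma divdiff_1: "i \<noteq> j \<Longrightarrow> divdiff i j 1 = 0"
  using divdiff_mconst[of i j 1] by simp

lemma divdiff_sum: "i \<noteq> j \<Longrightarrow> divdiff i j (sum f A) = (\<Sum>l\<in>A. divdiff i j (f l))"
  by (induction A rule: infinite_finite_induct) (simp_all add: divdiff_0 divdiff_add)

lemma divdiff_mvar:
  "i \<noteq> j \<Longrightarrow> divdiff i j (mvar l) = (if l = i then 1 else if l = j then - 1 else 0)"
  by (rule divdiffI) (auto simp: perm_poly_simps alpha_def transpose_def)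

lemma divdiff_swap: "i \<noteq> j \<Longrightarrow> divdiff j i p = - divdiff i j p"
  using alpha_mult_divdiff[of i j p]
  by (intro divdiffI) (simp_all add: alpha_def transpose_commute[of j i] algebra_simps)

lemma comp_transpose_inj: "inj w \<Longrightarrow> w \<circ> transpose i j = transpose (w i) (w j) \<circ> w"
  by (auto simp: fun_eq_iff transpose_def inj_eq)

lemma divdiff_perm_poly:
  assumes "inj w" "i \<noteq> j"
  shows "perm_poly w (divdiff i j p) = divdiff (w i) (w j) (perm_poly w p)"
proof (rule sym, rule divdiffI)
  show "w i \<noteq> w j"
    using assms by (simp add: inj_eq)
  have "alpha (w i) (w j) * perm_poly w (divdiff i j p) = perm_poly w (alpha i j * divdiff i j p)"
    by (simp add: alpha_def perm_poly_simps)
  then show "alpha (w i) (w j) * perm_poly w (divdiff i j p) =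
      perm_poly w p - perm_poly (transpose (w i) (w j)) (perm_poly w p)"
    by (simp add: alpha_mult_divdiff assms perm_poly_simps perm_poly_perm_poly comp_transpose_inj)
qed

lemma pderiv_var_perm_poly:
  assumes "w permutes {1..n}" "p \<in> polys_in {1..n}" "i \<in> {1..n}"
  shows "pderiv_var (w i) (perm_poly w p) = perm_poly w (pderiv_var i p)"
proof -
  have "pderiv_var (w i) (perm_poly w p) =
      (\<Sum>l\<in>{1..n}. perm_poly w (pderiv_var l p) * pderiv_var (w i) (mvar (w l)))"
    unfolding perm_poly_def
    by (rule derivation_msubst[OF coeff_hom_mconst _ _ _ finite_atLeastAtMost assms(2)])
      (simp_all add: pderiv_var_simps)
  also have "\<dots> = (\<Sum>l\<in>{1..n}. if l = i then perm_poly w (pderiv_var l p) else 0)"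
    using permutes_inj[OF assms(1)] by (intro sum.cong) (auto simp: pderiv_var_mvar inj_eq)
  also have "\<dots> = perm_poly w (pderiv_var i p)"
    using assms(3) by (simp add: sum.delta)
  finally show ?thesis .
qed

section \<open>Sums over transpositions and formal rules for Dunkl operators\<close>

lemma finite_transp_pairs [simp]: "finite (transp_pairs n)"
  by (rule finite_subset[of _ "{1..n} \<times> {1..n}"]) (auto simp: transp_pairs_def)

lemma transp_pairsD:
  "(i, j) \<in> transp_pairs n \<Longrightarrow> i \<noteq> j \<and> i \<in> {1..n} \<and> j \<in> {1..n} \<and> transpose i j permutes {1..n}"
  by (auto simp: transp_pairs_def intro!: permutes_swap_id)

text \<open>A permutation does not preserve the order i < j that selects one representative of each
  transposition. Sums over ordered pairs can be reindexed freely; they count every transposition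
  twice.\<close>

lemma sum_off_diagonal:
  fixes g :: "nat \<Rightarrow> nat \<Rightarrow> 'a::comm_monoid_add"
  assumes "\<And>i j. g i j = g j i"
  shows "(\<Sum>i\<in>{1..n}. \<Sum>j\<in>{1..n} - {i}. g i j) =
    (\<Sum>(i, j)\<in>transp_pairs n. g i j) + (\<Sum>(i, j)\<in>transp_pairs n. g i j)"
proof -
  have "(\<Sum>i\<in>{1..n}. \<Sum>j\<in>{1..n} - {i}. g i j) = (\<Sum>(i, j)\<in>(SIGMA i:{1..n}. {1..n} - {i}). g i j)"
    by (rule sum.Sigma) auto
  also have "(SIGMA i:{1..n}. {1..n} - {i}) = transp_pairs n \<union> prod.swap ` transp_pairs n"
    by (auto simp: transp_pairs_def image_iff)
  also have "(\<Sum>(i, j)\<in>\<dots>. g i j) =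
      (\<Sum>(i, j)\<in>transp_pairs n. g i j) + (\<Sum>(i, j)\<in>prod.swap ` transp_pairs n. g i j)"
    by (rule sum.union_disjoint[OF finite_transp_pairs finite_imageI[OF finite_transp_pairs]])
      (auto simp: transp_pairs_def)
  also have "(\<Sum>(i, j)\<in>prod.swap ` transp_pairs n. g i j) = (\<Sum>(i, j)\<in>transp_pairs n. g i j)"
    by (subst sum.reindex) (auto intro!: sum.cong simp: assms)
  finally show ?thesis .
qed

lemma sum_transp_pairs_permutes:
  fixes g :: "nat \<Rightarrow> nat \<Rightarrow> mpoly"
  assumes w: "w permutes {1..n}" and sym: "\<And>i j. g i j = g j i"
  shows "(\<Sum>(i, j)\<in>transp_pairs n. g (w i) (w j)) = (\<Sum>(i, j)\<in>transp_pairs n. g i j)"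
proof -
  have bij: "bij_betw w {1..n} {1..n}"
    using w by (rule permutes_imp_bij)
  have "(\<Sum>i\<in>{1..n}. \<Sum>j\<in>{1..n} - {i}. g (w i) (w j)) = (\<Sum>i\<in>{1..n}. \<Sum>j\<in>{1..n} - {w i}. g (w i) j)"
  proof (rule sum.cong[OF refl])
    fix i assume i: "i \<in> {1..n}"
    have "w ` ({1..n} - {i}) = w ` {1..n} - w ` {i}"
      by (rule image_set_diff[OF permutes_inj[OF w]])
    then have "bij_betw w ({1..n} - {i}) ({1..n} - {w i})"
      using inj_on_subset[OF permutes_inj[OF w]] permutes_image[OF w] by (simp add: bij_betw_def)
    then show "(\<Sum>j\<in>{1..n} - {i}. g (w i) (w j)) = (\<Sum>j\<in>{1..n} - {w i}. g (w i) j)"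
      by (rule sum.reindex_bij_betw)
  qed
  also have "\<dots> = (\<Sum>i\<in>{1..n}. \<Sum>j\<in>{1..n} - {i}. g i j)"
    by (rule sum.reindex_bij_betw[OF bij])
  finally have "2 * (\<Sum>(i, j)\<in>transp_pairs n. g (w i) (w j)) = 2 * (\<Sum>(i, j)\<in>transp_pairs n. g i j)"
    by (simp only: sum_off_diagonal[OF sym] sum_off_diagonal[of "\<lambda>i j. g (w i) (w j)", OF sym] mult_2)
  then show ?thesis
    by simp
qed

lemma dunkl_eq:
  "dunkl n k v p = (\<Sum>i\<in>{1..n}. mconst (v i) * pderiv_var i p)
     - mconst k * (\<Sum>(i, j)\<in>transp_pairs n. mconst (v i - v j) * divdiff i j p)"
  by (simp add: dunkl_def peval_alpha)

text \<open>The transposition is made to act on q, not on p. If q is one of the f_i, then D_v q = 0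
  and every remaining term is a multiple of f_i or of a permuted f_l; this makes the ideal generated
  by the f_i stable.\<close>

lemma dunkl_mult:
  "dunkl n k v (p * q) = p * dunkl n k v q + (\<Sum>i\<in>{1..n}. mconst (v i) * pderiv_var i p) * q
     - mconst k * (\<Sum>(i, j)\<in>transp_pairs n. mconst (v i - v j) * divdiff i j p * perm_poly (transpose i j) q)"
proof -
  have "(\<Sum>(i, j)\<in>transp_pairs n. mconst (v i - v j) * divdiff i j (p * q)) =
    (\<Sum>(i, j)\<in>transp_pairs n. p * (mconst (v i - v j) * divdiff i j q)
       + mconst (v i - v j) * divdiff i j p * perm_poly (transpose i j) q)"
    by (intro sum.cong) (auto dest!: transp_pairsD simp: divdiff_mult algebra_simps)
  also have "\<dots> = p * (\<Sum>(i, j)\<in>transp_pairs n. mconst (v i - v j) * divdiff i j q)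
     + (\<Sum>(i, j)\<in>transp_pairs n. mconst (v i - v j) * divdiff i j p * perm_poly (transpose i j) q)"
    by (simp add: sum.distrib sum_distrib_left split_beta)
  moreover have "(\<Sum>i\<in>{1..n}. mconst (v i) * pderiv_var i (p * q)) =
     p * (\<Sum>i\<in>{1..n}. mconst (v i) * pderiv_var i q) + (\<Sum>i\<in>{1..n}. mconst (v i) * pderiv_var i p) * q"
    by (simp add: pderiv_var_simps sum.distrib sum_distrib_left sum_distrib_right algebra_simps)
  ultimately show ?thesis
    by (simp add: dunkl_eq algebra_simps)
qed

lemma dunkl_add: "dunkl n k v (p + q) = dunkl n k v p + dunkl n k v q"
proof -
  have "(\<Sum>(i, j)\<in>transp_pairs n. mconst (v i - v j) * divdiff i j (p + q)) =
    (\<Sum>(i, j)\<in>transp_pairs n. mconst (v i - v j) * divdiff i j p + mconst (v i - v j) * divdiff i j q)"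
    by (intro sum.cong) (auto dest!: transp_pairsD simp: divdiff_add algebra_simps)
  then show ?thesis
    by (simp add: dunkl_eq pderiv_var_simps sum.distrib algebra_simps split_beta)
qed

lemma dunkl_mconst_mult: "dunkl n k v (mconst c * p) = mconst c * dunkl n k v p"
proof -
  have "(\<Sum>(i, j)\<in>transp_pairs n. mconst (v i - v j) * divdiff i j (mconst c) * perm_poly (transpose i j) p) = 0"
    by (intro sum.neutral) (auto dest!: transp_pairsD simp: divdiff_mconst)
  then show ?thesis
    by (simp add: dunkl_mult)
qed

lemma dunkl_0: "dunkl n k v 0 = 0"
  using dunkl_mconst_mult[of n k v 0 0] by simp

lemma dunkl_diff: "dunkl n k v (p - q) = dunkl n k v p - dunkl n k v q"
  using dunkl_add[of n k v "p - q" q] by simp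

lemma dunkl_sum: "dunkl n k v (sum f A) = (\<Sum>i\<in>A. dunkl n k v (f i))"
  by (induction A rule: infinite_finite_induct) (simp_all add: dunkl_0 dunkl_add)

lemma dunkl_1: "dunkl n k v 1 = 0"
proof -
  have "(\<Sum>(i, j)\<in>transp_pairs n. mconst (v i - v j) * divdiff i j 1) = 0"
    by (intro sum.neutral) (auto dest!: transp_pairsD simp: divdiff_1)
  then show ?thesis
    by (simp add: dunkl_eq)
qed

lemma dunkl_vec_add: "dunkl n k (\<lambda>i. u i + v i) p = dunkl n k u p + dunkl n k v p"
proof -
  have "(\<Sum>(i, j)\<in>transp_pairs n. mconst (u i + v i - (u j + v j)) * divdiff i j p) =
    (\<Sum>(i, j)\<in>transp_pairs n. mconst (u i - u j) * divdiff i j p + mconst (v i - v j) * divdiff i j p)"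
    by (intro sum.cong) (auto simp: mconst_add mconst_diff algebra_simps)
  then show ?thesis
    by (simp add: dunkl_eq sum.distrib mconst_add algebra_simps split_beta)
qed

lemma dunkl_vec_scale: "dunkl n k (\<lambda>i. c * v i) p = mconst c * dunkl n k v p"
proof -
  have "(\<Sum>(i, j)\<in>transp_pairs n. mconst (c * v i - c * v j) * divdiff i j p) =
    (\<Sum>(i, j)\<in>transp_pairs n. mconst c * (mconst (v i - v j) * divdiff i j p))"
    by (intro sum.cong) (auto simp: mconst_mult mconst_diff algebra_simps)
  then show ?thesis
    by (simp add: dunkl_eq sum_distrib_left mconst_mult algebra_simps split_beta)
qed

lemma dunkl_perm_poly:
  assumes w: "w permutes {1..n}" and p: "p \<in> polys_in {1..n}"
  shows "perm_poly w (dunkl n k v p) = dunkl n k (perm_vec w v) (perm_poly w p)"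
proof -
  have inv: "inv_into UNIV w (w i) = i" for i
    using permutes_inverses[OF w] by simp
  have "(\<Sum>i\<in>{1..n}. mconst (perm_vec w v i) * pderiv_var i (perm_poly w p)) =
      (\<Sum>i\<in>{1..n}. mconst (perm_vec w v (w i)) * pderiv_var (w i) (perm_poly w p))"
    by (rule sum.reindex_bij_betw[OF permutes_imp_bij[OF w], symmetric])
  also have "\<dots> = (\<Sum>i\<in>{1..n}. mconst (v i) * perm_poly w (pderiv_var i p))"
    by (intro sum.cong) (auto simp: perm_vec_def inv pderiv_var_perm_poly[OF w p])
  finally have 1: "(\<Sum>i\<in>{1..n}. mconst (perm_vec w v i) * pderiv_var i (perm_poly w p)) =
      (\<Sum>i\<in>{1..n}. mconst (v i) * perm_poly w (pderiv_var i p))" .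
  define g where "g i j = (if i = j then 0 else mconst (perm_vec w v i - perm_vec w v j) * divdiff i j (perm_poly w p))" for i j
  have g_sym: "g i j = g j i" for i j
    unfolding g_def using divdiff_swap[of i j] by (auto simp: mconst_diff algebra_simps)
  have "(\<Sum>(i, j)\<in>transp_pairs n. mconst (perm_vec w v i - perm_vec w v j) * divdiff i j (perm_poly w p)) =
      (\<Sum>(i, j)\<in>transp_pairs n. g i j)"
    by (intro sum.cong) (auto simp: g_def dest: transp_pairsD)
  also have "\<dots> = (\<Sum>(i, j)\<in>transp_pairs n. g (w i) (w j))"
    by (rule sum_transp_pairs_permutes[OF w g_sym, symmetric])
  also have "\<dots> = (\<Sum>(i, j)\<in>transp_pairs n. mconst (v i - v j) * perm_poly w (divdiff i j p))"
    using permutes_inj[OF w]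
    by (intro sum.cong) (auto simp: g_def perm_vec_def inv divdiff_perm_poly inj_eq dest: transp_pairsD)
  finally show ?thesis
    using 1 by (simp add: dunkl_eq perm_poly_simps split_beta)
qed

section \<open>Linear forms and the commutativity of the Dunkl operators\<close>

definition linear_form :: "nat \<Rightarrow> (nat \<Rightarrow> complex) \<Rightarrow> mpoly" where
  "linear_form n c = (\<Sum>i\<in>{1..n}. mconst (c i) * mvar i)"

lemma linear_form_in_polys: "linear_form n c \<in> polys_in {1..n}"
  by (auto simp: linear_form_def intro!: polys_in_sum polys_in_mult polys_in_mvar)

lemma peval_linear_form: "peval v (linear_form n c) = (\<Sum>i\<in>{1..n}. c i * v i)"
  by (simp add: linear_form_def peval_simps)

lemma mvar_eq_linear_form: "l \<in> {1..n} \<Longrightarrow> mvar l = linear_form n (\<lambda>i. if i = l then 1 else 0)"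
  by (simp add: linear_form_def if_distrib[of mconst] if_distrib[of "\<lambda>a. a * _"] sum.delta cong: if_cong)

lemma pderiv_var_linear_form: "i \<in> {1..n} \<Longrightarrow> pderiv_var i (linear_form n c) = mconst (c i)"
  by (simp add: linear_form_def pderiv_var_simps if_distrib sum.delta cong: if_cong)

lemma divdiff_linear_form:
  assumes "i \<noteq> j" "i \<in> {1..n}" "j \<in> {1..n}"
  shows "divdiff i j (linear_form n c) = mconst (c i - c j)"
proof -
  have "divdiff i j (linear_form n c) =
      (\<Sum>l\<in>{1..n}. (if l = i then mconst (c l) else 0) - (if l = j then mconst (c l) else 0))"
    unfolding linear_form_def divdiff_sum[OF assms(1)]
    by (intro sum.cong) (auto simp: divdiff_mconst_mult divdiff_mvar assms(1))
  also have "\<dots> = mconst (c i - c j)"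
    unfolding sum_subtractf using assms by (simp add: sum.delta mconst_diff)
  finally show ?thesis .
qed

lemma peval_coalpha_linear_form:
  assumes "i \<noteq> j" "i \<in> {1..n}" "j \<in> {1..n}"
  shows "peval (coalpha i j) (linear_form n c) = c i - c j"
proof -
  have "peval (coalpha i j) (linear_form n c) =
      (\<Sum>l\<in>{1..n}. (if l = i then c l else 0) - (if l = j then c l else 0))"
    unfolding peval_linear_form by (intro sum.cong) (auto simp: coalpha_def assms(1))
  also have "\<dots> = c i - c j"
    unfolding sum_subtractf using assms by (simp add: sum.delta)
  finally show ?thesis .
qed

lemma dunkl_linear_form_mult:
  "dunkl n k v (linear_form n c * p) = linear_form n c * dunkl n k v p + mconst (peval v (linear_form n c)) * p
     - mconst k * (\<Sum>(i, j)\<in>transp_pairs n. mconst ((v i - v j) * (c i - c j)) * perm_poly (transpose i j) p)"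
proof -
  have "(\<Sum>(i, j)\<in>transp_pairs n. mconst (v i - v j) * divdiff i j (linear_form n c) * perm_poly (transpose i j) p) =
    (\<Sum>(i, j)\<in>transp_pairs n. mconst ((v i - v j) * (c i - c j)) * perm_poly (transpose i j) p)"
    by (intro sum.cong) (auto dest!: transp_pairsD simp: divdiff_linear_form mconst_mult)
  moreover have "(\<Sum>i\<in>{1..n}. mconst (v i) * pderiv_var i (linear_form n c)) = mconst (peval v (linear_form n c))"
    by (simp add: pderiv_var_linear_form peval_linear_form mconst_sum mconst_mult mult.commute)
  ultimately show ?thesis
    by (simp add: dunkl_mult)
qed

text \<open>The reflection formula s v = v - (v_i - v_j) (e_i - e_j), inserted into the linear
  dependence of the Dunkl operator on its vector.\<close>

lemma dunkl_perm_vec_transpose: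
  assumes "(i, j) \<in> transp_pairs n"
  shows "dunkl n k (perm_vec (transpose i j) v) p =
    dunkl n k v p - mconst (v i - v j) * dunkl n k (coalpha i j) p"
proof -
  have eq: "perm_vec (transpose i j) v = (\<lambda>l. v l + (v j - v i) * coalpha i j l)"
    using transp_pairsD[OF assms] by (auto simp: perm_vec_def coalpha_def transpose_def)
  have "dunkl n k (perm_vec (transpose i j) v) p =
      dunkl n k v p + mconst (v j - v i) * dunkl n k (coalpha i j) p"
    unfolding eq by (simp only: dunkl_vec_add dunkl_vec_scale)
  then show ?thesis
    by (simp add: mconst_diff algebra_simps)
qed

text \<open>The commutator of two Dunkl operators commutes with multiplication by linear forms: by the Jacobi
  identity this only uses the commutator of a Dunkl operator with a linear form.\<close>

lemma dunkl_commutator_linear_form: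
  fixes a b :: "nat \<Rightarrow> complex" and k :: complex
  assumes p: "p \<in> polys_in {1..n}"
  defines "C \<equiv> \<lambda>p. dunkl n k a (dunkl n k b p) - dunkl n k b (dunkl n k a p)"
  shows "C (linear_form n c * p) = linear_form n c * C p"
proof -
  let ?l = "linear_form n c" and ?D = "dunkl n k" and ?T = "transp_pairs n"
  let ?s = "\<lambda>i j. perm_poly (transpose i j)"
  \<comment> \<open>The two middle terms are symmetric in \<open>a\<close> and \<open>b\<close> and
    cancel in the commutator. Only the sum over transpositions needs a further argument.\<close>
  have exp: "?D a (?D b (?l * p)) = ?l * ?D a (?D b p) + mconst (peval a ?l) * ?D b p
      + mconst (peval b ?l) * ?D a p
      - mconst k * (\<Sum>(i, j)\<in>?T. mconst (c i - c j) * (mconst (a i - a j) * ?s i j (?D b p)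
          + mconst (b i - b j) * ?D a (?s i j p)))" for a b
  proof -
    have "?D a (\<Sum>(i, j)\<in>?T. mconst ((b i - b j) * (c i - c j)) * ?s i j p) =
        (\<Sum>(i, j)\<in>?T. mconst ((b i - b j) * (c i - c j)) * ?D a (?s i j p))"
      by (simp add: dunkl_sum dunkl_mconst_mult split_beta)
    moreover have "(\<Sum>(i, j)\<in>?T. mconst (c i - c j) * (mconst (a i - a j) * ?s i j (?D b p)
          + mconst (b i - b j) * ?D a (?s i j p))) =
        (\<Sum>(i, j)\<in>?T. mconst ((a i - a j) * (c i - c j)) * ?s i j (?D b p))
        + (\<Sum>(i, j)\<in>?T. mconst ((b i - b j) * (c i - c j)) * ?D a (?s i j p))"
      by (simp add: mconst_mult distrib_left split_beta ac_simps flip: sum.distrib)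
    ultimately show ?thesis
      by (simp only: dunkl_linear_form_mult dunkl_diff dunkl_add dunkl_mconst_mult)
        (simp only: distrib_left diff_conv_add_uminus minus_add_distrib add_ac)
  qed
  have "(\<Sum>(i, j)\<in>?T. mconst (c i - c j) * (mconst (a i - a j) * ?s i j (?D b p)
          + mconst (b i - b j) * ?D a (?s i j p))) =
      (\<Sum>(i, j)\<in>?T. mconst (c i - c j) * (mconst (b i - b j) * ?s i j (?D a p)
          + mconst (a i - a j) * ?D b (?s i j p)))"
  proof (intro sum.cong refl, clarify)
    fix i j assume ij: "(i, j) \<in> ?T"
    \<comment> \<open>Moving s past D_v leaves a correction proportional to v_i - v_j. For v = b,
      together with the factor a_i - a_j, it is symmetric in a and b, so the sums for both orders
      agree.\<close>
    have e: "?s i j (?D v p) = ?D v (?s i j p) - mconst (v i - v j) * ?D (coalpha i j) (?s i j p)" for v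
      using dunkl_perm_poly[of "transpose i j" n p k v] transp_pairsD[OF ij] p
        dunkl_perm_vec_transpose[OF ij] by simp
    show "mconst (c i - c j) * (mconst (a i - a j) * ?s i j (?D b p)
          + mconst (b i - b j) * ?D a (?s i j p)) =
        mconst (c i - c j) * (mconst (b i - b j) * ?s i j (?D a p) + mconst (a i - a j) * ?D b (?s i j p))"
      unfolding e by (simp add: right_diff_distrib distrib_left mult_ac)
  qed
  then show ?thesis
    unfolding C_def exp[of a b] exp[of b a] by (simp add: algebra_simps)
qed

text \<open>The commutator commutes with every variable, hence with multiplication by every
  polynomial. It is therefore determined by its value at 1, which is 0.\<close>

lemma dunkl_commute:
  assumes "p \<in> polys_in {1..n}"
  shows "dunkl n k a (dunkl n k b p) = dunkl n k b (dunkl n k a p)"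
proof -
  define C where "C p = dunkl n k a (dunkl n k b p) - dunkl n k b (dunkl n k a p)" for p
  have "\<forall>q\<in>polys_in {1..n}. C (p * q) = p * C q"
    using assms
  proof (induction rule: polys_in_induct)
    case (const c)
    then show ?case by (simp add: C_def dunkl_mconst_mult right_diff_distrib)
  next
    case (var i)
    then show ?case
      using dunkl_commutator_linear_form unfolding C_def mvar_eq_linear_form[OF var] by blast
  next
    case (add p q)
    then show ?case
      by (simp add: C_def distrib_right dunkl_add) (simp add: algebra_simps)
  next
    case (mult p q)
    then show ?case
      by (simp add: mult.assoc polys_in_mult)
  qed
  then have "C (p * 1) = p * C 1" using polys_in_1 by blast
  then show ?thesis by (simp add: C_def dunkl_1 dunkl_0)
qed

section \<open>Translation invariant polynomials\<close>

definition translate :: "complex \<Rightarrow> mpoly \<Rightarrow> mpoly" where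
  "translate a = msubst mconst (\<lambda>i. mvar i + mconst a)"

lemma translate_simps:
  "translate a (p + q) = translate a p + translate a q"
  "translate a (p * q) = translate a p * translate a q"
  "translate a (mconst c) = mconst c"
  "translate a (mvar i) = mvar i + mconst a"
  "translate a (p - q) = translate a p - translate a q"
  "translate a (- p) = - translate a p"
  "translate a 0 = 0"
  "translate a 1 = 1"
  by (simp_all add: translate_def tsubst_simps)

lemma Ch_def': "Ch n = {p \<in> polys_in {1..n}. \<forall>a. translate a p = p}"
  by (simp add: Ch_def translate_def polys_eq_polys_in)

lemma Ch_in_polys: "p \<in> Ch n \<Longrightarrow> p \<in> polys_in {1..n}"
  by (simp add: Ch_def')

lemma peval_translate: "peval v (translate a p) = peval (\<lambda>i. v i + a) p"
  by (simp add: translate_def peval_msubst peval_simps)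

lemma Ch_peval_shift: "p \<in> Ch n \<Longrightarrow> peval (\<lambda>i. v i + a) p = peval v p"
  by (simp add: Ch_def' flip: peval_translate)

lemma Ch_I:
  assumes "p \<in> polys_in {1..n}" "\<And>v a. peval (\<lambda>i. v i + a) p = peval v p"
  shows "p \<in> Ch n"
  using assms by (auto simp: Ch_def' peval_translate intro!: mpoly_eqI)

lemma Ch_peval_cong:
  assumes p: "p \<in> Ch n" and uv: "\<And>i. i \<in> {1..n} \<Longrightarrow> u i - v i = a"
  shows "peval u p = peval v p"
proof -
  have "peval u p = peval (\<lambda>i. v i + a) p"
    by (rule peval_cong[OF Ch_in_polys[OF p]]) (use uv in \<open>auto simp: algebra_simps\<close>)
  then show ?thesis
    by (simp add: Ch_peval_shift[OF p])
qed

lemma Ch_add: "p \<in> Ch n \<Longrightarrow> q \<in> Ch n \<Longrightarrow> p + q \<in> Ch n"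
  by (simp add: Ch_def' translate_simps polys_in_add)

lemma Ch_mult: "p \<in> Ch n \<Longrightarrow> q \<in> Ch n \<Longrightarrow> p * q \<in> Ch n"
  by (simp add: Ch_def' translate_simps polys_in_mult)

lemma Ch_diff: "p \<in> Ch n \<Longrightarrow> q \<in> Ch n \<Longrightarrow> p - q \<in> Ch n"
  by (simp add: Ch_def' translate_simps polys_in_diff)

lemma Ch_mconst [simp]: "mconst c \<in> Ch n"
  by (simp add: Ch_def' translate_simps)

lemma Ch_0 [simp]: "0 \<in> Ch n"
  by (simp add: Ch_def' translate_simps)

lemma Ch_1 [simp]: "1 \<in> Ch n"
  by (simp add: Ch_def' translate_simps)

lemma Ch_sum: "(\<And>i. i \<in> A \<Longrightarrow> f i \<in> Ch n) \<Longrightarrow> sum f A \<in> Ch n"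
  by (induction A rule: infinite_finite_induct) (simp_all add: Ch_add)

lemma Ch_perm_poly:
  assumes "p \<in> Ch n" "w permutes {1..n}"
  shows "perm_poly w p \<in> Ch n"
proof (rule Ch_I)
  show "perm_poly w p \<in> polys_in {1..n}"
    using assms by (intro perm_poly_permutes) (auto dest: Ch_in_polys)
  show "peval (\<lambda>i. v i + a) (perm_poly w p) = peval v (perm_poly w p)" for v a
    using Ch_peval_shift[OF assms(1), of "v \<circ> w" a] by (simp add: peval_perm_poly comp_def)
qed

lemma Ch_divdiff:
  assumes "p \<in> Ch n" and ij: "i \<noteq> j" "i \<in> {1..n}" "j \<in> {1..n}"
  shows "divdiff i j p \<in> Ch n"
proof -
  have sp: "perm_poly (transpose i j) p \<in> Ch n"
    using assms by (intro Ch_perm_poly permutes_swap_id) auto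
  have "translate a (divdiff i j p) = divdiff i j p" for a
  proof (rule sym, rule divdiffI[OF ij(1)])
    have "alpha i j * translate a (divdiff i j p) = translate a (alpha i j * divdiff i j p)"
      by (simp add: translate_simps alpha_def)
    also have "\<dots> = p - perm_poly (transpose i j) p"
      using assms sp by (simp add: alpha_mult_divdiff translate_simps Ch_def')
    finally show "alpha i j * translate a (divdiff i j p) = p - perm_poly (transpose i j) p" .
  qed
  then show ?thesis
    using assms divdiff_in_polys_in by (simp add: Ch_def')
qed

lemma Ch_pderiv_var:
  assumes "p \<in> Ch n" "i \<in> {1..n}"
  shows "pderiv_var i p \<in> Ch n"
proof -
  have "translate a (pderiv_var i p) = pderiv_var i p" for a
  proof -
    have "pderiv_var i (translate a p) =
        (\<Sum>j\<in>{1..n}. translate a (pderiv_var j p) * pderiv_var i (mvar j + mconst a))"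
      unfolding translate_def
      by (rule derivation_msubst[OF coeff_hom_mconst _ _ _ finite_atLeastAtMost Ch_in_polys[OF assms(1)]])
        (simp_all add: pderiv_var_simps)
    also have "\<dots> = (\<Sum>j\<in>{1..n}. if j = i then translate a (pderiv_var j p) else 0)"
      by (intro sum.cong) (auto simp: pderiv_var_simps)
    also have "\<dots> = translate a (pderiv_var i p)"
      using assms(2) by (simp add: sum.delta)
    finally show ?thesis
      using assms by (simp add: Ch_def')
  qed
  then show ?thesis
    using assms by (simp add: Ch_def' pderiv_var_in_polys_in)
qed

lemma Ch_dunkl:
  assumes "p \<in> Ch n"
  shows "dunkl n k v p \<in> Ch n"
  unfolding dunkl_eq using assms
  by (auto intro!: Ch_diff Ch_sum Ch_mult Ch_pderiv_var Ch_divdiff dest!: transp_pairsD)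

lemma poly_msubst:
  "poly (msubst (\<lambda>c. [:c:]) (\<lambda>i. [:v i, 1:]) p) a = peval (\<lambda>i. v i + a) p"
proof -
  have "coeff_hom (\<lambda>c. [:c:])"
    by (simp add: coeff_hom_def one_pCons)
  then show ?thesis
    by (induction p rule: mpoly_induct) (simp_all add: msubst_simps peval_simps algebra_simps)
qed

text \<open>On the line v + a (1, ..., 1), p becomes a polynomial in a whose derivative is the
  restriction of the sum of all partial derivatives; in characteristic 0 a polynomial with zero
  derivative is constant.\<close>

lemma Ch_iff_sum_pderiv_var:
  assumes p: "p \<in> polys_in {1..n}"
  shows "p \<in> Ch n \<longleftrightarrow> (\<Sum>i\<in>{1..n}. pderiv_var i p) = 0"
proof -
  have hom: "coeff_hom (\<lambda>c. [:c:])"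
    by (simp add: coeff_hom_def one_pCons)
  let ?Q = "\<lambda>v. msubst (\<lambda>c. [:c:]) (\<lambda>i. [:v i, 1:])"
  have "pderiv (?Q v p) = (\<Sum>i\<in>{1..n}. ?Q v (pderiv_var i p) * pderiv [:v i, 1:])" for v
    by (rule derivation_msubst[OF hom _ _ _ finite_atLeastAtMost p])
      (simp_all add: pderiv_add pderiv_mult pderiv_pCons)
  then have Q': "pderiv (?Q v p) = ?Q v (\<Sum>i\<in>{1..n}. pderiv_var i p)" for v
    by (simp add: msubst_sum[OF hom] pderiv_pCons one_pCons[symmetric])
  show ?thesis
  proof
    assume Ch: "p \<in> Ch n"
    show "(\<Sum>i\<in>{1..n}. pderiv_var i p) = 0"
    proof (rule mpoly_eq_0I)
      fix v
      have "poly (?Q v p) = poly [:peval v p:]"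
        by (rule ext) (simp add: poly_msubst Ch_peval_shift[OF Ch])
      then have "?Q v p = [:peval v p:]"
        by (simp only: poly_eq_poly_eq_iff)
      then have "poly (?Q v (\<Sum>i\<in>{1..n}. pderiv_var i p)) 0 = 0"
        unfolding Q'[symmetric] by (simp add: pderiv_pCons)
      then show "peval v (\<Sum>i\<in>{1..n}. pderiv_var i p) = 0"
        by (simp add: poly_msubst)
    qed
  next
    assume 0: "(\<Sum>i\<in>{1..n}. pderiv_var i p) = 0"
    show "p \<in> Ch n"
    proof (rule Ch_I[OF p])
      fix v a
      have "pderiv (?Q v p) = 0"
        unfolding Q' 0 by (simp add: msubst_0[OF hom])
      then obtain c where "?Q v p = [:c:]"
        by (metis degree_eq_zeroE pderiv_eq_0_iff)
      then show "peval (\<lambda>i. v i + a) p = peval v p"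
        using poly_msubst[of v p a] poly_msubst[of v p 0] by simp
    qed
  qed
qed

text \<open>Shifting the vector by (a, ..., a) changes the derivative part by a times the sum of all
  partial derivatives, which kills invariants; the reflection part only sees differences.\<close>

lemma dunkl_Ch_cong:
  assumes p: "p \<in> Ch n" and uv: "\<And>i. i \<in> {1..n} \<Longrightarrow> u i - v i = a"
  shows "dunkl n k u p = dunkl n k v p"
proof -
  have u: "u i = v i + a" if "i \<in> {1..n}" for i
    using uv[OF that] by (simp add: algebra_simps)
  have "(\<Sum>i\<in>{1..n}. mconst (u i) * pderiv_var i p) =
      (\<Sum>i\<in>{1..n}. mconst (v i) * pderiv_var i p + mconst a * pderiv_var i p)"
    by (intro sum.cong) (simp_all add: u mconst_add distrib_right)
  also have "\<dots> = (\<Sum>i\<in>{1..n}. mconst (v i) * pderiv_var i p) + mconst a * (\<Sum>i\<in>{1..n}. pderiv_var i p)"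
    by (simp add: sum.distrib sum_distrib_left)
  also have "(\<Sum>i\<in>{1..n}. pderiv_var i p) = 0"
    using p Ch_iff_sum_pderiv_var Ch_in_polys by blast
  finally have "(\<Sum>i\<in>{1..n}. mconst (u i) * pderiv_var i p) = (\<Sum>i\<in>{1..n}. mconst (v i) * pderiv_var i p)"
    by simp
  moreover have "(\<Sum>(i, j)\<in>transp_pairs n. mconst (u i - u j) * divdiff i j p) =
      (\<Sum>(i, j)\<in>transp_pairs n. mconst (v i - v j) * divdiff i j p)"
    by (intro sum.cong) (auto dest!: transp_pairsD simp: u)
  ultimately show ?thesis
    by (simp only: dunkl_eq)
qed

section \<open>The space h* and centred coordinates\<close>

lemma hdual_eq: "hdual n = {linear_form n c | c. (\<Sum>i\<in>{1..n}. c i) = 0}"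
  by (simp add: hdual_def linear_form_def)

lemma hdual_subset_Ch: "x \<in> hdual n \<Longrightarrow> x \<in> Ch n"
proof (rule Ch_I)
  assume "x \<in> hdual n"
  then obtain c where x: "x = linear_form n c" and c: "(\<Sum>i\<in>{1..n}. c i) = 0"
    by (auto simp: hdual_eq)
  show "x \<in> polys_in {1..n}"
    by (simp only: x linear_form_in_polys)
  show "peval (\<lambda>i. v i + a) x = peval v x" for v a
  proof -
    have "(\<Sum>i\<in>{1..n}. c i * (v i + a)) = (\<Sum>i\<in>{1..n}. c i * v i) + (\<Sum>i\<in>{1..n}. c i) * a"
      by (simp add: distrib_left sum.distrib sum_distrib_right)
    then show ?thesis
      by (simp only: x peval_linear_form c) simp
  qed
qed

lemma hdual_add:
  assumes "x \<in> hdual n" "y \<in> hdual n" shows "x + y \<in> hdual n"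
proof -
  obtain c e where "x = linear_form n c" "(\<Sum>i\<in>{1..n}. c i) = 0" "y = linear_form n e" "(\<Sum>i\<in>{1..n}. e i) = 0"
    using assms by (auto simp: hdual_eq)
  then show ?thesis
    unfolding hdual_eq
    by (intro CollectI exI[of _ "\<lambda>i. c i + e i"])
      (simp add: linear_form_def mconst_add distrib_right sum.distrib)
qed

lemma hdual_mconst_mult:
  assumes "x \<in> hdual n" shows "mconst a * x \<in> hdual n"
proof -
  obtain c where "x = linear_form n c" "(\<Sum>i\<in>{1..n}. c i) = 0"
    using assms by (auto simp: hdual_eq)
  then show ?thesis
    unfolding hdual_eq
    by (intro CollectI exI[of _ "\<lambda>i. a * c i"])
      (simp add: linear_form_def mconst_mult sum_distrib_left mult.assoc flip: sum_distrib_left)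
qed

lemma hdual_perm_poly:
  assumes "x \<in> hdual n" and w: "w permutes {1..n}" shows "perm_poly w x \<in> hdual n"
proof -
  obtain c where x: "x = linear_form n c" and c: "(\<Sum>i\<in>{1..n}. c i) = 0"
    using assms by (auto simp: hdual_eq)
  let ?c = "\<lambda>i. c (inv_into UNIV w i)"
  have bij: "bij_betw w {1..n} {1..n}"
    using w by (rule permutes_imp_bij)
  have inv: "inv_into UNIV w (w i) = i" for i
    using permutes_inverses[OF w] by simp
  have "linear_form n ?c = (\<Sum>i\<in>{1..n}. mconst (?c (w i)) * mvar (w i))"
    unfolding linear_form_def by (rule sum.reindex_bij_betw[OF bij, symmetric])
  also have "\<dots> = perm_poly w x"
    by (simp add: x linear_form_def perm_poly_simps inv)
  finally have 1: "linear_form n ?c = perm_poly w x" .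
  have "(\<Sum>i\<in>{1..n}. ?c i) = (\<Sum>i\<in>{1..n}. ?c (w i))"
    by (rule sum.reindex_bij_betw[OF bij, symmetric])
  then have "(\<Sum>i\<in>{1..n}. ?c i) = 0"
    using c by (simp add: inv)
  then show ?thesis
    unfolding hdual_eq using 1[symmetric] by blast
qed

text \<open>Coordinates relative to the centre of mass; the values at indices outside \<open>{1..n}\<close> are irrelevant.\<close>

definition centered :: "nat \<Rightarrow> nat \<Rightarrow> mpoly" where
  "centered n i = (if i \<in> {1..n} then mvar i - mconst (1 / of_nat n) * (\<Sum>j\<in>{1..n}. mvar j) else 0)"

lemma centered_in_hdual:
  assumes "i \<in> {1..n}"
  shows "centered n i \<in> hdual n"
proof -
  let ?c = "\<lambda>j. (if j = i then 1 else 0) - 1 / of_nat n :: complex"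
  have "centered n i = linear_form n ?c"
    unfolding centered_def linear_form_def mconst_diff left_diff_distrib sum_subtractf
    using assms mvar_eq_linear_form[of i n] by (simp add: sum_distrib_left linear_form_def)
  moreover have "(\<Sum>j\<in>{1..n}. ?c j) = 0"
    unfolding sum_subtractf using assms by (auto simp: sum.delta)
  ultimately show ?thesis
    unfolding hdual_eq by blast
qed

lemma centered_in_Ch: "centered n i \<in> Ch n"
  using hdual_subset_Ch[OF centered_in_hdual, of i n] by (cases "i \<in> {1..n}") (auto simp: centered_def)

lemma peval_centered: "i \<in> {1..n} \<Longrightarrow> peval v (centered n i) = v i - (\<Sum>j\<in>{1..n}. v j) / of_nat n"
  by (simp add: centered_def peval_simps)

lemma msubst_centered_in_Ch: "msubst mconst (centered n) p \<in> Ch n"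
  by (induction p rule: mpoly_induct) (simp_all add: tsubst_simps centered_in_Ch Ch_add Ch_mult)

text \<open>Centring moves a point along the diagonal, where an invariant polynomial is constant. So
  the substitution retracts the full polynomial ring onto C[h] and carries identities there to
  identities among invariants.\<close>

lemma msubst_centered:
  assumes "p \<in> Ch n"
  shows "msubst mconst (centered n) p = p"
proof (rule mpoly_eqI)
  fix v
  show "peval v (msubst mconst (centered n) p) = peval v p"
    unfolding peval_msubst
    by (rule Ch_peval_cong[OF assms, where a = "- (\<Sum>j\<in>{1..n}. v j) / of_nat n"])
      (simp add: peval_centered)
qed

section \<open>The polynomial representation\<close>

lemma poly_mapping_induct_on [consumes 1, case_names zero single add]:
  fixes p :: "'a \<Rightarrow>\<^sub>0 'b::comm_monoid_add"
  assumes "Poly_Mapping.keys p \<subseteq> K"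
    and zero: "P 0"
    and single: "\<And>m c. m \<in> K \<Longrightarrow> P (Poly_Mapping.single m c)"
    and add: "\<And>p q. Poly_Mapping.keys p \<subseteq> K \<Longrightarrow> Poly_Mapping.keys q \<subseteq> K \<Longrightarrow> P p \<Longrightarrow> P q \<Longrightarrow> P (p + q)"
  shows "P p"
proof -
  have "P (\<Sum>m\<in>A. Poly_Mapping.single m (f m)) \<and>
      Poly_Mapping.keys (\<Sum>m\<in>A. Poly_Mapping.single m (f m)) \<subseteq> K"
    if "finite A" "A \<subseteq> K" for A and f :: "'a \<Rightarrow> 'b"
    using that
  proof (induction A)
    case (insert m A)
    have "Poly_Mapping.keys (Poly_Mapping.single m (f m)) \<subseteq> K"
      using insert.prems by simp
    then show ?case
      using insert keys_add[of "Poly_Mapping.single m (f m)" "\<Sum>m\<in>A. Poly_Mapping.single m (f m)"]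
      by (auto intro!: add single)
  qed (simp add: zero)
  then show ?thesis
    using poly_mapping_expand[of "Poly_Mapping.keys p" p] assms(1)
    by (metis finite_keys subset_refl)
qed

lemma cvec_nonempty_class:
  assumes "v \<in> cvec n"
  shows "v \<in> hclass n v" "hclass n v \<in> hspace n"
proof -
  show "v \<in> hclass n v"
    using assms by (auto simp: hclass_def diag_rel_def)
  show "hclass n v \<in> hspace n"
    unfolding hclass_def hspace_def using assms by (rule quotientI)
qed

lemma gen_act_Y:
  assumes v: "v \<in> cvec n" and p: "p \<in> Ch n"
  shows "gen_act n k (GVec (hclass n v)) p = dunkl n k v p"
proof -
  define u where "u = (SOME u. u \<in> hclass n v)"
  have "u \<in> hclass n v"
    unfolding u_def using cvec_nonempty_class(1)[OF v] by (rule someI[where P = "\<lambda>u. u \<in> hclass n v"])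
  then obtain a where "\<And>i. i \<in> {1..n} \<Longrightarrow> v i - u i = a"
    unfolding hclass_def diag_rel_def by blast
  then show ?thesis
    using dunkl_Ch_cong[OF p, of v u a] by (simp add: u_def)
qed

lemma cgens_cases:
  assumes "g \<in> cgens n"
  obtains w where "g = GPerm w" "w permutes {1..n}"
  | v where "g = GVec (hclass n v)" "v \<in> cvec n"
  | x where "g = GCovec x" "x \<in> hdual n"
  using assms by (auto simp: cgens_def hspace_def quotient_def hclass_def)

lemma gen_act_Ch:
  assumes "g \<in> cgens n" "p \<in> Ch n"
  shows "gen_act n k g p \<in> Ch n"
  using assms(1)
  by (rule cgens_cases)
    (use assms(2) in \<open>auto simp: gen_act_Y Ch_perm_poly Ch_dunkl Ch_mult hdual_subset_Ch
       simp del: gen_act.simps(2)\<close>)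

lemma gen_act_add:
  assumes "g \<in> cgens n" "p \<in> Ch n" "q \<in> Ch n"
  shows "gen_act n k g (p + q) = gen_act n k g p + gen_act n k g q"
  using assms(1)
  by (rule cgens_cases)
    (use assms(2,3) in \<open>auto simp: gen_act_Y Ch_add perm_poly_simps dunkl_add distrib_left
       simp del: gen_act.simps(2)\<close>)

lemma gen_act_mconst_mult:
  assumes "g \<in> cgens n" "p \<in> Ch n"
  shows "gen_act n k g (mconst c * p) = mconst c * gen_act n k g p"
  using assms(1)
  by (rule cgens_cases)
    (use assms(2) in \<open>auto simp: gen_act_Y Ch_mult perm_poly_simps dunkl_mconst_mult mult.left_commute
       simp del: gen_act.simps(2)\<close>)

lemma word_act:
  assumes "set ls \<subseteq> cgens n" "p \<in> Ch n" "q \<in> Ch n"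
  shows "foldr (gen_act n k) ls p \<in> Ch n"
    "foldr (gen_act n k) ls (p + q) = foldr (gen_act n k) ls p + foldr (gen_act n k) ls q"
    "foldr (gen_act n k) ls (mconst c * p) = mconst c * foldr (gen_act n k) ls p"
proof -
  have Ch: "foldr (gen_act n k) ls p \<in> Ch n" if "set ls \<subseteq> cgens n" "p \<in> Ch n" for ls p
    using that by (induction ls) (auto intro: gen_act_Ch)
  show "foldr (gen_act n k) ls p \<in> Ch n"
    by (rule Ch) fact+
  show "foldr (gen_act n k) ls (p + q) = foldr (gen_act n k) ls p + foldr (gen_act n k) ls q"
    using assms by (induction ls) (simp_all add: gen_act_add Ch)
  show "foldr (gen_act n k) ls (mconst c * p) = mconst c * foldr (gen_act n k) ls p"
    using assms by (induction ls) (simp_all add: gen_act_mconst_mult Ch)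
qed

section \<open>The free algebra on the generators and its action on C[h]\<close>

abbreviation gen_words :: "nat \<Rightarrow> cgen word set" where
  "gen_words n \<equiv> {w. set (letters w) \<subseteq> cgens n}"

definition gen_algebra :: "nat \<Rightarrow> cgen free_alg set" where
  "gen_algebra n = {a. Poly_Mapping.keys a \<subseteq> gen_words n}"

lemma carrier_free_algebra: "carrier (free_algebra (cgens n)) = gen_algebra n"
  by (auto simp: free_algebra_def gen_algebra_def)

lemma free_act_superset:
  assumes "finite A" "Poly_Mapping.keys a \<subseteq> A"
  shows "free_act n k a p = (\<Sum>w\<in>A. mconst (Poly_Mapping.lookup a w) * foldr (gen_act n k) (letters w) p)"
  unfolding free_act_def
  by (rule sum.mono_neutral_left) (use assms in \<open>auto simp: in_keys_iff\<close>)

lemma free_act_single: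
  "free_act n k (Poly_Mapping.single w c) p = mconst c * foldr (gen_act n k) (letters w) p"
  using free_act_superset[of "{w}" "Poly_Mapping.single w c" n k p] by simp

lemma free_act_0: "free_act n k 0 p = 0"
  by (simp add: free_act_def)

lemma free_act_add: "free_act n k (a + b) p = free_act n k a p + free_act n k b p"
proof -
  let ?A = "Poly_Mapping.keys a \<union> Poly_Mapping.keys b"
  have A: "finite ?A" "Poly_Mapping.keys a \<subseteq> ?A" "Poly_Mapping.keys b \<subseteq> ?A"
    "Poly_Mapping.keys (a + b) \<subseteq> ?A"
    using keys_add[of a b] by auto
  show ?thesis
    unfolding free_act_superset[OF A(1) A(2)] free_act_superset[OF A(1) A(3)]
      free_act_superset[OF A(1) A(4)]
    by (simp add: lookup_add mconst_add distrib_right sum.distrib)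
qed

lemma free_act_uminus: "free_act n k (- a) p = - free_act n k a p"
  using free_act_add[of n k a "- a" p] by (simp add: free_act_0 eq_neg_iff_add_eq_0 add.commute)

lemma free_act_diff: "free_act n k (a - b) p = free_act n k a p - free_act n k b p"
  using free_act_add[of n k a "- b" p] by (simp add: free_act_uminus)

lemma free_act_sum: "free_act n k (sum f A) p = (\<Sum>i\<in>A. free_act n k (f i) p)"
  by (induction A rule: infinite_finite_induct) (simp_all add: free_act_0 free_act_add)

lemma free_act_fgen: "free_act n k (fgen g) p = gen_act n k g p"
  by (simp add: fgen_def free_act_single)

lemma free_act_fconst: "free_act n k (fconst c) p = mconst c * p"
  by (simp add: fconst_def free_act_single zero_word_def)

lemma free_act_1: "free_act n k 1 p = p"
  using free_act_fconst[of n k 1 p] by (simp add: fconst_def)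

lemma free_act_Ch:
  assumes "a \<in> gen_algebra n" "p \<in> Ch n"
  shows "free_act n k a p \<in> Ch n"
  unfolding free_act_def using assms
  by (auto simp: gen_algebra_def intro!: Ch_sum Ch_mult word_act(1)[where q = 0])

lemma free_act_mult:
  assumes "a \<in> gen_algebra n" "b \<in> gen_algebra n" and p: "p \<in> Ch n"
  shows "free_act n k (a * b) p = free_act n k a (free_act n k b p)"
proof -
  have add: "free_act n k a (p + q) = free_act n k a p + free_act n k a q"
    if "a \<in> gen_algebra n" "p \<in> Ch n" "q \<in> Ch n" for a p q
    unfolding free_act_def sum.distrib[symmetric]
    by (intro sum.cong) (use that in \<open>auto simp: gen_algebra_def word_act(2) distrib_left\<close>)
  have single: "free_act n k (Poly_Mapping.single w c * b) p = free_act n k (Poly_Mapping.single w c) (free_act n k b p)"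
    if w: "w \<in> gen_words n" for w c
  proof -
    have "Poly_Mapping.keys b \<subseteq> gen_words n"
      using assms by (simp add: gen_algebra_def)
    then show ?thesis
    proof (induction rule: poly_mapping_induct_on)
      case zero
      then show ?case
        using word_act(3)[of "letters w" n 0 0 k 0] w by (simp add: free_act_0 free_act_single)
    next
      case (single u d)
      then have "foldr (gen_act n k) (letters w) (mconst d * foldr (gen_act n k) (letters u) p) =
          mconst d * foldr (gen_act n k) (letters w) (foldr (gen_act n k) (letters u) p)"
        using w p by (intro word_act(3)[where q = 0] word_act(1)[where q = 0]) auto
      then show ?case
        by (simp add: free_act_single mult_single plus_word_def mconst_mult mult.assoc)
    next
      case (add a b)
      then show ?case
        using w p free_act_Ch[of a n p k] free_act_Ch[of b n p k]
        by (simp add: gen_algebra_def distrib_left free_act_add free_act_single word_act(2))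
    qed
  qed
  have "Poly_Mapping.keys a \<subseteq> gen_words n"
    using assms by (simp add: gen_algebra_def)
  then show ?thesis
    by (induction rule: poly_mapping_induct_on)
      (simp_all only: single free_act_add distrib_right free_act_0 mult_zero_left)
qed

lemma gen_algebra_add: "a \<in> gen_algebra n \<Longrightarrow> b \<in> gen_algebra n \<Longrightarrow> a + b \<in> gen_algebra n"
  using keys_add[of a b] by (auto simp: gen_algebra_def)

lemma gen_algebra_uminus: "a \<in> gen_algebra n \<Longrightarrow> - a \<in> gen_algebra n"
  by (auto simp: gen_algebra_def in_keys_iff)

lemma gen_algebra_diff: "a \<in> gen_algebra n \<Longrightarrow> b \<in> gen_algebra n \<Longrightarrow> a - b \<in> gen_algebra n"
  using gen_algebra_add[of a n "- b"] gen_algebra_uminus[of b n] by simp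

lemma gen_algebra_mult:
  assumes "a \<in> gen_algebra n" "b \<in> gen_algebra n"
  shows "a * b \<in> gen_algebra n"
  unfolding gen_algebra_def
proof (clarify)
  fix w g assume "w \<in> Poly_Mapping.keys (a * b)" and g: "g \<in> set (letters w)"
  then obtain u v where "w = u + v" "u \<in> Poly_Mapping.keys a" "v \<in> Poly_Mapping.keys b"
    using keys_mult[of a b] by auto
  then show "g \<in> cgens n"
    using g assms by (auto simp: gen_algebra_def plus_word_def)
qed

lemma gen_algebra_fconst: "fconst c \<in> gen_algebra n"
  by (auto simp: gen_algebra_def fconst_def zero_word_def)

lemma gen_algebra_0: "0 \<in> gen_algebra n"
  by (simp add: gen_algebra_def)

lemma gen_algebra_1: "1 \<in> gen_algebra n"
  using gen_algebra_fconst[of 1 n] by (simp add: fconst_def)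

lemma gen_algebra_fgen: "g \<in> cgens n \<Longrightarrow> fgen g \<in> gen_algebra n"
  by (auto simp: gen_algebra_def fgen_def)

lemma gen_algebra_sum: "(\<And>i. i \<in> A \<Longrightarrow> f i \<in> gen_algebra n) \<Longrightarrow> sum f A \<in> gen_algebra n"
  by (induction A rule: infinite_finite_induct)
    (simp_all only: sum.infinite sum.empty sum.insert gen_algebra_0 gen_algebra_add insert_iff simp_thms)

lemma ring_free_algebra: "ring (free_algebra (cgens n))"
proof (rule ringI)
  let ?F = "free_algebra (cgens n)"
  have ops: "a \<oplus>\<^bsub>?F\<^esub> b = a + b" "a \<otimes>\<^bsub>?F\<^esub> b = a * b" "\<zero>\<^bsub>?F\<^esub> = 0" "\<one>\<^bsub>?F\<^esub> = 1" for a b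
    by (simp_all add: free_algebra_def)
  show "abelian_group ?F"
  proof (rule abelian_groupI)
    fix a assume "a \<in> carrier ?F"
    then show "\<exists>b\<in>carrier ?F. b \<oplus>\<^bsub>?F\<^esub> a = \<zero>\<^bsub>?F\<^esub>"
      unfolding carrier_free_algebra ops by (intro bexI[of _ "- a"] gen_algebra_uminus) simp_all
  qed (simp_all only: carrier_free_algebra ops gen_algebra_add gen_algebra_0 ac_simps add_0_left add_0_right)
  show "monoid ?F"
    by (rule monoidI)
      (simp_all only: carrier_free_algebra ops gen_algebra_mult gen_algebra_1 mult.assoc mult_1_left mult_1_right)
qed (simp_all add: free_algebra_def algebra_simps)

text \<open>An ideal that will be seen to contain all relations, hence the ideal they generate; this
  makes the action of a coset well defined.\<close>

definition annihilator :: "nat \<Rightarrow> complex \<Rightarrow> cgen free_alg set" where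
  "annihilator n k = {a \<in> gen_algebra n. \<forall>p\<in>Ch n. free_act n k a p = 0}"

lemma ideal_annihilator: "ideal (annihilator n k) (free_algebra (cgens n))"
proof (rule idealI[OF ring_free_algebra])
  let ?F = "free_algebra (cgens n)"
  have ops: "a \<oplus>\<^bsub>?F\<^esub> b = a + b" "a \<otimes>\<^bsub>?F\<^esub> b = a * b" "\<zero>\<^bsub>?F\<^esub> = 0" for a b
    by (simp_all add: free_algebra_def)
  interpret F: ring ?F by (rule ring_free_algebra)
  show "subgroup (annihilator n k) (add_monoid ?F)"
  proof (rule F.add.subgroupI)
    show "annihilator n k \<subseteq> carrier ?F"
      by (auto simp: annihilator_def carrier_free_algebra)
    have "0 \<in> annihilator n k"
      by (simp add: annihilator_def free_act_0 gen_algebra_0)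
    then show "annihilator n k \<noteq> {}"
      by blast
    show "a \<oplus>\<^bsub>?F\<^esub> b \<in> annihilator n k" if "a \<in> annihilator n k" "b \<in> annihilator n k" for a b
      using that gen_algebra_add[of a n b] by (simp add: ops annihilator_def free_act_add)
    show "\<ominus>\<^bsub>?F\<^esub> a \<in> annihilator n k" if a: "a \<in> annihilator n k" for a
    proof -
      have "\<ominus>\<^bsub>?F\<^esub> a = - a"
        by (rule F.minus_equality)
          (use a gen_algebra_uminus[of a n] in \<open>simp_all add: ops carrier_free_algebra annihilator_def\<close>)
      then show ?thesis
        using a gen_algebra_uminus[of a n] by (simp add: annihilator_def free_act_uminus)
    qed
  qed
  fix a b assume a: "a \<in> annihilator n k" and b: "b \<in> carrier ?F"
  have 0: "free_act n k b 0 = 0"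
    using free_act_mult[of b n 0 0 k] b by (simp add: carrier_free_algebra free_act_0 gen_algebra_0)
  show "b \<otimes>\<^bsub>?F\<^esub> a \<in> annihilator n k"
    using a b gen_algebra_mult[of b n a] 0
    by (simp add: ops carrier_free_algebra annihilator_def free_act_mult)
  show "a \<otimes>\<^bsub>?F\<^esub> b \<in> annihilator n k"
    using a b gen_algebra_mult[of a n b] free_act_Ch[of b n]
    by (simp add: ops carrier_free_algebra annihilator_def free_act_mult)
qed

lemma cvec_perm_vec: "w permutes {1..n} \<Longrightarrow> v \<in> cvec n \<Longrightarrow> perm_vec w v \<in> cvec n"
proof -
  assume w: "w permutes {1..n}" and v: "v \<in> cvec n"
  have "inv_into UNIV w i \<notin> {1..n}" if "i \<notin> {1..n}" for i
    using that permutes_not_in[OF permutes_inv[OF w] that] by simp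
  then show "perm_vec w v \<in> cvec n"
    using v by (simp add: perm_vec_def cvec_def del: atLeastAtMost_iff)
qed

text \<open>Beyond linearity and the multiplicativity of permutations, this rests on three facts
  about Dunkl operators: equivariance, commutativity, and their commutator with a linear
  form.\<close>

lemma relations_annihilate:
  "smash_relations n \<union> cherednik_relations n k \<subseteq> annihilator n k"
proof -
  have gW: "GPerm w \<in> cgens n" if "w permutes {1..n}" for w
    using that by (auto simp: cgens_def)
  have gY: "GVec (hclass n v) \<in> cgens n" if "v \<in> cvec n" for v
    using cvec_nonempty_class(2)[OF that] by (auto simp: cgens_def)
  have gX: "GCovec x \<in> cgens n" if "x \<in> hdual n" for x
    using that by (auto simp: cgens_def)
  have cvec: "(\<lambda>i. u i + v i) \<in> cvec n" "(\<lambda>i. c * v i) \<in> cvec n" if "u \<in> cvec n" "v \<in> cvec n" for u v c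
    using that by (auto simp: cvec_def)
  have annI: "a \<in> annihilator n k" if "a \<in> gen_algebra n" "\<And>p. p \<in> Ch n \<Longrightarrow> free_act n k a p = 0" for a
    using that by (simp add: annihilator_def)
  note closed = gen_algebra_add gen_algebra_diff gen_algebra_mult gen_algebra_fconst gen_algebra_1
    gen_algebra_fgen gen_algebra_sum gW gY gX cvec cvec_perm_vec hdual_add hdual_mconst_mult hdual_perm_poly
    permutes_compose permutes_id
  note act = free_act_add free_act_diff free_act_mult free_act_fconst free_act_1 free_act_fgen free_act_sum
    gen_act_Y gen_act.simps(1,3) Ch_mult hdual_subset_Ch Ch_perm_poly Ch_dunkl closed
  note [simp del] = gen_act.simps(2) One_nat_def
  show ?thesis
    unfolding smash_relations_def cherednik_relations_def Un_subset_iff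
  proof (intro conjI subsetI; elim CollectE exE conjE singletonE; hypsubst)
    show "Wg id - 1 \<in> annihilator n k"
      by (rule annI) (simp_all add: act)
    fix u w assume "u permutes {1..n}" "w permutes {1..n}"
    then show "Wg u * Wg w - Wg (u \<circ> w) \<in> annihilator n k"
      by (intro annI) (simp_all add: act perm_poly_perm_poly)
  next
    fix u v assume "u \<in> cvec n" "v \<in> cvec n"
    then show "Yg n (\<lambda>i. u i + v i) - (Yg n u + Yg n v) \<in> annihilator n k"
      by (intro annI) (simp_all add: act dunkl_vec_add)
    show "Yg n u * Yg n v - Yg n v * Yg n u \<in> annihilator n k"
      using \<open>u \<in> cvec n\<close> \<open>v \<in> cvec n\<close>
      by (intro annI) (simp_all add: act, metis dunkl_commute Ch_in_polys)
  next
    fix c v assume "v \<in> cvec n"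
    then show "Yg n (\<lambda>i. c * v i) - fconst c * Yg n v \<in> annihilator n k"
      by (intro annI) (simp_all add: act dunkl_vec_scale)
  next
    fix x y assume "x \<in> hdual n" "y \<in> hdual n"
    then show "Xg (x + y) - (Xg x + Xg y) \<in> annihilator n k"
      by (intro annI) (simp_all add: act distrib_right)
    show "Xg x * Xg y - Xg y * Xg x \<in> annihilator n k"
      using \<open>x \<in> hdual n\<close> \<open>y \<in> hdual n\<close> by (intro annI) (simp_all add: act mult_ac)
  next
    fix c x assume "x \<in> hdual n"
    then show "Xg (mconst c * x) - fconst c * Xg x \<in> annihilator n k"
      by (intro annI) (simp_all add: act mult.assoc)
  next
    fix w v assume "w permutes {1..n}" "v \<in> cvec n"
    then show "Wg w * Yg n v - Yg n (perm_vec w v) * Wg w \<in> annihilator n k"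
      by (intro annI) (simp_all add: act dunkl_perm_poly Ch_in_polys)
  next
    fix w x assume "w permutes {1..n}" "x \<in> hdual n"
    then show "Wg w * Xg x - Xg (perm_poly w x) * Wg w \<in> annihilator n k"
      by (intro annI) (simp_all add: act perm_poly_simps)
  next
    fix v x assume v: "v \<in> cvec n" and x: "x \<in> hdual n"
    obtain c where c: "x = linear_form n c"
      using x by (auto simp: hdual_eq)
    let ?T = "\<Sum>(i, j)\<in>transp_pairs n.
      fconst (peval v (alpha i j) * peval (coalpha i j) x) * Wg (transpose i j)"
    have T: "?T \<in> gen_algebra n"
    proof (rule gen_algebra_sum, clarify)
      fix i j assume "(i, j) \<in> transp_pairs n"
      then show "fconst (peval v (alpha i j) * peval (coalpha i j) x) * Wg (transpose i j) \<in> gen_algebra n"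
        using transp_pairsD by (blast intro: closed)
    qed
    define T where "T = ?T"
    have T': "free_act n k T p = (\<Sum>(i, j)\<in>transp_pairs n.
          mconst ((v i - v j) * (c i - c j)) * perm_poly (transpose i j) p)" if "p \<in> Ch n" for p
      unfolding T_def free_act_sum using that
      by (intro sum.cong)
        (auto dest!: transp_pairsD simp: act c peval_coalpha_linear_form peval_alpha)
    show "Yg n v * Xg x - Xg x * Yg n v - (fconst (peval v x) - fconst k * ?T) \<in> annihilator n k"
      unfolding T_def[symmetric]
    proof (rule annI)
      have T: "T \<in> gen_algebra n"
        using T by (simp only: T_def)
      then show "Yg n v * Xg x - Xg x * Yg n v - (fconst (peval v x) - fconst k * T) \<in> gen_algebra n"
        using v x by (intro closed)
      fix p assume p: "p \<in> Ch n"
      show "free_act n k (Yg n v * Xg x - Xg x * Yg n v - (fconst (peval v x) - fconst k * T)) p = 0"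
        using v x p T by (simp add: act T') (simp add: c dunkl_linear_form_mult)
    qed
  qed
qed

section \<open>The action of the Cherednik algebra and its submodules\<close>

lemma carrier_cherednik:
  "carrier (cherednik n k) =
    {genideal (free_algebra (cgens n)) (smash_relations n \<union> cherednik_relations n k) +>\<^bsub>free_algebra (cgens n)\<^esub> a
      | a. a \<in> gen_algebra n}"
  by (auto simp: cherednik_def Let_def FactRing_def A_RCOSETS_def' carrier_free_algebra)

text \<open>The image inside \<open>cherednik_act\<close> is a singleton: nonempty because the ideal
  contains 0, with one value only because the ideal annihilates p.\<close>

lemma cherednik_act_eq:
  assumes "p \<in> Ch n"
  shows "cherednik_act n k (genideal (free_algebra (cgens n)) (smash_relations n \<union> cherednik_relations n k)
    +>\<^bsub>free_algebra (cgens n)\<^esub> a) p = free_act n k a p"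
proof -
  let ?F = "free_algebra (cgens n)" and ?R = "smash_relations n \<union> cherednik_relations n k"
  interpret F: ring ?F by (rule ring_free_algebra)
  have sub: "genideal ?F ?R \<subseteq> annihilator n k"
    by (rule F.genideal_minimal[OF ideal_annihilator relations_annihilate])
  have "?R \<subseteq> carrier ?F"
    using relations_annihilate by (force simp: annihilator_def carrier_free_algebra)
  then have "\<zero>\<^bsub>?F\<^esub> \<in> genideal ?F ?R"
    using F.genideal_ideal additive_subgroup.zero_closed ideal.axioms(1) by blast
  then have 0: "0 \<in> genideal ?F ?R"
    by (simp add: free_algebra_def)
  have "genideal ?F ?R +>\<^bsub>?F\<^esub> a = {b + a | b. b \<in> genideal ?F ?R}"
    by (auto simp: a_r_coset_def' free_algebra_def)
  then have "(\<lambda>b. free_act n k b p) ` (genideal ?F ?R +>\<^bsub>?F\<^esub> a) = {free_act n k a p}"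
    using 0 sub assms by (force simp: free_act_add annihilator_def)
  then show ?thesis
    by (simp add: cherednik_act_def)
qed

lemma cherednik_submoduleI:
  assumes sub: "N \<subseteq> Ch n" and "0 \<in> N" and add: "\<And>p q. p \<in> N \<Longrightarrow> q \<in> N \<Longrightarrow> p + q \<in> N"
    and scale: "\<And>c p. p \<in> N \<Longrightarrow> mconst c * p \<in> N"
    and gen: "\<And>g p. g \<in> cgens n \<Longrightarrow> p \<in> N \<Longrightarrow> gen_act n k g p \<in> N"
  shows "cherednik_submodule n k N"
proof -
  have word: "foldr (gen_act n k) ls p \<in> N" if "set ls \<subseteq> cgens n" "p \<in> N" for ls p
    using that by (induction ls) (auto intro: gen)
  have sum: "sum f A \<in> N" if "\<And>i. i \<in> A \<Longrightarrow> f i \<in> N" for f and A :: "cgen word set"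
    using that by (induction A rule: infinite_finite_induct) (auto intro: add \<open>0 \<in> N\<close>)
  have "free_act n k a p \<in> N" if "a \<in> gen_algebra n" "p \<in> N" for a p
    unfolding free_act_def using that by (intro sum scale word) (auto simp: gen_algebra_def)
  then have "cherednik_act n k h p \<in> N" if "h \<in> carrier (cherednik n k)" "p \<in> N" for h p
    using that sub by (auto simp: carrier_cherednik cherednik_act_eq)
  then show ?thesis
    using assms by (simp add: cherednik_submodule_def)
qed

text \<open>C[h] is generated by h*: an invariant polynomial equals its own expression in the
  centred coordinates, and these lie in h* and so act through the Cherednik algebra.\<close>

lemma cherednik_submodule_Ch_mult:
  assumes N: "cherednik_submodule n k N" and "c \<in> Ch n" "p \<in> N"
  shows "c * p \<in> N"
proof -
  have sub: "N \<subseteq> Ch n" and add: "\<And>p q. p \<in> N \<Longrightarrow> q \<in> N \<Longrightarrow> p + q \<in> N"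
    and act: "\<And>a p. a \<in> gen_algebra n \<Longrightarrow> p \<in> N \<Longrightarrow> free_act n k a p \<in> N"
    using N cherednik_act_eq unfolding cherednik_submodule_def carrier_cherednik by (blast, blast, fastforce)
  have const: "mconst c * p \<in> N" if "p \<in> N" for c p
    using act[OF gen_algebra_fconst that, of c] by (simp add: free_act_fconst)
  have hdual: "x * p \<in> N" if "x \<in> hdual n" "p \<in> N" for x p
    using act[OF gen_algebra_fgen that(2), of "GCovec x"] that(1) by (auto simp: free_act_fgen cgens_def)
  have "\<forall>p\<in>N. msubst mconst (centered n) c * p \<in> N"
  proof (induction c rule: mpoly_induct)
    case (var i)
    have "centered n i * p \<in> N" if "p \<in> N" for p
    proof (cases "i \<in> {1..n}")
      case True
      then show ?thesis
        using that by (intro hdual centered_in_hdual)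
    next
      case False
      then have "centered n i = 0"
        unfolding centered_def by (rule if_not_P)
      then show ?thesis
        using const[OF that, of 0] by simp
    qed
    then show ?case
      by (simp add: tsubst_simps)
  qed (simp_all add: tsubst_simps const distrib_right add mult.assoc)
  then show ?thesis
    using assms by (simp add: msubst_centered)
qed

definition generated_ideal :: "nat \<Rightarrow> (nat \<Rightarrow> mpoly) \<Rightarrow> mpoly set" where
  "generated_ideal n f = {\<Sum>i\<in>{1..n}. c i * f i | c. \<forall>i\<in>{1..n}. c i \<in> Ch n}"

lemma generated_ideal_add:
  assumes "p \<in> generated_ideal n f" "q \<in> generated_ideal n f"
  shows "p + q \<in> generated_ideal n f"
proof -
  obtain b c where "p = (\<Sum>i\<in>{1..n}. b i * f i)" "q = (\<Sum>i\<in>{1..n}. c i * f i)"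
    "\<forall>i\<in>{1..n}. b i \<in> Ch n" "\<forall>i\<in>{1..n}. c i \<in> Ch n"
    using assms by (auto simp: generated_ideal_def)
  then show ?thesis
    unfolding generated_ideal_def
    by (intro CollectI exI[of _ "\<lambda>i. b i + c i"]) (auto simp: distrib_right sum.distrib Ch_add)
qed

lemma generated_ideal_Ch_mult:
  assumes "p \<in> generated_ideal n f" "a \<in> Ch n"
  shows "a * p \<in> generated_ideal n f"
proof -
  obtain c where "p = (\<Sum>i\<in>{1..n}. c i * f i)" "\<forall>i\<in>{1..n}. c i \<in> Ch n"
    using assms by (auto simp: generated_ideal_def)
  then show ?thesis
    unfolding generated_ideal_def using assms(2)
    by (intro CollectI exI[of _ "\<lambda>i. a * c i"]) (auto simp: sum_distrib_left Ch_mult mult.assoc)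
qed

lemma generated_ideal_0: "0 \<in> generated_ideal n f"
  unfolding generated_ideal_def by (intro CollectI exI[of _ "\<lambda>i. 0"]) auto

lemma generated_ideal_uminus: "p \<in> generated_ideal n f \<Longrightarrow> - p \<in> generated_ideal n f"
  using generated_ideal_Ch_mult[OF _ Ch_mconst[of "- 1"], of p n f] by (simp add: mconst_uminus)

lemma generated_ideal_diff:
  "p \<in> generated_ideal n f \<Longrightarrow> q \<in> generated_ideal n f \<Longrightarrow> p - q \<in> generated_ideal n f"
  using generated_ideal_add[of p n f "- q"] generated_ideal_uminus[of q n f] by simp

lemma generated_ideal_sum:
  "(\<And>i. i \<in> A \<Longrightarrow> g i \<in> generated_ideal n f) \<Longrightarrow> sum g A \<in> generated_ideal n f"
  by (induction A rule: infinite_finite_induct) (simp_all add: generated_ideal_0 generated_ideal_add)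

lemma generated_ideal_gen:
  assumes "i \<in> {1..n}"
  shows "f i \<in> generated_ideal n f"
proof -
  have "(\<Sum>j\<in>{1..n}. (if j = i then 1 else 0) * f j) = (\<Sum>j\<in>{1..n}. if j = i then f j else 0)"
    by (intro sum.cong) auto
  also have "\<dots> = f i"
    using assms by (simp add: sum.delta)
  finally show ?thesis
    unfolding generated_ideal_def by (intro CollectI exI[of _ "\<lambda>j. if j = i then 1 else 0"]) auto
qed

lemma generated_ideal_subset_Ch:
  assumes "\<And>i. i \<in> {1..n} \<Longrightarrow> f i \<in> Ch n"
  shows "generated_ideal n f \<subseteq> Ch n"
  using assms by (auto simp: generated_ideal_def intro!: Ch_sum Ch_mult)

text \<open>Permutations and h* clearly preserve the ideal. For D_v, \<open>dunkl_mult\<close>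
  applied to c_i f_i leaves only multiples of f_i and of its images under transpositions.
  Conversely, every submodule is closed under C[h].\<close>

lemma cherednik_span_eq_generated_ideal:
  assumes f: "\<And>i. i \<in> {1..n} \<Longrightarrow> f i \<in> Ch n"
    and perm: "\<And>i w. i \<in> {1..n} \<Longrightarrow> w permutes {1..n} \<Longrightarrow> perm_poly w (f i) = f (w i)"
    and dunkl: "\<And>i v. i \<in> {1..n} \<Longrightarrow> dunkl n k v (f i) = 0"
  shows "cherednik_span n k (f ` {1..n}) = generated_ideal n f"
proof
  let ?J = "generated_ideal n f"
  have "cherednik_submodule n k ?J"
  proof (rule cherednik_submoduleI)
    show "?J \<subseteq> Ch n"
      using f by (rule generated_ideal_subset_Ch)
    show "0 \<in> ?J"
      by (rule generated_ideal_0)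
    show "p + q \<in> ?J" if "p \<in> ?J" "q \<in> ?J" for p q
      using that by (rule generated_ideal_add)
    show "mconst c * p \<in> ?J" if "p \<in> ?J" for c p
      using that by (intro generated_ideal_Ch_mult) auto
    fix g p assume g: "g \<in> cgens n" and "p \<in> ?J"
    then obtain c where p: "p = (\<Sum>i\<in>{1..n}. c i * f i)" and c: "\<And>i. i \<in> {1..n} \<Longrightarrow> c i \<in> Ch n"
      by (auto simp: generated_ideal_def)
    have fJ: "b * f i \<in> ?J" if "b \<in> Ch n" "i \<in> {1..n}" for b i
      using that by (intro generated_ideal_Ch_mult generated_ideal_gen)
    have pCh: "p \<in> Ch n"
      unfolding p using f c by (auto intro!: Ch_sum Ch_mult)
    from g show "gen_act n k g p \<in> ?J"
    proof (cases rule: cgens_cases)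
      case (1 w)
      have "perm_poly w p = (\<Sum>i\<in>{1..n}. perm_poly w (c i) * f (w i))"
        unfolding p perm_poly_simps by (intro sum.cong refl) (simp only: perm[OF _ 1(2)])
      moreover have "\<dots> \<in> ?J"
        using permutes_in_image[OF 1(2)] c 1
        by (intro generated_ideal_sum fJ Ch_perm_poly) auto
      ultimately show ?thesis
        by (simp add: 1)
    next
      case (2 v)
      have "dunkl n k v p \<in> ?J"
        unfolding p dunkl_sum
      proof (rule generated_ideal_sum)
        fix i assume i: "i \<in> {1..n}"
        have fs: "perm_poly (transpose a b) (f i) = f (transpose a b i)" "transpose a b i \<in> {1..n}"
          if "(a, b) \<in> transp_pairs n" for a b
          using transp_pairsD[OF that] perm[OF i] permutes_in_image[of "transpose a b" "{1..n}" i] i by auto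
        have "mconst (v a - v b) * divdiff a b (c i) * perm_poly (transpose a b) (f i) \<in> ?J"
          if "(a, b) \<in> transp_pairs n" for a b
          unfolding fs(1)[OF that]
          using transp_pairsD[OF that] c[OF i] fs(2)[OF that] by (intro fJ Ch_mult Ch_mconst Ch_divdiff) auto
        then have "(\<Sum>(a, b)\<in>transp_pairs n. mconst (v a - v b) * divdiff a b (c i) * perm_poly (transpose a b) (f i)) \<in> ?J"
          by (intro generated_ideal_sum) auto
        moreover have "(\<Sum>j\<in>{1..n}. mconst (v j) * pderiv_var j (c i)) * f i \<in> ?J"
          using c[OF i] i by (intro fJ Ch_sum Ch_mult Ch_mconst Ch_pderiv_var)
        ultimately show "dunkl n k v (c i * f i) \<in> ?J"
          unfolding dunkl_mult dunkl[OF i]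
          by (simp only: mult_zero_right add_0_left)
            (rule generated_ideal_diff, assumption, rule generated_ideal_Ch_mult, assumption, rule Ch_mconst)
      qed
      then show ?thesis
        using pCh 2 by (simp add: gen_act_Y del: gen_act.simps(2))
    next
      case (3 x)
      then show ?thesis
        using \<open>p \<in> ?J\<close> by (simp add: generated_ideal_Ch_mult hdual_subset_Ch)
    qed
  qed
  then show "cherednik_span n k (f ` {1..n}) \<subseteq> ?J"
    unfolding cherednik_span_def using generated_ideal_gen by blast
  have "?J \<subseteq> N" if N: "cherednik_submodule n k N" and fN: "f ` {1..n} \<subseteq> N" for N
  proof
    fix p assume "p \<in> ?J"
    then obtain c where p: "p = (\<Sum>i\<in>{1..n}. c i * f i)" and c: "\<And>i. i \<in> {1..n} \<Longrightarrow> c i \<in> Ch n"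
      by (auto simp: generated_ideal_def)
    have sum: "sum g A \<in> N" if "\<And>i. i \<in> A \<Longrightarrow> g i \<in> N" for g and A :: "nat set"
      using that N by (induction A rule: infinite_finite_induct) (auto simp: cherednik_submodule_def)
    show "p \<in> N"
      unfolding p by (intro sum cherednik_submodule_Ch_mult[OF N] c) (use fN in \<open>simp_all only: image_subset_iff\<close>)
  qed
  then show "?J \<subseteq> cherednik_span n k (f ` {1..n})"
    by (auto simp: cherednik_span_def)
qed

section \<open>The singular polynomials \<open>f\<^sub>i\<close>\<close>

declare fps_const_neg [simp del] fps_const_mult [simp del] fps_const_add [simp del] fps_const_sub [simp del]

text \<open>The binomial series (1 - x u)^a over any ring that receives the complex numbers through
  \<phi>: with \<open>mconst\<close> for the generating functions, with the identity for their
  values at a point.\<close>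

definition opow :: "(complex \<Rightarrow> 'r::comm_ring_1) \<Rightarrow> 'r \<Rightarrow> complex \<Rightarrow> 'r fps" where
  "opow \<phi> x a = Abs_fps (\<lambda>m. \<phi> (a gchoose m) * (- x) ^ m)"

lemma one_minus_power_eq: "one_minus_power = opow mconst"
  by (simp add: fun_eq_iff one_minus_power_def opow_def)

lemma coeff_hom_sum: "coeff_hom \<phi> \<Longrightarrow> \<phi> (sum f A) = (\<Sum>i\<in>A. \<phi> (f i))"
  by (induction A rule: infinite_finite_induct) (simp_all add: coeff_hom_simps)

lemma coeff_hom_of_nat: "coeff_hom \<phi> \<Longrightarrow> \<phi> (of_nat m) = of_nat m"
  by (induction m) (simp_all add: coeff_hom_simps)

lemma opow_add:
  assumes "coeff_hom \<phi>"
  shows "opow \<phi> x (a + b) = opow \<phi> x a * opow \<phi> x b"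
proof (rule fps_ext)
  fix m
  have "opow \<phi> x (a + b) $ m = \<phi> (\<Sum>i=0..m. (a gchoose i) * (b gchoose (m - i))) * (- x) ^ m"
    by (simp add: opow_def gbinomial_Vandermonde)
  also have "\<dots> = (\<Sum>i=0..m. \<phi> (a gchoose i) * \<phi> (b gchoose (m - i)) * (- x) ^ m)"
    by (simp add: coeff_hom_sum[OF assms] coeff_hom_simps[OF assms] sum_distrib_right)
  also have "\<dots> = (opow \<phi> x a * opow \<phi> x b) $ m"
    unfolding fps_mult_nth
  proof (rule sum.cong[OF refl])
    fix i assume "i \<in> {0..m}"
    then have "(- x) ^ m = (- x) ^ i * (- x) ^ (m - i)"
      by (simp flip: power_add)
    then show "\<phi> (a gchoose i) * \<phi> (b gchoose (m - i)) * (- x) ^ m = opow \<phi> x a $ i * opow \<phi> x b $ (m - i)"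
      by (simp add: opow_def mult_ac)
  qed
  finally show "opow \<phi> x (a + b) $ m = (opow \<phi> x a * opow \<phi> x b) $ m" .
qed

lemma opow_0: "coeff_hom \<phi> \<Longrightarrow> opow \<phi> x 0 = 1"
  by (rule fps_ext) (auto simp: opow_def gbinomial_0(2) coeff_hom_simps gr0_conv_Suc)

lemma opow_1:
  assumes "coeff_hom \<phi>" shows "opow \<phi> x 1 = 1 - fps_const x * fps_X"
proof (rule fps_ext)
  fix m
  have 0: "(1::complex) gchoose Suc (Suc j) = 0" for j
    using binomial_gbinomial[of 1 "Suc (Suc j)", where ?'a = complex] by simp
  consider "m = 0" | "m = Suc 0" | j where "m = Suc (Suc j)"
    by (metis nat.exhaust)
  then show "opow \<phi> x 1 $ m = (1 - fps_const x * fps_X) $ m"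
    by cases (simp_all add: opow_def coeff_hom_simps[OF assms] 0)
qed

lemma opow_of_nat: "coeff_hom \<phi> \<Longrightarrow> opow \<phi> x (of_nat j) = (1 - fps_const x * fps_X) ^ j"
  by (induction j) (simp_all add: opow_0 opow_add opow_1)

lemma opow_inverse: "coeff_hom \<phi> \<Longrightarrow> opow \<phi> x (- 1) * (1 - fps_const x * fps_X) = 1"
  using opow_add[of \<phi> x "- 1" 1] by (simp add: opow_0 opow_1)

lemma gbinomial_Suc_absorb: "of_nat (Suc m) * (a gchoose Suc m) = a * ((a - 1) gchoose m)" for a :: complex
  by (rule gbinomial_absorption)

lemma opow_diff_1: "coeff_hom \<phi> \<Longrightarrow> opow \<phi> x (a - 1) = opow \<phi> x a * opow \<phi> x (- 1)"
  using opow_add[of \<phi> x a "- 1"] by simp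

lemma fps_deriv_opow:
  assumes "coeff_hom \<phi>"
  shows "fps_deriv (opow \<phi> x a) = - fps_const (\<phi> a * x) * opow \<phi> x (- 1) * opow \<phi> x a"
proof -
  have "fps_deriv (opow \<phi> x a) = - fps_const (\<phi> a * x) * opow \<phi> x (a - 1)"
  proof (rule fps_ext)
    fix m
    have "of_nat (Suc m) * \<phi> (a gchoose Suc m) = \<phi> a * \<phi> ((a - 1) gchoose m)"
      using arg_cong[OF gbinomial_Suc_absorb[of m a], of \<phi>]
      by (simp only: coeff_hom_simps[OF assms] coeff_hom_of_nat[OF assms])
    then show "fps_deriv (opow \<phi> x a) $ m = (- fps_const (\<phi> a * x) * opow \<phi> x (a - 1)) $ m"
      by (simp add: opow_def mult.assoc[symmetric] del: of_nat_Suc)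
  qed
  then show ?thesis
    by (simp add: opow_diff_1[OF assms] mult_ac)
qed

lemma fps_deriv_prod_opow:
  assumes "coeff_hom \<phi>" "finite S"
  shows "fps_deriv (\<Prod>j\<in>S. opow \<phi> (x j) a) =
    - fps_const (\<phi> a) * (\<Sum>j\<in>S. fps_const (x j) * opow \<phi> (x j) (- 1)) * (\<Prod>j\<in>S. opow \<phi> (x j) a)"
  using \<open>finite S\<close>
proof (induction S)
  case (insert j S)
  then show ?case
    by (simp add: fps_deriv_opow[OF assms(1)] fps_const_mult[symmetric] algebra_simps)
qed simp

text \<open>The power series \<open>\<Prod>\<^sub>j (1 - x\<^sub>j u)\<^sup>s\<close> and, for \<open>s = r/n\<close>, the generating function
  \<open>\<Prod>\<^sub>j (1 - x\<^sub>j u)\<^sup>s / (1 - x\<^sub>i u)\<close>, whose coefficients \<open>u\<^sup>r\<close> are the \<open>-f\<^sub>i\<close>.\<close>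

definition gpow :: "nat \<Rightarrow> complex \<Rightarrow> mpoly fps" where
  "gpow n s = (\<Prod>j\<in>{1..n}. opow mconst (mvar j) s)"

definition geo :: "nat \<Rightarrow> mpoly fps" where
  "geo i = opow mconst (mvar i) (- 1)"

definition gfun :: "nat \<Rightarrow> complex \<Rightarrow> nat \<Rightarrow> mpoly fps" where
  "gfun n s i = gpow n s * geo i"

text \<open>The factors u^(-r) and u turn the coefficient of u^1, whose negative is the residue,
  into that of u^r.\<close>

lemma fpoly_eq: "fpoly n r i = - (gfun n (of_nat r / of_nat n) i $ r)"
proof -
  have "fls_X_intpow (- int r) * fps_to_fls (gpow n (of_nat r / of_nat n)) * (fls_X * fps_to_fls (geo i)) =
      fls_shift (int r - 1) (fps_to_fls (gfun n (of_nat r / of_nat n) i))"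
    by (simp add: gfun_def fls_times_fps_to_fls fls_X_times_conv_shift fls_shifted_times_simps)
  then show ?thesis
    by (simp add: fpoly_def res_infinity_def gpow_def geo_def one_minus_power_eq)
qed

lemma geo_inverse: "geo i * (1 - fps_const (mvar i) * fps_X) = 1"
  by (simp add: geo_def opow_inverse coeff_hom_mconst)

lemma geo_Euler: "fps_X * (fps_const (mvar i) * geo i) = geo i - 1"
  using geo_inverse[of i] by (simp add: algebra_simps)

text \<open>The resolvent identity. Through it, divided differences of the generating functions
  become products of \<open>geo\<close> factors.\<close>

lemma geo_diff: "geo a - geo b = fps_const (alpha a b) * (fps_X * geo a * geo b)"
proof -
  let ?u = "\<lambda>i. 1 - fps_const (mvar i) * fps_X"
  have "geo a - geo b = geo a * (geo b * ?u b) - geo b * (geo a * ?u a)"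
    by (simp add: geo_inverse)
  also have "\<dots> = fps_const (alpha a b) * (fps_X * geo a * geo b)"
    by (simp add: alpha_def algebra_simps flip: fps_const_sub)
  finally show ?thesis .
qed

lemma fps_deriv_gpow:
  "fps_deriv (gpow n s) = - fps_const (mconst s) * (\<Sum>j\<in>{1..n}. fps_const (mvar j) * geo j) * gpow n s"
  unfolding gpow_def geo_def by (rule fps_deriv_prod_opow[OF coeff_hom_mconst finite_atLeastAtMost])

lemma fps_deriv_geo: "fps_deriv (geo i) = fps_const (mvar i) * geo i * geo i"
  unfolding geo_def using fps_deriv_opow[OF coeff_hom_mconst, of "mvar i" "- 1"]
  by (simp add: mconst_uminus flip: fps_const_neg)

lemma fps_deriv_gfun:
  "fps_deriv (gfun n s i) = fps_const (mvar i) * geo i * gfun n s i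
    - fps_const (mconst s) * (\<Sum>j\<in>{1..n}. fps_const (mvar j) * geo j) * gfun n s i"
  by (simp add: gfun_def fps_deriv_gpow fps_deriv_geo algebra_simps)

text \<open>Let E be the series in the statement. The operator u d/du sends Y_i to E + (s n - 1)
  Y_i. At u^(r-1) it multiplies by r - 1 = s n - 1, so E has no such term. This is where s = r/n
  enters.\<close>

lemma gfun_Euler:
  assumes "s * of_nat n = of_nat r" "r > 0"
  shows "(gfun n s i * (geo i - fps_const (mconst s) * (\<Sum>j\<in>{1..n}. geo j))) $ (r - 1) = 0"
proof -
  let ?E = "gfun n s i * (geo i - fps_const (mconst s) * (\<Sum>j\<in>{1..n}. geo j))"
  have S: "fps_X * (\<Sum>j\<in>{1..n}. fps_const (mvar j) * geo j) = (\<Sum>j\<in>{1..n}. geo j) - of_nat n"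
    by (simp add: sum_distrib_left geo_Euler sum_subtractf)
  have "fps_X * fps_deriv (gfun n s i) = fps_X * (fps_const (mvar i) * geo i) * gfun n s i
      - fps_const (mconst s) * (fps_X * (\<Sum>j\<in>{1..n}. fps_const (mvar j) * geo j)) * gfun n s i"
    unfolding fps_deriv_gfun by (simp add: algebra_simps)
  also have "\<dots> = ?E + (fps_const (mconst s) * of_nat n - 1) * gfun n s i"
    unfolding S geo_Euler by (simp add: algebra_simps)
  also have "fps_const (mconst s) * of_nat n = (of_nat r :: mpoly fps)"
  proof -
    have "fps_const (mconst s) * of_nat n = fps_const (mconst s * mconst (of_nat n))"
      by (simp add: mconst_of_nat fps_of_nat flip: fps_const_mult)
    also have "\<dots> = of_nat r"
      by (simp only: mconst_mult[symmetric] assms(1)) (simp add: mconst_of_nat fps_of_nat)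
    finally show ?thesis .
  qed
  also have "(of_nat r - 1 :: mpoly fps) = of_nat (r - 1)"
    using assms(2) by (simp add: of_nat_diff)
  finally have "(fps_X * fps_deriv (gfun n s i)) $ (r - 1) = ?E $ (r - 1) + (of_nat (r - 1) * gfun n s i) $ (r - 1)"
    by simp
  moreover have "(fps_X * fps_deriv (gfun n s i)) $ (r - 1) = of_nat (r - 1) * gfun n s i $ (r - 1)"
    by (cases "r - 1") simp_all
  moreover have "(of_nat (r - 1) * gfun n s i) $ (r - 1) = of_nat (r - 1) * gfun n s i $ (r - 1)"
    by (simp flip: fps_of_nat)
  ultimately show ?thesis
    by simp
qed

text \<open>Multiplying the derivative by 1 - x_i u cancels the factor \<open>geo i\<close> of Y_i,
  and \<open>gpow\<close> times \<open>geo j\<close> is Y_j again: the system closes on Y_1, ...,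
  Y_n.\<close>

lemma gfun_recurrence:
  "of_nat (Suc m) * gfun n s i $ Suc m = of_nat (Suc m) * (mvar i * gfun n s i $ m)
     - mconst s * (\<Sum>j\<in>{1..n}. mvar j * gfun n s j $ m)"
proof -
  let ?u = "1 - fps_const (mvar i) * fps_X"
  have "fps_deriv (gfun n s i) * ?u = fps_const (mvar i) * gfun n s i * (geo i * ?u)
    - fps_const (mconst s) * (\<Sum>j\<in>{1..n}. fps_const (mvar j) * (gpow n s * geo j)) * (geo i * ?u)"
    by (subst fps_deriv_gfun) (simp add: gfun_def algebra_simps sum_distrib_left)
  then have "fps_deriv (gfun n s i) * ?u = fps_const (mvar i) * gfun n s i
      - fps_const (mconst s) * (\<Sum>j\<in>{1..n}. fps_const (mvar j) * gfun n s j)"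
    by (simp add: geo_inverse gfun_def)
  then have "(fps_deriv (gfun n s i) * ?u) $ m = mvar i * gfun n s i $ m
      - mconst s * (\<Sum>j\<in>{1..n}. mvar j * gfun n s j $ m)"
    by (simp add: fps_sum_nth)
  moreover have "(fps_deriv (gfun n s i) * ?u) $ m =
      of_nat (Suc m) * gfun n s i $ Suc m - mvar i * (of_nat m * gfun n s i $ m)"
    by (cases m) (simp_all add: right_diff_distrib mult.assoc[symmetric] mult.commute[of _ "fps_const (mvar i)"]
        del: of_nat_Suc)
  ultimately show ?thesis
    by (simp add: algebra_simps)
qed

section \<open>Partial derivatives, permutations and Dunkl operators on the coefficients\<close>

definition pderiv_fps :: "nat \<Rightarrow> mpoly fps \<Rightarrow> mpoly fps" where
  "pderiv_fps i F = Abs_fps (\<lambda>m. pderiv_var i (F $ m))"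

lemma pderiv_fps_mult: "pderiv_fps i (F * G) = pderiv_fps i F * G + F * pderiv_fps i G"
  by (rule fps_ext) (simp add: pderiv_fps_def fps_mult_nth pderiv_var_simps sum.distrib)

lemma pderiv_fps_opow:
  "pderiv_fps i (opow mconst (mvar j) a) =
    (if i = j then - fps_const (mconst a) * fps_X * geo j * opow mconst (mvar j) a else 0)"
proof (cases "i = j")
  case True
  have "pderiv_fps i (opow mconst (mvar j) a) = - fps_const (mconst a) * (fps_X * opow mconst (mvar j) (a - 1))"
  proof (rule fps_ext)
    fix m
    show "pderiv_fps i (opow mconst (mvar j) a) $ m =
        (- fps_const (mconst a) * (fps_X * opow mconst (mvar j) (a - 1))) $ m"
    proof (cases m)
      case (Suc l)
      have "of_nat (Suc l) * mconst (a gchoose Suc l) = mconst a * mconst ((a - 1) gchoose l)"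
        using arg_cong[OF gbinomial_Suc_absorb[of l a], of mconst]
        by (simp only: mconst_mult mconst_of_nat)
      then have eq: "mconst (a gchoose Suc l) * (- of_nat (Suc l) * p) =
          - (mconst a * (mconst ((a - 1) gchoose l) * p))" for p
        by (metis (no_types, opaque_lifting) mult.assoc mult.commute mult_minus_left mult_minus_right)
      have "pderiv_fps i (opow mconst (mvar j) a) $ m =
          mconst (a gchoose Suc l) * pderiv_var j ((- mvar j) ^ Suc l)"
        by (simp add: pderiv_fps_def opow_def pderiv_var_mult True Suc del: power_Suc)
      also have "pderiv_var j ((- mvar j) ^ Suc l) = - of_nat (Suc l) * (- mvar j) ^ l"
        by (simp only: pderiv_var_power_mvar if_P diff_Suc_1)
      also note eq
      also have "- (mconst a * (mconst ((a - 1) gchoose l) * (- mvar j) ^ l)) =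
          (- fps_const (mconst a) * (fps_X * opow mconst (mvar j) (a - 1))) $ m"
        by (simp add: opow_def Suc)
      finally show ?thesis .
    qed (simp add: pderiv_fps_def opow_def)
  qed
  then show ?thesis
    using True by (simp add: opow_diff_1[OF coeff_hom_mconst] geo_def mult_ac)
next
  case False
  then show ?thesis
    by (intro fps_ext) (simp add: pderiv_fps_def opow_def pderiv_var_mult pderiv_var_power_mvar)
qed

lemma pderiv_fps_1: "pderiv_fps i 1 = 0"
  by (rule fps_ext) (simp add: pderiv_fps_def)

lemma pderiv_fps_gpow:
  assumes "i \<in> {1..n}"
  shows "pderiv_fps i (gpow n s) = - fps_const (mconst s) * fps_X * geo i * gpow n s"
proof -
  have 0: "pderiv_fps i (\<Prod>j\<in>S. opow mconst (mvar j) s) = 0" if "finite S" "i \<notin> S" for S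
    using that by (induction S) (auto simp: pderiv_fps_1 pderiv_fps_mult pderiv_fps_opow)
  have "gpow n s = opow mconst (mvar i) s * (\<Prod>j\<in>{1..n} - {i}. opow mconst (mvar j) s)"
    unfolding gpow_def using assms by (simp add: prod.remove)
  then show ?thesis
    using 0[of "{1..n} - {i}"] by (simp add: pderiv_fps_mult pderiv_fps_opow mult_ac)
qed

lemma pderiv_fps_gfun:
  assumes "j \<in> {1..n}"
  shows "pderiv_fps j (gfun n s i) = (if i = j then fps_X * geo i * gfun n s i else 0)
    - fps_const (mconst s) * (fps_X * geo j * gfun n s i)"
proof -
  have "pderiv_fps j (geo i) = (if i = j then fps_X * geo i * geo i else 0)"
    unfolding geo_def[of i] pderiv_fps_opow by (simp add: geo_def mconst_uminus fps_const_neg[symmetric])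
  then show ?thesis
    by (simp add: gfun_def pderiv_fps_mult pderiv_fps_gpow[OF assms] algebra_simps)
qed

definition perm_fps :: "(nat \<Rightarrow> nat) \<Rightarrow> mpoly fps \<Rightarrow> mpoly fps" where
  "perm_fps w F = Abs_fps (\<lambda>m. perm_poly w (F $ m))"

lemma perm_fps_mult: "perm_fps w (F * G) = perm_fps w F * perm_fps w G"
  by (rule fps_ext) (simp add: perm_fps_def fps_mult_nth perm_poly_simps)

lemma perm_fps_1: "perm_fps w 1 = 1"
  by (rule fps_ext) (simp add: perm_fps_def perm_poly_simps)

lemma perm_fps_opow: "perm_fps w (opow mconst (mvar i) s) = opow mconst (mvar (w i)) s"
proof -
  have "perm_poly w ((- mvar i) ^ m) = (- mvar (w i)) ^ m" for m
    by (induction m) (simp_all add: perm_poly_simps)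
  then show ?thesis
    by (intro fps_ext) (simp add: perm_fps_def opow_def perm_poly_simps)
qed

lemma perm_poly_gfun:
  assumes "w permutes {1..n}"
  shows "perm_poly w (gfun n s i $ m) = gfun n s (w i) $ m"
proof -
  have "perm_fps w (\<Prod>j\<in>S. opow mconst (mvar j) s) = (\<Prod>j\<in>S. opow mconst (mvar (w j)) s)" for S
    by (induction S rule: infinite_finite_induct) (simp_all add: perm_fps_1 perm_fps_mult perm_fps_opow)
  also have "(\<Prod>j\<in>{1..n}. opow mconst (mvar (w j)) s) = gpow n s"
    unfolding gpow_def by (rule prod.reindex_bij_betw[OF permutes_imp_bij[OF assms]])
  finally have "perm_fps w (gpow n s) = gpow n s"
    unfolding gpow_def .
  then have "perm_fps w (gfun n s i) = gfun n s (w i)"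
    by (simp add: gfun_def perm_fps_mult geo_def perm_fps_opow)
  then show ?thesis
    by (simp add: perm_fps_def fps_eq_iff)
qed

lemma gfun_in_polys:
  assumes "i \<in> {1..n}"
  shows "gfun n s i $ m \<in> polys_in {1..n}"
proof -
  have mult: "(F * G) $ m \<in> polys_in S" if "\<And>m. F $ m \<in> polys_in S" "\<And>m. G $ m \<in> polys_in S" for F G m S
    unfolding fps_mult_nth using that by (intro polys_in_sum polys_in_mult)
  have opow: "opow mconst (mvar j) s $ m \<in> polys_in {1..n}" if "j \<in> {1..n}" for j s m
    using that by (auto simp: opow_def intro!: polys_in_mult polys_in_power polys_in_uminus polys_in_mvar)
  have "(\<Prod>j\<in>S. opow mconst (mvar j) s) $ m \<in> polys_in {1..n}" if "S \<subseteq> {1..n}" for S m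
    using finite_subset[OF that finite_atLeastAtMost] that
  proof (induction S arbitrary: m)
    case empty
    then show ?case by (cases m) auto
  next
    case (insert j S)
    then show ?case
      unfolding prod.insert[OF insert.hyps] by (intro mult opow) auto
  qed
  then show ?thesis
    unfolding gfun_def gpow_def geo_def by (intro mult opow assms) auto
qed

text \<open>Since \<open>gpow\<close> is symmetric, a transposition only moves the
  \<open>geo\<close> factor, and it fixes the series unless it moves i.\<close>

lemma divdiff_gfun:
  assumes "(a, b) \<in> transp_pairs n"
  shows "divdiff a b (gfun n s i $ m) =
    ((if i = a then 1 else 0) - (if i = b then 1 else 0)) * (fps_X * geo a * geo b * gpow n s) $ m"
proof (rule divdiffI)
  note ab = transp_pairsD[OF assms]
  then show "a \<noteq> b" by blast
  have diff: "gfun n s a $ m - gfun n s b $ m = alpha a b * (fps_X * geo a * geo b * gpow n s) $ m"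
  proof -
    have "gfun n s a - gfun n s b = gpow n s * (geo a - geo b)"
      by (simp add: gfun_def algebra_simps)
    also have "\<dots> = fps_const (alpha a b) * (fps_X * geo a * geo b * gpow n s)"
      unfolding geo_diff by (simp add: mult_ac)
    finally show ?thesis
      by (metis fps_sub_nth fps_mult_left_const_nth)
  qed
  have "perm_poly (transpose a b) (gfun n s i $ m) = gfun n s (transpose a b i) $ m"
    using ab by (intro perm_poly_gfun) auto
  then show "alpha a b * (((if i = a then 1 else 0) - (if i = b then 1 else 0)) * (fps_X * geo a * geo b * gpow n s) $ m) =
      gfun n s i $ m - perm_poly (transpose a b) (gfun n s i $ m)"
    using diff by (auto simp: transpose_def algebra_simps)
qed

lemma dunkl_gfun:
  assumes i: "i \<in> {1..n}" and s: "s * of_nat n = of_nat r" and r: "r > 0"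
  shows "dunkl n s v (gfun n s i $ r) = 0"
proof -
  \<comment> \<open>All terms of the Dunkl operator reduce to these coefficients: a derivative in
    x_j falls on G_s or on \<open>geo i\<close>, and the reflections are given by the resolvent
    identity.\<close>
  define Z where "Z a b = (fps_X * geo a * geo b * gpow n s) $ r" for a b
  have Z_sym: "Z a b = Z b a" for a b
    by (simp add: Z_def mult_ac)
  have pd: "pderiv_var j (gfun n s i $ r) = (if j = i then Z i i else 0) - mconst s * Z i j"
    if "j \<in> {1..n}" for j
  proof -
    have "pderiv_var j (gfun n s i $ r) = pderiv_fps j (gfun n s i) $ r"
      by (simp add: pderiv_fps_def)
    also have "pderiv_fps j (gfun n s i) = (if j = i then fps_X * geo i * geo i * gpow n s else 0)
        - fps_const (mconst s) * (fps_X * geo i * geo j * gpow n s)"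
      by (subst pderiv_fps_gfun[OF that]) (simp add: gfun_def mult_ac)
    also have "\<dots> $ r = (if j = i then Z i i else 0) - mconst s * Z i j"
      by (simp only: Z_def fps_sub_nth fps_mult_left_const_nth if_distrib[of "\<lambda>F. F $ r"] fps_zero_nth)
    finally show ?thesis .
  qed
  have "(\<Sum>j\<in>{1..n}. mconst (v j) * pderiv_var j (gfun n s i $ r)) =
      (\<Sum>j\<in>{1..n}. (if j = i then mconst (v j) * Z i i else 0) - mconst s * (mconst (v j) * Z i j))"
  proof (rule sum.cong[OF refl])
    have "x * ((if j = i then z else 0) - c * y) = (if j = i then x * z else 0) - c * (x * y)"
      for x y z c :: mpoly and j
      by (simp add: algebra_simps)
    then show "mconst (v j) * pderiv_var j (gfun n s i $ r) =
        (if j = i then mconst (v j) * Z i i else 0) - mconst s * (mconst (v j) * Z i j)"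
      if "j \<in> {1..n}" for j
      by (simp only: pd[OF that])
  qed
  then have 1: "(\<Sum>j\<in>{1..n}. mconst (v j) * pderiv_var j (gfun n s i $ r)) =
      mconst (v i) * Z i i - mconst s * (\<Sum>j\<in>{1..n}. mconst (v j) * Z i j)"
    using i by (simp add: sum_subtractf sum.delta sum_distrib_left)
  define g where "g a b = mconst (v a - v b) * (((if i = a then 1 else 0) - (if i = b then 1 else 0)) * Z a b)" for a b
  have "(\<Sum>(a, b)\<in>transp_pairs n. mconst (v a - v b) * divdiff a b (gfun n s i $ r)) = (\<Sum>(a, b)\<in>transp_pairs n. g a b)"
    by (intro sum.cong) (auto simp: divdiff_gfun g_def Z_def)
  moreover have "2 * (\<Sum>(a, b)\<in>transp_pairs n. g a b) = 2 * (\<Sum>j\<in>{1..n}. mconst (v i - v j) * Z i j)"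
  proof -
    have g_sym: "g a b = g b a" for a b
      by (simp add: g_def Z_sym[of a b] mconst_diff algebra_simps)
    have "2 * (\<Sum>(a, b)\<in>transp_pairs n. g a b) = (\<Sum>a\<in>{1..n}. \<Sum>b\<in>{1..n} - {a}. g a b)"
      by (simp only: sum_off_diagonal[of g, OF g_sym] mult_2)
    also have "\<dots> = (\<Sum>a\<in>{1..n}. \<Sum>b\<in>{1..n}. g a b)"
      by (intro sum.cong refl sum.mono_neutral_left) (auto simp: g_def)
    also have "\<dots> = (\<Sum>a\<in>{1..n}. \<Sum>b\<in>{1..n}. (if a = i then mconst (v a - v b) * Z a b else 0))
        + (\<Sum>a\<in>{1..n}. \<Sum>b\<in>{1..n}. (if b = i then mconst (v b - v a) * Z a b else 0))"
      unfolding sum.distrib[symmetric]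
      by (intro sum.cong refl) (auto simp: g_def mconst_diff algebra_simps)
    also have "(\<Sum>a\<in>{1..n}. \<Sum>b\<in>{1..n}. (if a = i then mconst (v a - v b) * Z a b else 0)) =
        (\<Sum>b\<in>{1..n}. mconst (v i - v b) * Z i b)"
      using i by (subst sum.swap) (simp add: sum.delta)
    also have "(\<Sum>a\<in>{1..n}. \<Sum>b\<in>{1..n}. (if b = i then mconst (v b - v a) * Z a b else 0)) =
        (\<Sum>b\<in>{1..n}. mconst (v i - v b) * Z i b)"
      using i by (simp add: sum.delta Z_sym[of _ i])
    finally show ?thesis
      by (simp only: mult_2)
  qed
  ultimately have 2: "(\<Sum>(a, b)\<in>transp_pairs n. mconst (v a - v b) * divdiff a b (gfun n s i $ r)) =
      (\<Sum>j\<in>{1..n}. mconst (v i - v j) * Z i j)"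
    by simp
  \<comment> \<open>The terms with v_j cancel between the derivative and the reflection part. The
    factor left beside v_i is the coefficient treated in \<open>gfun_Euler\<close>, shifted by one
    power of u.\<close>
  have "dunkl n s v (gfun n s i $ r) = mconst (v i) * (Z i i - mconst s * (\<Sum>j\<in>{1..n}. Z i j))"
    unfolding dunkl_eq 1 2
    by (simp add: mconst_diff left_diff_distrib sum_subtractf right_diff_distrib sum_distrib_left mult_ac)
  also have "Z i i - mconst s * (\<Sum>j\<in>{1..n}. Z i j) =
      (fps_X * (gfun n s i * (geo i - fps_const (mconst s) * (\<Sum>j\<in>{1..n}. geo j)))) $ r"
  proof -
    have "fps_X * (gfun n s i * (geo i - fps_const (mconst s) * (\<Sum>j\<in>{1..n}. geo j))) =
      fps_X * geo i * geo i * gpow n s - fps_const (mconst s) * (\<Sum>j\<in>{1..n}. fps_X * geo i * geo j * gpow n s)"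
      by (simp add: gfun_def right_diff_distrib sum_distrib_left mult_ac)
    then show ?thesis
      by (simp add: Z_def fps_sum_nth)
  qed
  also have "\<dots> = 0"
    using gfun_Euler[OF s r, of i] r by (simp add: fps_X_mult_nth)
  finally show ?thesis
    by simp
qed

section \<open>The submodule generated by the f_i is an ideal of C[h]\<close>

context
  fixes n r :: nat
  assumes n: "n > 0" and r: "r > 0"
begin

lemma dunkl_fpoly:
  assumes "i \<in> {1..n}"
  shows "dunkl n (of_nat r / of_nat n) v (fpoly n r i) = 0"
proof -
  have "dunkl n (of_nat r / of_nat n) v (mconst (- 1) * (gfun n (of_nat r / of_nat n) i $ r)) = 0"
    unfolding dunkl_mconst_mult using dunkl_gfun[OF assms _ r] n by simp
  then show ?thesis
    by (simp add: fpoly_eq mconst_uminus)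
qed

lemma fpoly_in_Ch:
  assumes "i \<in> {1..n}"
  shows "fpoly n r i \<in> Ch n"
proof -
  have "fpoly n r i \<in> polys_in {1..n}"
    unfolding fpoly_eq by (intro polys_in_uminus gfun_in_polys assms)
  moreover have "(\<Sum>j\<in>{1..n}. pderiv_var j (fpoly n r i)) = 0"
    \<comment> \<open>For the vector (1, ..., 1) all differences v_i - v_j vanish, so the Dunkl
      operator is the sum of the partial derivatives; translation invariance thus follows from being
      killed by it.\<close>
    using dunkl_fpoly[OF assms, of "\<lambda>i. 1"] by (simp add: dunkl_eq split_beta)
  ultimately show ?thesis
    by (simp only: Ch_iff_sum_pderiv_var)
qed

lemma perm_poly_fpoly: "w permutes {1..n} \<Longrightarrow> perm_poly w (fpoly n r i) = fpoly n r (w i)"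
  unfolding fpoly_eq perm_poly_simps by (subst perm_poly_gfun) (rule refl | assumption)+

lemma cherednik_span_fpoly:
  "cherednik_span n (of_nat r / of_nat n) (fpoly n r ` {1..n}) = generated_ideal n (fpoly n r)"
proof (rule cherednik_span_eq_generated_ideal)
  show "fpoly n r i \<in> Ch n" if "i \<in> {1..n}" for i
    using that by (rule fpoly_in_Ch)
  show "perm_poly w (fpoly n r i) = fpoly n r (w i)" if "i \<in> {1..n}" "w permutes {1..n}" for i w
    using that(2) by (rule perm_poly_fpoly)
  show "dunkl n (of_nat r / of_nat n) v (fpoly n r i) = 0" if "i \<in> {1..n}" for i v
    using that by (rule dunkl_fpoly)
qed

end

section \<open>The common zeros of the \<open>f\<^sub>i\<close>\<close>

text \<open>Ideals of the full polynomial ring, because the generating functions and power sums are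
  not translation invariant. Two instances matter: the vanishing ideal of a point, and the ideal
  generated by the f_i and power sums.\<close>

definition mideal :: "mpoly set \<Rightarrow> bool" where
  "mideal K \<longleftrightarrow> 0 \<in> K \<and> (\<forall>p\<in>K. \<forall>q\<in>K. p + q \<in> K) \<and> (\<forall>c. \<forall>p\<in>K. c * p \<in> K)"

lemma mideal_closed:
  assumes "mideal K"
  shows "0 \<in> K" "p \<in> K \<Longrightarrow> q \<in> K \<Longrightarrow> p + q \<in> K" "p \<in> K \<Longrightarrow> c * p \<in> K"
    "p \<in> K \<Longrightarrow> p * c \<in> K" "p \<in> K \<Longrightarrow> - p \<in> K" "p \<in> K \<Longrightarrow> q \<in> K \<Longrightarrow> p - q \<in> K"
proof -
  show "0 \<in> K" and add: "p \<in> K \<Longrightarrow> q \<in> K \<Longrightarrow> p + q \<in> K"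
    and mult: "p \<in> K \<Longrightarrow> c * p \<in> K" for p q c
    using assms by (auto simp: mideal_def)
  show "p \<in> K \<Longrightarrow> p * c \<in> K"
    using mult[of p c] by (simp add: mult.commute)
  show neg: "p \<in> K \<Longrightarrow> - p \<in> K" for p
    using mult[of p "- 1"] by simp
  show "p \<in> K \<Longrightarrow> q \<in> K \<Longrightarrow> p - q \<in> K"
    using add[of p "- q"] neg[of q] by simp
qed

lemma mideal_sum:
  "mideal K \<Longrightarrow> (\<And>i. i \<in> A \<Longrightarrow> f i \<in> K) \<Longrightarrow> sum f A \<in> K"
  by (induction A rule: infinite_finite_induct) (auto intro: mideal_closed)

lemma mideal_cancel_mconst:
  assumes "mideal K" "mconst c * p \<in> K" "c \<noteq> 0"
  shows "p \<in> K"
  using mideal_closed(3)[OF assms(1,2), of "mconst (inverse c)"] mconst_inverse_cancel[OF assms(3)] by simp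

text \<open>The recurrence for the vector of the generating functions has no inhomogeneous term, so that the
  vanishing of all coefficients of \<open>u\<^sup>r\<close> propagates to all higher coefficients.\<close>

lemma gfun_tail:
  assumes K: "mideal K" and r: "\<And>i. i \<in> {1..n} \<Longrightarrow> gfun n s i $ r \<in> K" and "r \<le> m" "i \<in> {1..n}"
  shows "gfun n s i $ m \<in> K"
  using \<open>r \<le> m\<close> \<open>i \<in> {1..n}\<close>
proof (induction m arbitrary: i rule: dec_induct)
  case base
  then show ?case by (rule r)
next
  case (step m)
  have "of_nat (Suc m) * (mvar i * gfun n s i $ m) - mconst s * (\<Sum>j\<in>{1..n}. mvar j * gfun n s j $ m) \<in> K"
    using step by (intro mideal_closed[OF K] mideal_sum[OF K]) auto
  then have "mconst (of_nat (Suc m)) * gfun n s i $ Suc m \<in> K"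
    unfolding mconst_of_nat gfun_recurrence .
  then show ?case
    by (rule mideal_cancel_mconst[OF K]) (simp del: of_nat_Suc)
qed

text \<open>Since G_s = (1 - x_1 u) Y_1, its coefficient at u^m combines those of Y_1 at u^m and
  u^(m-1). Both exponents must be at least r, hence \<open>r < m\<close> here against
  \<open>r \<le> m\<close> in \<open>gfun_tail\<close>.\<close>

lemma gpow_tail:
  assumes K: "mideal K" and n: "n > 0"
    and r: "\<And>i. i \<in> {1..n} \<Longrightarrow> gfun n s i $ r \<in> K" and "r < m"
  shows "gpow n s $ m \<in> K"
proof -
  obtain l where l: "m = Suc l" "r \<le> l"
    using \<open>r < m\<close> by (cases m) auto
  have "gpow n s = gfun n s 1 * (1 - fps_const (mvar 1) * fps_X)"
    by (simp add: gfun_def mult.assoc geo_inverse)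
  also have "\<dots> = gfun n s 1 - fps_const (mvar 1) * (gfun n s 1 * fps_X)"
    by (simp add: algebra_simps)
  finally have "gpow n s $ m = gfun n s 1 $ m - mvar 1 * gfun n s 1 $ l"
    by (simp add: l)
  moreover have "gfun n s 1 $ m \<in> K" "gfun n s 1 $ l \<in> K"
    using gfun_tail[where n = n, OF K r] l n by auto
  ultimately show ?thesis
    by (auto intro: mideal_closed[OF K])
qed

section \<open>Evaluation at a point and orders of vanishing\<close>

definition peval_fps :: "(nat \<Rightarrow> complex) \<Rightarrow> mpoly fps \<Rightarrow> complex fps" where
  "peval_fps v F = Abs_fps (\<lambda>m. peval v (F $ m))"

lemma peval_fps_mult: "peval_fps v (F * G) = peval_fps v F * peval_fps v G"
  by (rule fps_ext) (simp add: peval_fps_def fps_mult_nth peval_simps)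

lemma peval_fps_prod: "peval_fps v (prod F A) = (\<Prod>i\<in>A. peval_fps v (F i))"
proof -
  have "peval_fps v 1 = 1"
    by (rule fps_ext) (simp add: peval_fps_def peval_simps)
  then show ?thesis
    by (induction A rule: infinite_finite_induct) (simp_all add: peval_fps_mult)
qed

abbreviation cpow :: "complex \<Rightarrow> complex \<Rightarrow> complex fps" where
  "cpow \<equiv> opow (\<lambda>c. c)"

lemma peval_fps_opow: "peval_fps v (opow mconst (mvar j) s) = cpow (v j) s"
  by (rule fps_ext) (simp add: peval_fps_def opow_def peval_simps)

lemma peval_fps_gpow: "peval_fps v (gpow n s) = (\<Prod>j\<in>{1..n}. cpow (v j) s)"
  by (simp add: gpow_def peval_fps_prod peval_fps_opow)

lemma peval_fps_gfun: "peval_fps v (gfun n s i) = (\<Prod>j\<in>{1..n}. cpow (v j) s) * cpow (v i) (- 1)"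
  by (simp add: gfun_def geo_def peval_fps_mult peval_fps_gpow peval_fps_opow)

lemma cpow_power: "cpow x s ^ m = cpow x (s * of_nat m)"
  by (induction m) (simp_all add: opow_0 opow_add coeff_hom_id algebra_simps)

lemma cpow_of_nat: "cpow x (of_nat m) = fps_of_poly ([:1, - x:] ^ m)"
  by (simp add: opow_of_nat coeff_hom_id fps_of_poly_power fps_of_poly_linear' fps_const_neg[symmetric])

lemma order_power:
  fixes p :: "complex poly"
  assumes "p \<noteq> 0" shows "Polynomial.order c (p ^ m) = m * Polynomial.order c p"
  using assms by (induction m) (simp_all add: order_mult)

lemma order_prod:
  fixes p :: "'a \<Rightarrow> complex poly"
  assumes "finite A" "\<And>i. i \<in> A \<Longrightarrow> p i \<noteq> 0"
  shows "Polynomial.order c (prod p A) = (\<Sum>i\<in>A. Polynomial.order c (p i))"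
  using assms by (induction A) (simp_all add: order_mult)

lemma sum_card_fibres: "finite A \<Longrightarrow> (\<Sum>a\<in>v ` A. card {i \<in> A. v i = a}) = card A"
  using sum.image_gen[of A "\<lambda>_. 1::nat" v] by simp

lemma dvd_cancel_gcd:
  fixes n r c :: nat
  assumes "n > 0"
  shows "n dvd r * c \<longleftrightarrow> n div gcd r n dvd c"
proof -
  define d where "d = gcd r n"
  obtain q e where q: "n = d * q" and e: "r = d * e"
    by (metis d_def dvd_def gcd_dvd1 gcd_dvd2)
  have d: "d > 0" using assms q by (cases d) auto
  have "d * gcd e q = d"
    using d_def unfolding q e by (simp add: gcd_mult_distrib_nat)
  then have cop: "coprime q e"
    using d by (simp add: coprime_iff_gcd_eq_1 gcd.commute)
  have "n dvd r * c \<longleftrightarrow> q dvd e * c"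
    using d by (simp add: q e mult.assoc)
  also have "\<dots> \<longleftrightarrow> q dvd c"
    using cop by (rule coprime_dvd_mult_right_iff)
  also have "q = n div gcd r n"
    unfolding d_def[symmetric] using d by (subst q) simp
  finally show ?thesis .
qed

text \<open>At a common zero \<open>v\<close>, the power series \<open>\<Prod>\<^sub>j (1 - v\<^sub>j u)\<^bsup>r/n\<^esup>\<close> is a polynomial whose \<open>n\<close>-th power
  is \<open>\<Prod>\<^sub>j (1 - v\<^sub>j u)\<^sup>r\<close>; compare the orders of vanishing.\<close>

lemma fibres_of_zero:
  assumes n: "n > 0" and zero: "\<And>i. i \<in> {1..n} \<Longrightarrow> peval v (fpoly n r i) = 0"
  shows "n div gcd r n dvd card {i\<in>{1..n}. v i = a}"
proof -
  let ?q = "n div gcd r n"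
  define s :: complex where "s = of_nat r / of_nat n"
  define g where "g = (\<Prod>j\<in>{1..n}. cpow (v j) s)"
  have K: "mideal {p. peval v p = 0}"
    by (simp add: mideal_def peval_simps)
  have "g $ m = 0" if "r < m" for m
  proof -
    have "gpow n s $ m \<in> {p. peval v p = 0}"
      using zero by (intro gpow_tail[OF K n _ that]) (simp add: fpoly_eq peval_simps s_def)
    then show ?thesis
      using peval_fps_gpow[of v n s] by (simp add: g_def peval_fps_def fps_eq_iff)
  qed
  then have "g = fps_of_poly (\<Sum>m\<le>r. monom (g $ m) m)"
    by (intro fps_ext) (auto simp: coeff_sum coeff_monom sum.delta)
  then obtain P where P: "g = fps_of_poly P" ..
  have "fps_of_poly (P ^ n) = (\<Prod>j\<in>{1..n}. cpow (v j) (s * of_nat n))"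
    unfolding fps_of_poly_power P[symmetric] g_def by (simp add: prod_power_distrib cpow_power)
  also have "\<dots> = fps_of_poly (\<Prod>j\<in>{1..n}. [:1, - v j:] ^ r)"
    using n by (simp add: s_def cpow_of_nat fps_of_poly_prod)
  finally have Pn: "P ^ n = (\<Prod>j\<in>{1..n}. [:1, - v j:] ^ r)"
    by (simp only: fps_of_poly_eq_iff)
  have nz: "[:1, - v j:] ^ r \<noteq> 0" for j
    by simp
  have "P \<noteq> 0"
  proof
    assume "P = 0"
    then have "(\<Prod>j\<in>{1..n}. [:1, - v j:] ^ r) = 0"
      using Pn n by (simp add: power_0_left)
    then show False
      using nz unfolding prod_zero_iff[OF finite_atLeastAtMost] by blast
  qed
  have q_dvd: "?q dvd card {i\<in>{1..n}. v i = b}" if "b \<noteq> 0" for b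
  proof -
    have ord: "Polynomial.order (1 / b) [:1, - v j:] = (if v j = b then 1 else 0)" for j
    proof (cases "v j = b")
      case True
      then have "[:1, - v j:] = Polynomial.smult (- b) ([:- (1 / b), 1:] ^ 1)"
        using that by simp
      then have "Polynomial.order (1 / b) [:1, - v j:] = Polynomial.order (1 / b) ([:- (1 / b), 1:] ^ 1)"
        using that by (metis order_smult neg_equal_0_iff_equal)
      then show ?thesis
        by (simp only: if_P[OF True] order_power_n_n)
    next
      case False
      then show ?thesis
        using that by (auto intro!: order_0I simp: field_simps)
    qed
    have "n * Polynomial.order (1 / b) P = Polynomial.order (1 / b) (P ^ n)"
      using \<open>P \<noteq> 0\<close> by (simp add: order_power)
    also have "\<dots> = (\<Sum>j\<in>{1..n}. r * (if v j = b then 1 else 0))"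
      unfolding Pn by (subst order_prod) (simp_all add: order_power ord nz)
    also have "\<dots> = r * card {i\<in>{1..n}. v i = b}"
      by (simp add: sum.If_cases Int_def flip: sum_distrib_left)
    finally have "n dvd r * card {i\<in>{1..n}. v i = b}"
      by (metis dvd_triv_left)
    then show ?thesis
      using dvd_cancel_gcd[OF n] by blast
  qed
  show ?thesis
  proof (cases "a = 0")
    case True
    \<comment> \<open>Coordinates equal to 0 contribute the factor 1 and leave no trace in
      \<open>P\<close>. Their number is found by complement: n and all other multiplicities are
      divisible by \<open>?q\<close>.\<close>
    let ?A = "{i\<in>{1..n}. v i \<noteq> 0}"
    have "?q dvd (\<Sum>b\<in>v ` ?A. card {i \<in> ?A. v i = b})"
    proof (rule dvd_sum)
      fix b assume "b \<in> v ` ?A"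
      then have "b \<noteq> 0" and "{i \<in> ?A. v i = b} = {i\<in>{1..n}. v i = b}"
        by auto
      then show "?q dvd card {i \<in> ?A. v i = b}"
        using q_dvd by simp
    qed
    then have A: "?q dvd card ?A"
      by (subst (asm) sum_card_fibres) simp_all
    have "card ?A + card {i\<in>{1..n}. v i = 0} = card (?A \<union> {i\<in>{1..n}. v i = 0})"
      by (rule card_Un_disjoint[symmetric]) auto
    also have "?A \<union> {i\<in>{1..n}. v i = 0} = {1..n}"
      by auto
    finally have eq: "card ?A + card {i\<in>{1..n}. v i = 0} = n"
      by simp
    have "?q dvd card ?A + card {i\<in>{1..n}. v i = 0}"
      unfolding eq by (metis dvd_div_mult_self dvd_triv_left gcd_dvd2)
    then show ?thesis
      unfolding True using dvd_add_right_iff[OF A] by blast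
  qed (use q_dvd in blast)
qed

text \<open>Let N(a) be the multiplicity of a. The exponents e(a) = r N(a)/n are natural numbers, so
  G_{r/n} is the product of the (1 - a u)^e(a), of degree at most the sum r of the exponents.
  Dividing by 1 - v_i u lowers one positive exponent, and the coefficient of u^r disappears.\<close>

lemma zero_of_fibres:
  assumes n: "n > 0" and r: "r > 0" and fib: "\<And>a. n div gcd r n dvd card {i\<in>{1..n}. v i = a}"
    and i: "i \<in> {1..n}"
  shows "peval v (fpoly n r i) = 0"
proof -
  define s :: complex where "s = of_nat r / of_nat n"
  define N where "N a = card {i\<in>{1..n}. v i = a}" for a
  define e where "e a = r * N a div n" for a
  have "n dvd r * N a" for a
    using dvd_cancel_gcd[OF n] fib by (simp add: N_def)
  then have ne: "n * e a = r * N a" for a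
    by (simp add: e_def)
  have se: "s * of_nat (N a) = of_nat (e a)" for a
    using arg_cong[OF ne[of a], of "of_nat :: nat \<Rightarrow> complex"] n by (simp add: s_def field_simps)
  let ?V = "v ` {1..n}"
  have "n * (\<Sum>a\<in>?V. e a) = r * (\<Sum>a\<in>?V. N a)"
    by (simp add: sum_distrib_left ne)
  also have "(\<Sum>a\<in>?V. N a) = n"
    using sum_card_fibres[of "{1..n}" v] by (simp add: N_def)
  finally have sum_e: "(\<Sum>a\<in>?V. e a) = r"
    using n by simp
  have "N (v i) > 0"
    using i by (auto simp: N_def card_gt_0_iff)
  then have ei: "e (v i) > 0"
    using ne[of "v i"] r by (metis mult_is_0 neq0_conv)
  have "(\<Prod>j\<in>{1..n}. cpow (v j) s) = (\<Prod>a\<in>?V. \<Prod>j\<in>{j\<in>{1..n}. v j = a}. cpow (v j) s)"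
    by (rule prod.image_gen) simp
  also have "\<dots> = (\<Prod>a\<in>?V. fps_of_poly ([:1, - a:] ^ e a))"
  proof (rule prod.cong[OF refl])
    fix a
    have "(\<Prod>j\<in>{j\<in>{1..n}. v j = a}. cpow (v j) s) = (\<Prod>j\<in>{j\<in>{1..n}. v j = a}. cpow a s)"
      by (rule prod.cong) auto
    also have "\<dots> = cpow a s ^ N a"
      by (simp add: N_def)
    finally show "(\<Prod>j\<in>{j\<in>{1..n}. v j = a}. cpow (v j) s) = fps_of_poly ([:1, - a:] ^ e a)"
      by (simp add: cpow_power se cpow_of_nat)
  qed
  also have "\<dots> = fps_of_poly ([:1, - v i:] ^ e (v i)) * (\<Prod>a\<in>?V - {v i}. fps_of_poly ([:1, - a:] ^ e a))"
    using i by (subst prod.remove[of ?V "v i"]) auto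
  also have "fps_of_poly ([:1, - v i:] ^ e (v i)) = cpow (v i) 1 * fps_of_poly ([:1, - v i:] ^ (e (v i) - 1))"
    unfolding cpow_of_nat[symmetric] using ei by (simp add: of_nat_diff flip: opow_add[OF coeff_hom_id])
  finally have "peval_fps v (gfun n s i) = (cpow (v i) 1 * cpow (v i) (- 1)) *
      fps_of_poly ([:1, - v i:] ^ (e (v i) - 1) * (\<Prod>a\<in>?V - {v i}. [:1, - a:] ^ e a))"
    unfolding peval_fps_gfun fps_of_poly_mult fps_of_poly_prod by (simp only: mult_ac)
  also have "cpow (v i) 1 * cpow (v i) (- 1) = 1"
    by (simp add: opow_0 coeff_hom_id flip: opow_add[OF coeff_hom_id])
  finally have "peval v (gfun n s i $ r) =
      coeff ([:1, - v i:] ^ (e (v i) - 1) * (\<Prod>a\<in>?V - {v i}. [:1, - a:] ^ e a)) r"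
    by (simp add: peval_fps_def fps_eq_iff)
  also have "\<dots> = 0"
  proof (rule coeff_eq_0)
    have deg: "degree ([:1, - a:] ^ m) \<le> m" for a :: complex and m
      using degree_power_le[of "[:1, - a:]" m] by (auto split: if_splits)
    have "degree ([:1, - v i:] ^ (e (v i) - 1) * (\<Prod>a\<in>?V - {v i}. [:1, - a:] ^ e a)) \<le>
        degree ([:1, - v i:] ^ (e (v i) - 1)) + degree (\<Prod>a\<in>?V - {v i}. [:1, - a:] ^ e a)"
      by (rule degree_mult_le)
    also have "degree (\<Prod>a\<in>?V - {v i}. [:1, - a:] ^ e a) \<le> (\<Sum>a\<in>?V - {v i}. degree ([:1, - a:] ^ e a))"
      using degree_prod_sum_le[of "?V - {v i}" "\<lambda>a. [:1, - a:] ^ e a"] by (simp add: comp_def)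
    also have "\<dots> \<le> (\<Sum>a\<in>?V - {v i}. e a)"
      by (intro sum_mono deg)
    also have "degree ([:1, - v i:] ^ (e (v i) - 1)) \<le> e (v i) - 1"
      by (rule deg)
    also have "e (v i) - 1 + (\<Sum>a\<in>?V - {v i}. e a) < r"
      using sum.remove[of ?V "v i" e] i ei sum_e by simp
    finally show "degree ([:1, - v i:] ^ (e (v i) - 1) * (\<Prod>a\<in>?V - {v i}. [:1, - a:] ^ e a)) < r"
      by simp
  qed
  finally show ?thesis
    by (simp add: fpoly_eq peval_simps s_def)
qed

lemma fpoly_zeros_iff:
  assumes "n > 0" "r > 0"
  shows "(\<forall>i\<in>{1..n}. peval v (fpoly n r i) = 0) \<longleftrightarrow>
    (\<forall>a. n div gcd r n dvd card {i\<in>{1..n}. v i = a})"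
  using fibres_of_zero[OF assms(1)] zero_of_fibres[OF assms] by blast

section \<open>Quotients by ideals and their support\<close>

locale Ch_ideal =
  fixes n :: nat and J :: "mpoly set"
  assumes subset_Ch: "J \<subseteq> Ch n"
    and zero_mem: "0 \<in> J"
    and add_mem: "p \<in> J \<Longrightarrow> q \<in> J \<Longrightarrow> p + q \<in> J"
    and mult_mem: "p \<in> J \<Longrightarrow> c \<in> Ch n \<Longrightarrow> c * p \<in> J"
begin

lemma uminus_mem: "p \<in> J \<Longrightarrow> - p \<in> J"
  using mult_mem[OF _ Ch_mconst[of "- 1"], of p] by (simp add: mconst_uminus)

lemma diff_mem: "p \<in> J \<Longrightarrow> q \<in> J \<Longrightarrow> p - q \<in> J"
  using add_mem[of p "- q"] uminus_mem[of q] by simp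

definition cls :: "mpoly \<Rightarrow> mpoly set" where
  "cls p = {q + p | q. q \<in> J}"

lemma mem_cls_iff: "q \<in> cls p \<longleftrightarrow> q - p \<in> J"
  by (auto simp: cls_def intro: exI[of _ "q - p"])

lemma cls_eq_iff: "cls p = cls q \<longleftrightarrow> p - q \<in> J"
proof
  assume "cls p = cls q"
  then show "p - q \<in> J"
    using mem_cls_iff[of p p] mem_cls_iff[of p q] zero_mem by simp
next
  assume pq: "p - q \<in> J"
  show "cls p = cls q"
  proof (rule Set.set_eqI)
    fix x
    have "x - q = (x - p) + (p - q)" "x - p = (x - q) - (p - q)"
      by simp_all
    then show "x \<in> cls p \<longleftrightarrow> x \<in> cls q"
      unfolding mem_cls_iff using pq add_mem diff_mem by metis
  qed
qed

lemma cls_0: "cls 0 = J"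
  by (simp add: cls_def)

lemma coset_eq_cls: "J +>\<^bsub>Ch_module n\<^esub> p = cls p"
  by (auto simp: a_r_coset_def' Ch_module_def cls_def)

lemma carrier_Vmod: "carrier (Vmod n J) = cls ` Ch n"
  by (auto simp: Vmod_def quotient_module_def A_RCOSETS_def' coset_eq_cls) (auto simp: Ch_module_def)

lemma zero_Vmod: "\<zero>\<^bsub>Vmod n J\<^esub> = cls 0"
  by (simp add: Vmod_def quotient_module_def cls_0)

lemma add_Vmod: "cls p \<oplus>\<^bsub>Vmod n J\<^esub> cls q = cls (p + q)"
proof -
  have "cls p \<oplus>\<^bsub>Vmod n J\<^esub> cls q = {a + b | a b. a \<in> cls p \<and> b \<in> cls q}"
    by (auto simp: Vmod_def quotient_module_def set_add_def' Ch_module_def)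
  also have "\<dots> = cls (p + q)"
  proof (intro Set.set_eqI iffI)
    fix x assume "x \<in> {a + b | a b. a \<in> cls p \<and> b \<in> cls q}"
    then obtain a b where "x = a + b" "a - p \<in> J" "b - q \<in> J"
      by (auto simp: mem_cls_iff)
    moreover have "a + b - (p + q) = (a - p) + (b - q)"
      by simp
    ultimately show "x \<in> cls (p + q)"
      by (simp only: mem_cls_iff add_mem)
  next
    fix x assume "x \<in> cls (p + q)"
    then have "x = (x - q) + q" "x - q \<in> cls p" "q \<in> cls q"
      using zero_mem by (auto simp: mem_cls_iff diff_diff_eq add.commute)
    then show "x \<in> {a + b | a b. a \<in> cls p \<and> b \<in> cls q}"
      by blast
  qed
  finally show ?thesis .
qed

lemma smult_Vmod:
  assumes "c \<in> Ch n"
  shows "c \<odot>\<^bsub>Vmod n J\<^esub> cls p = cls (c * p)"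
proof -
  have "c \<odot>\<^bsub>Vmod n J\<^esub> cls p = (\<Union>m\<in>cls p. cls (c * m))"
    by (simp add: Vmod_def quotient_module_def coset_eq_cls) (simp add: Ch_module_def)
  also have "\<dots> = cls (c * p)"
  proof -
    have "cls (c * m) = cls (c * p)" if "m \<in> cls p" for m
      using that mult_mem[of "m - p" c] assms by (simp add: mem_cls_iff cls_eq_iff right_diff_distrib)
    moreover have "p \<in> cls p"
      by (simp add: mem_cls_iff zero_mem)
    ultimately show ?thesis
      by blast
  qed
  finally show ?thesis .
qed

text \<open>The module is generated by the class of \<open>1\<close>, so its localization vanishes iff that class is killed by
  some function outside the maximal ideal.\<close>

lemma supp_iff:
  assumes y: "y \<in> hspace n"
  shows "y \<in> supp n (Vmod n J) \<longleftrightarrow> J \<subseteq> max_ideal_at n y"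
proof -
  let ?M = "max_ideal_at n y" and ?R = "loc_rel (Ch_ring n) (Vmod n J) (max_ideal_at n y)"
  have R: "((a, s), (b, t)) \<in> ?R \<longleftrightarrow> a \<in> cls ` Ch n \<and> b \<in> cls ` Ch n \<and> s \<in> Ch n - ?M \<and> t \<in> Ch n - ?M \<and>
      (\<exists>u\<in>Ch n - ?M. u \<odot>\<^bsub>Vmod n J\<^esub> (t \<odot>\<^bsub>Vmod n J\<^esub> a) = u \<odot>\<^bsub>Vmod n J\<^esub> (s \<odot>\<^bsub>Vmod n J\<^esub> b))" for a s b t
    by (simp add: loc_rel_def Ch_ring_def carrier_Vmod)
  obtain v where v: "v \<in> cvec n" "y = hclass n v"
    using y by (auto simp: hspace_def hclass_def quotient_def)
  then have "v \<in> y"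
    using cvec_nonempty_class(1) by simp
  then have one: "1 \<in> Ch n - ?M"
    by (auto simp: max_ideal_at_def peval_simps)
  let ?L = "localization (Ch_ring n) (Vmod n J) ?M" and ?Z = "localization_zero (Ch_ring n) (Vmod n J) ?M"
  have L: "?L = (cls ` Ch n \<times> (Ch n - ?M)) // ?R" and Z: "?Z = ?R `` {(cls 0, 1)}"
    by (simp_all add: localization_def localization_zero_def carrier_Vmod zero_Vmod Ch_ring_def)
  show ?thesis
  proof
    assume "y \<in> supp n (Vmod n J)"
    then have ne: "?L \<noteq> {?Z}"
      by (simp add: supp_def)
    show "J \<subseteq> ?M"
    proof (rule ccontr)
      assume "\<not> J \<subseteq> ?M"
      then obtain s where s: "s \<in> J" "s \<notin> ?M" by blast
      have "((cls p, a), (cls q, b)) \<in> ?R"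
        if "p \<in> Ch n" "q \<in> Ch n" "a \<in> Ch n - ?M" "b \<in> Ch n - ?M" for p q a b
      proof -
        have s_mult: "s * x \<in> J" if "x \<in> Ch n" for x
          using mult_mem[OF s(1) that] by (simp add: mult.commute)
        have "cls (s * (b * p)) = cls (s * (a * q))"
          unfolding cls_eq_iff using that by (intro diff_mem s_mult Ch_mult) auto
        moreover have "s \<in> Ch n" "a \<in> Ch n" "b \<in> Ch n"
          using s subset_Ch that by auto
        ultimately have "s \<odot>\<^bsub>Vmod n J\<^esub> (b \<odot>\<^bsub>Vmod n J\<^esub> cls p) = s \<odot>\<^bsub>Vmod n J\<^esub> (a \<odot>\<^bsub>Vmod n J\<^esub> cls q)"
          by (simp only: smult_Vmod)
        then show ?thesis
          unfolding R using that s subset_Ch by blast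
      qed
      then have all: "?R `` {x} = cls ` Ch n \<times> (Ch n - ?M)" if "x \<in> cls ` Ch n \<times> (Ch n - ?M)" for x
        using that by (auto simp: R)
      have mem: "(cls 0, 1) \<in> cls ` Ch n \<times> (Ch n - ?M)"
        using one by auto
      have "?L = (\<Union>x\<in>cls ` Ch n \<times> (Ch n - ?M). {cls ` Ch n \<times> (Ch n - ?M)})"
        unfolding L quotient_def by (rule SUP_cong[OF refl]) (simp only: all)
      also have "\<dots> = {?Z}"
        unfolding Z all[OF mem] using mem by blast
      finally have "?L = {?Z}" .
      then show False using ne by simp
    qed
  next
    assume sub: "J \<subseteq> ?M"
    have notin: "(cls 1, 1) \<notin> ?Z"
    proof
      assume "(cls 1, 1) \<in> ?Z"
      then obtain u where u: "u \<in> Ch n - ?M"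
        and "u \<odot>\<^bsub>Vmod n J\<^esub> (1 \<odot>\<^bsub>Vmod n J\<^esub> cls 0) = u \<odot>\<^bsub>Vmod n J\<^esub> (1 \<odot>\<^bsub>Vmod n J\<^esub> cls 1)"
        unfolding Z Image_singleton_iff R by blast
      then have "cls u = cls 0"
        by (simp add: smult_Vmod)
      then show False
        using u sub by (auto simp: cls_eq_iff)
    qed
    have L_mem: "?R `` {(cls 1, 1)} \<in> ?L"
      unfolding L using one by (intro quotientI) auto
    have R_mem: "(cls 1, 1) \<in> ?R `` {(cls 1, 1)}"
      unfolding Image_singleton_iff R using one by blast
    have "?L \<noteq> {?Z}"
    proof
      assume "?L = {?Z}"
      then have "?R `` {(cls 1, 1)} = ?Z"
        using L_mem by (simp only: singleton_iff)
      then show False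
        using R_mem notin by (simp only:)
    qed
    then show "y \<in> supp n (Vmod n J)"
      using y by (simp add: supp_def)
  qed
qed

end

lemma Ch_ideal_generated_ideal:
  assumes "\<And>i. i \<in> {1..n} \<Longrightarrow> f i \<in> Ch n"
  shows "Ch_ideal n (generated_ideal n f)"
  using generated_ideal_subset_Ch[of n f, OF assms]
  by unfold_locales (simp_all add: generated_ideal_0 generated_ideal_add generated_ideal_Ch_mult)

lemma generated_ideal_subset_max_ideal_at:
  assumes f: "\<And>i. i \<in> {1..n} \<Longrightarrow> f i \<in> Ch n" and v: "v \<in> cvec n"
  shows "generated_ideal n f \<subseteq> max_ideal_at n (hclass n v) \<longleftrightarrow> (\<forall>i\<in>{1..n}. peval v (f i) = 0)"
proof -
  have max: "p \<in> max_ideal_at n (hclass n v) \<longleftrightarrow> peval v p = 0" if p: "p \<in> Ch n" for p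
  proof -
    have shift: "peval u p = peval v p" if u: "u \<in> hclass n v" for u
    proof -
      obtain a where "\<And>i. i \<in> {1..n} \<Longrightarrow> v i - u i = a"
        using u unfolding hclass_def diag_rel_def by blast
      then show ?thesis
        by (rule Ch_peval_cong[OF p, symmetric])
    qed
    show ?thesis
      unfolding max_ideal_at_def mem_Collect_eq
      using p cvec_nonempty_class(1)[OF v] shift by metis
  qed
  show ?thesis
  proof
    assume sub: "generated_ideal n f \<subseteq> max_ideal_at n (hclass n v)"
    show "\<forall>i\<in>{1..n}. peval v (f i) = 0"
    proof
      fix i assume i: "i \<in> {1..n}"
      have "f i \<in> max_ideal_at n (hclass n v)"
        using sub generated_ideal_gen[OF i] by (rule subsetD)
      then show "peval v (f i) = 0"
        by (simp only: max[OF f[OF i]])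
    qed
  next
    assume 0: "\<forall>i\<in>{1..n}. peval v (f i) = 0"
    show "generated_ideal n f \<subseteq> max_ideal_at n (hclass n v)"
    proof
      fix p assume p: "p \<in> generated_ideal n f"
      have "p \<in> Ch n"
        using generated_ideal_subset_Ch[of n f, OF f] p by blast
      moreover have "peval v p = 0"
        using p 0 by (auto simp: generated_ideal_def peval_simps)
      ultimately show "p \<in> max_ideal_at n (hclass n v)"
        by (simp only: max)
    qed
  qed
qed

section \<open>The arrangement\<close>

lemma perm_hspace_hclass:
  assumes w: "w permutes {1..n}" and v: "v \<in> cvec n"
  shows "perm_hspace w (hclass n v) = hclass n (perm_vec w v)"
proof (intro Set.set_eqI iffI)
  have inv: "inv_into UNIV w (w i) = i" "w (inv_into UNIV w i) = i" for i
    using permutes_inverses[OF w] by simp_all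
  have winv: "inv_into UNIV w permutes {1..n}"
    using w by (rule permutes_inv)
  fix u
  show "u \<in> hclass n (perm_vec w v)" if mem: "u \<in> perm_hspace w (hclass n v)"
  proof -
    obtain u' where "u = perm_vec w u'" "u' \<in> hclass n v"
      using mem unfolding perm_hspace_def by blast
    then obtain a where u: "u = perm_vec w u'" "u' \<in> cvec n" "\<And>i. i \<in> {1..n} \<Longrightarrow> v i - u' i = a"
      unfolding hclass_def diag_rel_def by blast
    have "perm_vec w v i - u i = a" if "i \<in> {1..n}" for i
      unfolding u(1) perm_vec_def by (rule u(3)) (use that permutes_in_image[OF winv] in blast)
    then show ?thesis
      unfolding hclass_def diag_rel_def using cvec_perm_vec[OF w] v u by blast
  qed
  show "u \<in> perm_hspace w (hclass n v)" if mem: "u \<in> hclass n (perm_vec w v)"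
  proof -
    obtain a where u: "u \<in> cvec n" "\<And>i. i \<in> {1..n} \<Longrightarrow> perm_vec w v i - u i = a"
      using mem unfolding hclass_def diag_rel_def by blast
    have "v i - u (w i) = a" if "i \<in> {1..n}" for i
      using u(2)[of "w i"] permutes_in_image[OF w] that by (simp add: perm_vec_def inv)
    moreover have "(\<lambda>i. u (w i)) \<in> cvec n"
      using u(1) permutes_not_in[OF w] by (simp add: cvec_def del: atLeastAtMost_iff)
    ultimately have "(\<lambda>i. u (w i)) \<in> hclass n v"
      unfolding hclass_def diag_rel_def using v by blast
    moreover have "u = perm_vec w (\<lambda>i. u (w i))"
      by (simp add: perm_vec_def inv)
    ultimately show ?thesis
      unfolding perm_hspace_def by blast
  qed
qed

text \<open>Indices start at 1, hence division with remainder of i - 1: b is the block and s the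
  position within it.\<close>

lemma block_decomposition:
  fixes d q :: nat
  assumes "q > 0"
  shows "{1..d * q} = (\<lambda>(b, s). b * q + s + 1) ` ({..<d} \<times> {..<q})"
proof (intro Set.set_eqI iffI)
  fix i assume i: "i \<in> {1..d * q}"
  have "i = (i - 1) div q * q + (i - 1) mod q + 1"
    using i by simp
  moreover have "(i - 1) div q < d" "(i - 1) mod q < q"
    using i assms by (auto intro!: less_mult_imp_div_less)
  ultimately show "i \<in> (\<lambda>(b, s). b * q + s + 1) ` ({..<d} \<times> {..<q})"
    by (intro image_eqI[of _ _ "((i - 1) div q, (i - 1) mod q)"]) (simp_all only: prod.case mem_Times_iff fst_conv snd_conv lessThan_iff)
next
  fix i assume "i \<in> (\<lambda>(b, s). b * q + s + 1) ` ({..<d} \<times> {..<q})"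
  then obtain b s where i: "i = b * q + s + 1" "b < d" "s < q"
    by auto
  then have "b * q + s + 1 \<le> (b + 1) * q" "(b + 1) * q \<le> d * q"
    by (simp, intro mult_le_mono1) simp
  then show "i \<in> {1..d * q}"
    using i by simp
qed

lemma inj_on_block_index: "inj_on (\<lambda>(b, s). b * q + s + 1) (A \<times> {..<q::nat})"
proof (rule inj_onI, clarsimp)
  fix b s b' s' assume "s < q" "s' < q" and eq: "b * q + s = b' * q + s'"
  from \<open>s < q\<close> have "(b * q + s) div q = b" "(b * q + s) mod q = s"
    by simp_all
  moreover have "(b' * q + s') div q = b'" "(b' * q + s') mod q = s'"
    using \<open>s' < q\<close> by simp_all
  ultimately show "b = b' \<and> s = s'"
    using eq by metis
qed

lemma card_block_fibre:
  assumes "q > 0" and c: "\<And>b s. b < d \<Longrightarrow> s < q \<Longrightarrow> v (b * q + s + 1) = c b"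
  shows "card {i\<in>{1..d * q}. v i = a} = q * card {b. b < d \<and> c b = a}"
proof -
  have "{i\<in>{1..d * q}. v i = a} = (\<lambda>(b, s). b * q + s + 1) ` ({b. b < d \<and> c b = a} \<times> {..<q})"
    unfolding block_decomposition[OF assms(1)] using c by auto
  also have "card \<dots> = card ({b. b < d \<and> c b = a} \<times> {..<q})"
    by (rule card_image, rule inj_on_block_index)
  finally show ?thesis
    by (simp add: card_cartesian_product mult.commute)
qed

lemma fibres_block:
  assumes n: "n > 0" and "d dvd n" and v: "v \<in> cvec n"
    and block: "\<forall>b<d. \<forall>i\<in>{b * (n div d) + 1..(b + 1) * (n div d)}.
      \<forall>j\<in>{b * (n div d) + 1..(b + 1) * (n div d)}. v i = v j"
  shows "n div d dvd card {i\<in>{1..n}. v i = a}"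
proof -
  let ?q = "n div d"
  have q: "?q > 0" "n = d * ?q"
    using dvd_imp_le[OF \<open>d dvd n\<close> n] dvd_pos_nat[OF n \<open>d dvd n\<close>] \<open>d dvd n\<close>
    by (simp_all add: div_greater_zero_iff)
  have "v (b * ?q + s + 1) = v (b * ?q + 1)" if "b < d" "s < ?q" for b s
  proof -
    have "b * ?q + s + 1 \<in> {b * ?q + 1..(b + 1) * ?q}" "b * ?q + 1 \<in> {b * ?q + 1..(b + 1) * ?q}"
      using that by auto
    then show ?thesis
      using block that(1) by blast
  qed
  then show ?thesis
    using card_block_fibre[where v = v and c = "\<lambda>b. v (b * ?q + 1)", OF q(1), of d a] q(2) by simp
qed

text \<open>The multiset of coordinates of u consists of n/d copies of a multiset with d elements.
  Any listing of the latter gives the block values of a vector v with the same coordinates as u up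
  to order, so a permutation relates the two.\<close>

lemma block_of_fibres:
  assumes n: "n > 0" and "d dvd n" and u: "u \<in> cvec n"
    and fib: "\<And>a. n div d dvd card {i\<in>{1..n}. u i = a}"
  obtains w v where "w permutes {1..n}" "v \<in> cvec n" "u = perm_vec w v"
    "\<forall>b<d. \<forall>i\<in>{b * (n div d) + 1..(b + 1) * (n div d)}.
      \<forall>j\<in>{b * (n div d) + 1..(b + 1) * (n div d)}. v i = v j"
proof -
  let ?q = "n div d"
  have q: "?q > 0" "n = d * ?q"
    using dvd_imp_le[OF \<open>d dvd n\<close> n] dvd_pos_nat[OF n \<open>d dvd n\<close>] \<open>d dvd n\<close>
    by (simp_all add: div_greater_zero_iff)
  define M where "M = image_mset u (mset_set {1..n})"
  have cM: "count M a = card {i\<in>{1..n}. u i = a}" for a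
    unfolding M_def by (rule count_image_mset_eq_card_vimage) simp
  define N where "N = (\<Sum>a\<in>set_mset M. replicate_mset (count M a div ?q) a)"
  have cN: "count N a = count M a div ?q" for a
    by (simp add: N_def count_sum sum.delta' not_in_iff)
  have MN: "count M a = ?q * count N a" for a
    using fib[of a] by (simp add: cN cM)
  obtain L where L: "mset L = N"
    using ex_mset by blast
  have "M = repeat_mset ?q N"
    by (rule multiset_eqI) (simp add: MN)
  then have "size M = ?q * length L"
    by (simp flip: L)
  then have len: "length L = d"
    using q by (simp add: M_def) (metis mult.commute mult_cancel1 not_gr0)
  define v where "v i = (if i \<in> {1..n} then L ! ((i - 1) div ?q) else 0)" for i
  have vb: "v (b * ?q + s + 1) = L ! b" if "b < d" "s < ?q" for b s
  proof -
    have "b * ?q + s + 1 \<in> {1..d * ?q}"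
      unfolding block_decomposition[OF q(1)] using that by auto
    then show ?thesis
      using that q by (simp add: v_def)
  qed
  have "image_mset v (mset_set {1..n}) = M"
  proof (rule multiset_eqI)
    fix a
    have "count (image_mset v (mset_set {1..n})) a = card {i\<in>{1..n}. v i = a}"
      by (rule count_image_mset_eq_card_vimage) simp
    also have "\<dots> = ?q * card {b. b < d \<and> L ! b = a}"
      using card_block_fibre[where v = v and c = "\<lambda>b. L ! b", OF q(1) vb, of d a] q(2) by simp
    also have "card {b. b < d \<and> L ! b = a} = card {b. b < d \<and> a = L ! b}"
      by (rule arg_cong[where f = card]) auto
    also have "\<dots> = count N a"
      by (simp add: L[symmetric] count_mset count_list_eq_length_filter length_filter_conv_card len)
    finally show "count (image_mset v (mset_set {1..n})) a = count M a"
      by (simp add: MN)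
  qed
  then have "image_mset u (mset_set {1..n}) = image_mset v (mset_set {1..n})"
    by (simp add: M_def)
  then obtain p where p: "p permutes {1..n}" "\<forall>i\<in>{1..n}. u i = v (p i)"
    by (rule image_mset_eq_implies_permutes[OF finite_atLeastAtMost])
  show ?thesis
  proof (rule that)
    show "inv_into UNIV p permutes {1..n}"
      using p(1) by (rule permutes_inv)
    show "v \<in> cvec n"
      by (simp add: cvec_def v_def)
    \<comment> \<open>\<open>perm_vec w v\<close> reads v at the inverse of w, so u_i = v_{p i}
      calls for w = p^(-1).\<close>
    show "u = perm_vec (inv_into UNIV p) v"
    proof
      fix i
      have "u i = v (p i)"
      proof (cases "i \<in> {1..n}")
        case False
        then show ?thesis
          using False u permutes_not_in[OF p(1) False] by (simp add: cvec_def v_def del: atLeastAtMost_iff)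
      qed (use p(2) in blast)
      then show "u i = perm_vec (inv_into UNIV p) v i"
        using permutes_bij[OF p(1)] by (simp add: perm_vec_def inv_inv_eq)
    qed
    have "v i = L ! b" if "b < d" "i \<in> {b * ?q + 1..(b + 1) * ?q}" for b i
    proof -
      have "i = b * ?q + (i - (b * ?q + 1)) + 1" "i - (b * ?q + 1) < ?q"
        using that(2) q(1) by auto
      then show ?thesis
        using vb[OF that(1), of "i - (b * ?q + 1)"] by simp
    qed
    then show "\<forall>b<d. \<forall>i\<in>{b * ?q + 1..(b + 1) * ?q}. \<forall>j\<in>{b * ?q + 1..(b + 1) * ?q}. v i = v j"
      by simp
  qed
qed

lemma perm_vec_fibres:
  assumes w: "w permutes {1..n}"
  shows "card {i\<in>{1..n}. perm_vec w v i = a} = card {i\<in>{1..n}. v i = a}"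
proof -
  have inv: "inv_into UNIV w (w i) = i" "w (inv_into UNIV w i) = i" for i
    using permutes_inverses[OF w] by simp_all
  have "{i\<in>{1..n}. perm_vec w v i = a} = w ` {i\<in>{1..n}. v i = a}"
  proof (intro Set.set_eqI iffI)
    fix i assume "i \<in> {i\<in>{1..n}. perm_vec w v i = a}"
    then show "i \<in> w ` {i\<in>{1..n}. v i = a}"
      using permutes_in_image[OF permutes_inv[OF w], of i]
      by (intro image_eqI[of _ _ "inv_into UNIV w i"]) (simp_all add: perm_vec_def inv)
  next
    fix i assume "i \<in> w ` {i\<in>{1..n}. v i = a}"
    then obtain j where "i = w j" "j \<in> {1..n}" "v j = a"
      by blast
    then show "i \<in> {i\<in>{1..n}. perm_vec w v i = a}"
      using permutes_in_image[OF w, of j] by (simp add: perm_vec_def inv)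
  qed
  then show ?thesis
    by (simp add: card_image inj_on_subset[OF permutes_inj[OF w]])
qed

text \<open>Membership in the arrangement depends only on the multiplicities of the coordinates, the
  form in which \<open>fpoly_zeros_iff\<close> describes the common zeros.\<close>

lemma arrangement_eq:
  assumes n: "n > 0" and d: "d dvd n"
  shows "(\<Union>w\<in>{w. w permutes {1..n}}. perm_hspace w ` block_subspace n d) =
    hclass n ` {v \<in> cvec n. \<forall>a. n div d dvd card {i\<in>{1..n}. v i = a}}"
proof (intro Set.set_eqI iffI)
  fix y assume "y \<in> (\<Union>w\<in>{w. w permutes {1..n}}. perm_hspace w ` block_subspace n d)"
  then obtain w v where w: "w permutes {1..n}" and v: "v \<in> cvec n" "y = perm_hspace w (hclass n v)"
    and block: "\<forall>b<d. \<forall>i\<in>{b * (n div d) + 1..(b + 1) * (n div d)}.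
      \<forall>j\<in>{b * (n div d) + 1..(b + 1) * (n div d)}. v i = v j"
    unfolding block_subspace_def by blast
  have "y = hclass n (perm_vec w v)" "perm_vec w v \<in> cvec n"
    using perm_hspace_hclass[OF w v(1)] cvec_perm_vec[OF w v(1)] v(2) by simp_all
  moreover have "n div d dvd card {i\<in>{1..n}. perm_vec w v i = a}" for a
    unfolding perm_vec_fibres[OF w] by (rule fibres_block[OF n d v(1) block])
  ultimately show "y \<in> hclass n ` {v \<in> cvec n. \<forall>a. n div d dvd card {i\<in>{1..n}. v i = a}}"
    by blast
next
  fix y assume "y \<in> hclass n ` {v \<in> cvec n. \<forall>a. n div d dvd card {i\<in>{1..n}. v i = a}}"
  then obtain u where u: "y = hclass n u" "u \<in> cvec n" and fib: "\<And>a. n div d dvd card {i\<in>{1..n}. u i = a}"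
    by blast
  obtain w v where wv: "w permutes {1..n}" "v \<in> cvec n" "u = perm_vec w v"
    "\<forall>b<d. \<forall>i\<in>{b * (n div d) + 1..(b + 1) * (n div d)}.
      \<forall>j\<in>{b * (n div d) + 1..(b + 1) * (n div d)}. v i = v j"
    by (rule block_of_fibres[OF n d u(2) fib])
  then have "y = perm_hspace w (hclass n v)"
    by (simp only: u(1) perm_hspace_hclass)
  moreover have "hclass n v \<in> block_subspace n d"
    unfolding block_subspace_def using wv(2,4) by blast
  ultimately show "y \<in> (\<Union>w\<in>{w. w permutes {1..n}}. perm_hspace w ` block_subspace n d)"
    using wv(1) by blast
qed

lemma supp_fpoly:
  assumes n: "n > 0" and r: "r > 0"
  shows "supp n (Vmod n (generated_ideal n (fpoly n r))) =
    (\<Union>w\<in>{w. w permutes {1..n}}. perm_hspace w ` block_subspace n (gcd r n))"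
proof -
  have f: "fpoly n r i \<in> Ch n" if "i \<in> {1..n}" for i
    using fpoly_in_Ch[OF n r that] .
  interpret Ch_ideal n "generated_ideal n (fpoly n r)"
    by (rule Ch_ideal_generated_ideal[OF f])
  have "hclass n v \<in> supp n (Vmod n (generated_ideal n (fpoly n r))) \<longleftrightarrow>
      (\<forall>a. n div gcd r n dvd card {i\<in>{1..n}. v i = a})" if v: "v \<in> cvec n" for v
    unfolding supp_iff[OF cvec_nonempty_class(2)[OF v]]
    using generated_ideal_subset_max_ideal_at[of n "fpoly n r", OF f v] fpoly_zeros_iff[OF n r, of v] by blast
  moreover have "supp n (Vmod n (generated_ideal n (fpoly n r))) \<subseteq> hclass n ` cvec n"
    by (auto simp: supp_def hspace_def hclass_def quotient_def)
  ultimately have "supp n (Vmod n (generated_ideal n (fpoly n r))) =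
      hclass n ` {v \<in> cvec n. \<forall>a. n div gcd r n dvd card {i\<in>{1..n}. v i = a}}"
    by blast
  then show ?thesis
    using arrangement_eq[OF n gcd_dvd2] by simp
qed

section \<open>Nilpotency of the coordinates modulo the \<open>f\<^sub>i\<close> and power sums\<close>

definition power_sum :: "nat \<Rightarrow> nat \<Rightarrow> mpoly" where
  "power_sum n j = (\<Sum>i\<in>{1..n}. mvar i ^ j)"

lemma geo_nth: "geo i $ m = mvar i ^ m"
proof -
  let ?A = "Abs_fps (\<lambda>m. mvar i ^ m)" and ?u = "1 - fps_const (mvar i) * fps_X"
  have "?A * ?u = 1"
  proof (rule fps_ext)
    fix m
    have "?A * ?u = ?A - fps_X * (fps_const (mvar i) * ?A)"
      by (simp add: algebra_simps)
    then show "(?A * ?u) $ m = 1 $ m"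
      by (cases m) simp_all
  qed
  then have "geo i = geo i * (?A * ?u)"
    by (simp only: mult_1_right)
  also have "\<dots> = ?A * (geo i * ?u)"
    by (simp only: mult_ac)
  also have "\<dots> = ?A"
    by (simp only: geo_inverse mult_1_right)
  finally show ?thesis
    by simp
qed

text \<open>Newton's identities for arbitrary exponents: the logarithmic derivative of G_s is -s
  times the generating series of the power sums.\<close>

lemma gpow_recurrence:
  "of_nat (Suc t) * gpow n s $ Suc t = - mconst s * (\<Sum>l\<in>{0..t}. power_sum n (Suc l) * gpow n s $ (t - l))"
proof -
  have ps: "(\<Sum>j\<in>{1..n}. fps_const (mvar j) * geo j) $ l = power_sum n (Suc l)" for l
    by (simp add: fps_sum_nth geo_nth power_sum_def)
  have "of_nat (Suc t) * gpow n s $ Suc t = fps_deriv (gpow n s) $ t"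
    by simp
  also have "\<dots> = - (mconst s * ((\<Sum>j\<in>{1..n}. fps_const (mvar j) * geo j) * gpow n s) $ t)"
    unfolding fps_deriv_gpow by (simp add: mult.assoc)
  also have "((\<Sum>j\<in>{1..n}. fps_const (mvar j) * geo j) * gpow n s) $ t =
      (\<Sum>l\<in>{0..t}. power_sum n (Suc l) * gpow n s $ (t - l))"
    unfolding fps_mult_nth ps ..
  finally show ?thesis
    by simp
qed

lemma gpow_add: "gpow n (s + s') = gpow n s * gpow n s'"
  by (simp add: gpow_def opow_add coeff_hom_mconst prod.distrib)

lemma gpow_0: "gpow n 0 = 1"
  by (simp add: gpow_def opow_0 coeff_hom_mconst)

lemma gpow_nth_0: "gpow n s $ 0 = 1"
proof -
  have "(\<Prod>j\<in>S. opow mconst (mvar j) s) $ 0 = 1" for S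
    by (induction S rule: infinite_finite_induct) (simp_all add: opow_def)
  then show ?thesis
    by (simp add: gpow_def)
qed

text \<open>Each factor s in the recurrence comes with a drop of t: the term with p_(l+1) refers
  back to t - l - 1. With p_1, ..., p_d in K only drops by at least d + 1 survive, so at most
  t/(d+1) factors of s accumulate.\<close>

lemma gpow_nth_polynomial:
  assumes K: "mideal K" and ps: "\<And>j. j \<in> {1..d} \<Longrightarrow> power_sum n j \<in> K"
  shows "\<exists>F. degree F \<le> t div (d + 1) \<and> (\<forall>s. gpow n s $ t - poly F (mconst s) \<in> K)"
proof (induction t rule: less_induct)
  case (less t)
  show ?case
  proof (cases t)
    case 0
    then show ?thesis
      using mideal_closed(1)[OF K] by (intro exI[of _ "[:1:]"]) (simp add: gpow_nth_0)
  next
    case (Suc t')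
    have "\<forall>l\<in>{..t'}. \<exists>F. degree F \<le> l div (d + 1) \<and> (\<forall>s. gpow n s $ l - poly F (mconst s) \<in> K)"
      using less Suc by auto
    then obtain F where F: "\<And>l. l \<le> t' \<Longrightarrow> degree (F l) \<le> l div (d + 1)"
      "\<And>l s. l \<le> t' \<Longrightarrow> gpow n s $ l - poly (F l) (mconst s) \<in> K"
      unfolding bchoice_iff by auto
    define c where "c = mconst (- 1 / of_nat (Suc t'))"
    \<comment> \<open>Starting the sum at l = d leaves out exactly the terms with p_1, ...,
      p_d.\<close>
    define Q where "Q = (\<Sum>l\<in>{d..t'}. Polynomial.smult (power_sum n (Suc l)) (F (t' - l)))"
    have c: "c * of_nat (Suc t') = - 1"
      unfolding c_def by (simp only: mconst_of_nat[symmetric] mconst_mult[symmetric])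
        (simp add: mconst_uminus del: of_nat_Suc)
    show ?thesis
    proof (intro exI[of _ "Polynomial.smult c (pCons 0 Q)"] conjI allI)
      show "degree (Polynomial.smult c (pCons 0 Q)) \<le> t div (d + 1)"
      proof (cases "d \<le> t'")
        case True
        have "degree Q \<le> (t' - d) div (d + 1)"
          unfolding Q_def
        proof (rule degree_sum_le)
          fix l assume l: "l \<in> {d..t'}"
          have "degree (Polynomial.smult (power_sum n (Suc l)) (F (t' - l))) \<le> degree (F (t' - l))"
            by (rule degree_smult_le)
          also have "\<dots> \<le> (t' - l) div (d + 1)"
            by (rule F) simp
          also have "\<dots> \<le> (t' - d) div (d + 1)"
            using l by (intro div_le_mono) auto
          finally show "degree (Polynomial.smult (power_sum n (Suc l)) (F (t' - l))) \<le> (t' - d) div (d + 1)" .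
        qed simp
        moreover have "t div (d + 1) = (t' - d) div (d + 1) + 1"
        proof -
          have "t = (t' - d) + (d + 1)"
            using Suc True by simp
          then show ?thesis
            by (metis Suc_eq_plus1 add.commute div_add_self1 nat.distinct(1))
        qed
        moreover have "degree (Polynomial.smult c (pCons 0 Q)) \<le> Suc (degree Q)"
          using degree_smult_le degree_pCons_le le_trans by blast
        ultimately show ?thesis
          by simp
      next
        case False
        then have "Q = 0"
          by (simp add: Q_def)
        then show ?thesis
          by simp
      qed
      fix s
      let ?g = "\<lambda>l. gpow n s $ l" and ?P = "\<lambda>l. power_sum n (Suc l)"
      let ?T = "\<Sum>l\<in>{0..t'}. ?P l * ?g (t' - l)"
      have "?T - poly Q (mconst s) = (\<Sum>l\<in>{0..t'}. ?P l * ?g (t' - l)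
          - (if l \<in> {d..t'} then ?P l * poly (F (t' - l)) (mconst s) else 0))"
      proof -
        have "(\<Sum>l\<in>{0..t'}. if l \<in> {d..t'} then ?P l * poly (F (t' - l)) (mconst s) else 0) =
            (\<Sum>l\<in>{d..t'}. ?P l * poly (F (t' - l)) (mconst s))"
          by (rule sum.mono_neutral_cong_right) auto
        then show ?thesis
          unfolding sum_subtractf Q_def poly_sum by simp
      qed
      also have "\<dots> \<in> K"
      proof (rule mideal_sum[OF K])
        fix l assume l: "l \<in> {0..t'}"
        show "?P l * ?g (t' - l) - (if l \<in> {d..t'} then ?P l * poly (F (t' - l)) (mconst s) else 0) \<in> K"
        proof (cases "d \<le> l")
          case True
          have "?P l * (?g (t' - l) - poly (F (t' - l)) (mconst s)) \<in> K"
            using F(2) by (intro mideal_closed(3)[OF K]) simp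
          then show ?thesis
            using True l by (simp add: right_diff_distrib)
        next
          case False
          then have "?P l \<in> K"
            by (intro ps) simp
          then show ?thesis
            using False by (simp add: mideal_closed(4)[OF K])
        qed
      qed
      finally have "mconst s * c * (?T - poly Q (mconst s)) \<in> K"
        by (rule mideal_closed(3)[OF K])
      moreover have "?g t = mconst s * c * ?T"
      proof -
        have "c * (of_nat (Suc t') * ?g (Suc t')) = c * (- mconst s * ?T)"
          by (simp only: gpow_recurrence)
        then have "- ?g (Suc t') = - (mconst s * c * ?T)"
          by (simp only: mult.assoc[symmetric] c) (simp add: mult_ac)
        then show ?thesis
          using Suc by simp
      qed
      ultimately show "?g t - poly (Polynomial.smult c (pCons 0 Q)) (mconst s) \<in> K"
        by (simp add: algebra_simps)
    qed
  qed
qed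

text \<open>K need not be prime, so roots cannot simply be counted. But the arguments are scalars,
  and nonzero differences of scalars are units: splitting off one linear factor lowers the degree
  and keeps the other zeros modulo K.\<close>

lemma poly_in_mideal:
  assumes K: "mideal K" and "degree F \<le> D" "finite S" "D < card S"
    and S: "\<And>s. s \<in> S \<Longrightarrow> poly F (mconst s) \<in> K"
  shows "poly F (mconst s) \<in> K"
  using assms(2-)
proof (induction D arbitrary: F S s)
  case 0
  then obtain a where "F = [:a:]"
    by (metis degree_eq_zeroE le_zero_eq)
  moreover obtain s0 where "s0 \<in> S"
    using 0 by fastforce
  ultimately show ?case
    using 0(4)[of s0] by simp
next
  case (Suc D)
  obtain s0 where s0: "s0 \<in> S"
    using Suc.prems by fastforce
  define Q where "Q = synthetic_div F (mconst s0)"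
  have F: "poly F (mconst s) = mconst (s - s0) * poly Q (mconst s) + poly F (mconst s0)" for s
    using arg_cong[OF synthetic_div_correct'[of "mconst s0" F], of "\<lambda>p. poly p (mconst s)"]
    by (simp add: Q_def mconst_diff algebra_simps)
  have "poly Q (mconst s) \<in> K" for s
  proof (rule Suc.IH)
    show "degree Q \<le> D"
      using Suc.prems(1) by (simp add: Q_def degree_synthetic_div)
    show "finite (S - {s0})" "D < card (S - {s0})"
      using Suc.prems s0 by simp_all
    fix s assume s: "s \<in> S - {s0}"
    have "poly F (mconst s) - poly F (mconst s0) \<in> K"
      using s s0 Suc.prems by (intro mideal_closed(6)[OF K]) auto
    then have "mconst (s - s0) * poly Q (mconst s) \<in> K"
      by (simp add: F[of s])
    then show "poly Q (mconst s) \<in> K"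
      by (rule mideal_cancel_mconst[OF K]) (use s in simp)
  qed
  then show ?case
    unfolding F[of s] using Suc.prems(4)[OF s0] by (intro mideal_closed(2,3)[OF K])
qed

text \<open>The series is a polynomial of degree at most \<open>D\<close> modulo \<open>K\<close>;
  this notion of degree adds up in products.\<close>

definition fps_tail_in :: "mpoly set \<Rightarrow> nat \<Rightarrow> mpoly fps \<Rightarrow> bool" where
  "fps_tail_in K D F \<longleftrightarrow> (\<forall>t>D. F $ t \<in> K)"

lemma fps_tail_in_mult:
  assumes K: "mideal K" and "fps_tail_in K D F" "fps_tail_in K E G"
  shows "fps_tail_in K (D + E) (F * G)"
  unfolding fps_tail_in_def fps_mult_nth
proof (intro allI impI mideal_sum[OF K])
  fix t i assume t: "D + E < t" and "i \<in> {0..t}"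
  then have "i > D \<or> t - i > E"
    by auto
  then show "F $ i * G $ (t - i) \<in> K"
    using assms(2,3) by (auto simp: fps_tail_in_def intro: mideal_closed(3,4)[OF K])
qed

lemma fps_tail_in_power:
  assumes K: "mideal K" and "fps_tail_in K D F"
  shows "fps_tail_in K (D * m) (F ^ m)"
proof (induction m)
  case 0
  then show ?case
    using mideal_closed(1)[OF K] by (simp add: fps_tail_in_def)
next
  case (Suc m)
  then show ?case
    using fps_tail_in_mult[OF K assms(2) Suc] by simp
qed

lemma fps_tail_in_prod_opow_1:
  assumes K: "mideal K" and "finite S"
  shows "fps_tail_in K (card S) (\<Prod>j\<in>S. opow mconst (mvar j) 1)"
  using \<open>finite S\<close>
proof (induction S)
  case empty
  then show ?case
    using mideal_closed(1)[OF K] by (simp add: fps_tail_in_def)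
next
  case (insert j S)
  have "fps_tail_in K 1 (opow mconst (mvar j) 1)"
    using mideal_closed(1)[OF K] by (simp add: fps_tail_in_def opow_1 coeff_hom_mconst)
  then have "fps_tail_in K (1 + card S) (opow mconst (mvar j) 1 * (\<Prod>j\<in>S. opow mconst (mvar j) 1))"
    by (rule fps_tail_in_mult[OF K _ insert.IH])
  then show ?case
    using insert.hyps by simp
qed

text \<open>The coin problem with a crude bound: for x an inverse of e modulo q, the residue b of x
  N satisfies e b = N modulo q and b \<le> q, so N - e b is a nonnegative multiple of q.\<close>

lemma coprime_combination:
  fixes q e N :: nat
  assumes "coprime e q" "q > 0" "q * e \<le> N"
  obtains a b where "N = a * q + b * e"
proof -
  obtain x where x: "[e * x = 1] (mod q)"
    using cong_solve_coprime_nat[OF assms(1)] by auto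
  define b where "b = x * N mod q"
  have "[e * b = e * (x * N)] (mod q)"
    unfolding b_def by (intro cong_mult cong_refl) (simp add: unique_euclidean_semiring_class.cong_def)
  also have "[e * (x * N) = 1 * N] (mod q)"
    unfolding mult.assoc[symmetric] by (intro cong_mult cong_refl x)
  finally have eq: "N mod q = (e * b) mod q"
    by (simp add: unique_euclidean_semiring_class.cong_def)
  have "b \<le> q"
    using assms(2) by (simp add: b_def less_imp_le)
  then have "e * b \<le> e * q"
    by (rule mult_le_mono2)
  also have "e * q \<le> N"
    using assms(3) by (simp only: mult.commute)
  finally have le: "e * b \<le> N" .
  then have "q dvd N - e * b"
    using eq by (simp add: mod_eq_dvd_iff_nat)
  then obtain a where "N - e * b = q * a" ..
  then have "N = a * q + b * e"
    using le by (simp add: mult.commute)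
  then show ?thesis
    by (rule that)
qed

text \<open>For \<open>s = N/q\<close> with \<open>N = a q + b r/d\<close> the power series is a product of powers of \<open>\<Prod>\<^sub>j (1 - x\<^sub>j u)\<close> and of
  \<open>\<Prod>\<^sub>j (1 - x\<^sub>j u)\<^bsup>r/n\<^esup>\<close>, hence of degree at most \<open>d N\<close> modulo \<open>K\<close>. For large \<open>t\<close> this gives more zeros of the
  polynomial \<open>s \<mapsto> [u\<^sup>t]\<Prod>\<^sub>j (1 - x\<^sub>j u)\<^sup>s\<close> than its degree, so it vanishes modulo \<open>K\<close>; then take \<open>s = -1\<close>.\<close>

lemma mvar_power_in_mideal:
  assumes n: "n > 0" and r: "r > 0" and K: "mideal K"
    and f: "\<And>i. i \<in> {1..n} \<Longrightarrow> fpoly n r i \<in> K"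
    and ps: "\<And>j. j \<in> {1..gcd r n} \<Longrightarrow> power_sum n j \<in> K"
  obtains M where "M \<ge> r" "M \<ge> n" "\<And>i. i \<in> {1..n} \<Longrightarrow> mvar i ^ M \<in> K"
proof -
  define d where "d = gcd r n"
  obtain q e where q: "n = d * q" and e: "r = d * e"
    by (metis d_def dvd_def gcd_dvd1 gcd_dvd2)
  have pos: "d > 0" "q > 0" "e > 0"
    using n r q e by auto
  have "d * gcd e q = d"
    using d_def unfolding q e by (simp add: gcd_mult_distrib_nat)
  then have cop: "coprime e q"
    using pos by (simp add: coprime_iff_gcd_eq_1)
  define k :: complex where "k = of_nat r / of_nat n"
  have kq: "k = of_nat e / of_nat q"
    using pos by (simp add: k_def q e)
  have tail_k: "fps_tail_in K r (gpow n k)"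
    unfolding fps_tail_in_def
  proof (intro allI impI)
    fix t assume "r < t"
    have "gfun n k i $ r \<in> K" if "i \<in> {1..n}" for i
      using mideal_closed(5)[OF K f[OF that]] by (simp add: fpoly_eq k_def)
    then show "gpow n k $ t \<in> K"
      using \<open>r < t\<close> by (rule gpow_tail[OF K n])
  qed
  have tail_1: "fps_tail_in K n (gpow n 1)"
    using fps_tail_in_prod_opow_1[OF K, of "{1..n}"] by (simp add: gpow_def)
  have gpow_mult: "gpow n (s * of_nat m) = gpow n s ^ m" for s m
    by (induction m) (simp_all add: gpow_0 gpow_add distrib_left)
  have tail_N: "fps_tail_in K (d * N) (gpow n (of_nat N / of_nat q))" if le: "q * e \<le> N" for N
  proof -
    obtain a b where N: "N = a * q + b * e"
      by (rule coprime_combination[OF cop pos(2) le])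
    have "of_nat N / of_nat q = 1 * of_nat a + k * of_nat b"
      using pos by (simp add: kq N field_simps)
    then have "gpow n (of_nat N / of_nat q) = gpow n 1 ^ a * gpow n k ^ b"
      by (simp only: gpow_add gpow_mult)
    moreover have "fps_tail_in K (n * a + r * b) (gpow n 1 ^ a * gpow n k ^ b)"
      by (intro fps_tail_in_mult[OF K] fps_tail_in_power[OF K] tail_1 tail_k)
    moreover have "n * a + r * b = d * N"
      by (simp add: q e N algebra_simps)
    ultimately show ?thesis
      by simp
  qed
  define N0 where "N0 = q * e"
  \<comment> \<open>The integers from N0 to the largest N with d N < t must outnumber t/(d+1). Since
    t/d - t/(d+1) = t/(d (d+1)), this holds once t exceeds d (d+1) N0.\<close>
  define T where "T = d * (d + 1) * N0"
  have all: "gpow n s $ t \<in> K" if t: "t > T" for s t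
  proof -
    obtain F where F: "degree F \<le> t div (d + 1)" "\<And>s. gpow n s $ t - poly F (mconst s) \<in> K"
      using gpow_nth_polynomial[OF K ps, of d t] unfolding d_def by blast
    define A where "A = (t - 1) div d"
    define S :: "complex set" where "S = (\<lambda>N. of_nat N / of_nat q) ` {N0..A}"
    have "poly F (mconst s) \<in> K"
    proof (rule poly_in_mideal[OF K F(1)])
      show "finite S"
        by (simp add: S_def)
      have "card S = card {N0..A}"
        unfolding S_def using pos by (intro card_image inj_onI) simp
      moreover have "t div (d + 1) + N0 \<le> A"
      proof (rule ccontr)
        let ?B = "t div (d + 1)"
        assume "\<not> ?B + N0 \<le> A"
        then have "A + 1 \<le> ?B + N0"
          by simp
        then have "d * (A + 1) \<le> d * (?B + N0)"
          by (rule mult_le_mono2)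
        moreover have "t \<le> d * (A + 1)"
        proof -
          have "t - 1 = d * A + (t - 1) mod d"
            by (simp add: A_def)
          moreover have "(t - 1) mod d < d"
            using pos by simp
          ultimately show ?thesis
            by simp
        qed
        ultimately have "t \<le> d * ?B + d * N0"
          by (simp add: distrib_left)
        then have "(d + 1) * t \<le> (d + 1) * (d * ?B + d * N0)"
          by (rule mult_le_mono2)
        also have "\<dots> = d * ((d + 1) * ?B) + T"
          by (simp add: T_def algebra_simps)
        also have "\<dots> \<le> d * t + T"
          by (intro add_right_mono mult_le_mono2) (rule times_div_less_eq_dividend)
        finally show False
          using t by simp
      qed
      ultimately show "t div (d + 1) < card S"
        by simp
      fix s assume "s \<in> S"
      then obtain N where N: "N0 \<le> N" "N \<le> A" "s = of_nat N / of_nat q"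
        by (auto simp: S_def)
      have "d * N \<le> d * A"
        using N(2) by (rule mult_le_mono2)
      also have "\<dots> \<le> t - 1"
        unfolding A_def by (rule times_div_less_eq_dividend)
      finally have "d * N < t"
        using t by simp
      then have "gpow n s $ t \<in> K"
        using tail_N[of N] N by (simp add: fps_tail_in_def N0_def)
      then have "gpow n s $ t - (gpow n s $ t - poly F (mconst s)) \<in> K"
        using F(2) by (rule mideal_closed(6)[OF K])
      then show "poly F (mconst s) \<in> K"
        by simp
    qed
    then have "(gpow n s $ t - poly F (mconst s)) + poly F (mconst s) \<in> K"
      using F(2) by (intro mideal_closed(2)[OF K])
    then show ?thesis
      by simp
  qed
  have tail_inv: "fps_tail_in K T (gpow n (- 1))"
    using all by (simp add: fps_tail_in_def)
  show ?thesis
  proof (rule that[of "Suc (T + n)"])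
    \<comment> \<open>The exponent must also reach r and n, so that homogeneous parts of degrees M -
      r and M - j can be taken later.\<close>
    have "1 * (r * 1) \<le> (d + 1) * (r * q)"
      using pos by (intro mult_le_mono) auto
    also have "\<dots> = T"
      by (simp only: T_def N0_def e mult_ac)
    finally show "r \<le> Suc (T + n)"
      by simp
    show "n \<le> Suc (T + n)"
      by simp
    fix i assume i: "i \<in> {1..n}"
    \<comment> \<open>1/(1 - x_i u) is G_{-1} times the product of the 1 - x_j u over j \<noteq> i.
      So it too has bounded degree modulo K, and its coefficients are the powers of x_i.\<close>
    have "(\<Prod>j\<in>{1..n} - {i}. opow mconst (mvar j) (- 1)) * (\<Prod>j\<in>{1..n} - {i}. opow mconst (mvar j) 1) = 1"
      by (simp add: opow_0 coeff_hom_mconst flip: prod.distrib opow_add[OF coeff_hom_mconst])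
    moreover have "gpow n (- 1) = geo i * (\<Prod>j\<in>{1..n} - {i}. opow mconst (mvar j) (- 1))"
      unfolding gpow_def geo_def by (rule prod.remove) (use i in auto)
    ultimately have "geo i = gpow n (- 1) * (\<Prod>j\<in>{1..n} - {i}. opow mconst (mvar j) 1)"
      by (simp add: mult.assoc)
    moreover have "fps_tail_in K (T + card ({1..n} - {i})) (gpow n (- 1) * (\<Prod>j\<in>{1..n} - {i}. opow mconst (mvar j) 1))"
      by (intro fps_tail_in_mult[OF K] tail_inv fps_tail_in_prod_opow_1[OF K]) simp
    moreover have "card ({1..n} - {i}) \<le> n"
      using i by simp
    ultimately have "geo i $ Suc (T + n) \<in> K"
      by (simp add: fps_tail_in_def)
    then show "mvar i ^ Suc (T + n) \<in> K"
      unfolding geo_nth .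
  qed
qed

section \<open>Dimensions of subspaces of the quotient\<close>

interpretation mpoly_vs: vector_space "\<lambda>c (p :: mpoly). mconst c * p"
  by unfold_locales (simp_all add: distrib_left distrib_right mconst_add mconst_mult mult.assoc)

interpretation mpoly_vsp: vector_space_pair "\<lambda>c (p :: mpoly). mconst c * p" "\<lambda>c (p :: mpoly). mconst c * p"
  by unfold_locales

context Ch_ideal
begin

definition is_projection :: "(mpoly \<Rightarrow> mpoly) \<Rightarrow> bool" where
  "is_projection g \<longleftrightarrow> (\<forall>p q. g (p + q) = g p + g q) \<and> (\<forall>c p. g (mconst c * p) = mconst c * g p) \<and>
    (\<forall>p. p - g p \<in> J) \<and> (\<forall>p\<in>J. g p = 0)"

text \<open>A linear projection onto a complement of \<open>J\<close> represents the quotient inside the space of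
  polynomials.\<close>

definition proj :: "mpoly \<Rightarrow> mpoly" where
  "proj = (SOME g. is_projection g)"

lemma proj: "is_projection proj"
proof -
  obtain B0 where B0: "B0 \<subseteq> J" "mpoly_vs.independent B0" "J \<subseteq> mpoly_vs.span B0"
    using mpoly_vs.maximal_independent_subset by blast
  obtain B where B: "B0 \<subseteq> B" "mpoly_vs.independent B" "UNIV \<subseteq> mpoly_vs.span B"
    by (rule mpoly_vs.maximal_independent_subset_extend[OF subset_UNIV B0(2)])
  have "\<exists>g. Vector_Spaces.linear (\<lambda>c p. mconst c * p) (\<lambda>c p. mconst c * p) g \<and>
      (\<forall>b\<in>B. g b = (if b \<in> B0 then 0 else b))"
    by (rule mpoly_vsp.linear_independent_extend[OF B(2)])
  then obtain g where g: "Vector_Spaces.linear (\<lambda>c p. mconst c * p) (\<lambda>c p. mconst c * p) g"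
    and gB: "\<forall>b\<in>B. g b = (if b \<in> B0 then 0 else b)"
    by blast
  have lin: "g (p + q) = g p + g q" "g (mconst c * p) = mconst c * g p" for p q c
    using g unfolding Vector_Spaces.linear_iff by auto
  have g0: "g 0 = 0"
    using lin(2)[of 0 0] by simp
  have "p - g p \<in> J" for p
  proof -
    have "p \<in> mpoly_vs.span B"
      using B(3) by blast
    then show ?thesis
    proof (induction rule: mpoly_vs.span_induct_alt)
      case base
      then show ?case by (simp add: g0 zero_mem)
    next
      case (step c x y)
      have "x - g x \<in> J"
        using step(1) gB B0(1) zero_mem by (cases "x \<in> B0") auto
      then have "mconst c * (x - g x) + (y - g y) \<in> J"
        using step(2) by (intro add_mem mult_mem) auto
      then show ?case
        by (simp only: lin) (simp add: algebra_simps)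
    qed
  qed
  moreover have "g p = 0" if "p \<in> J" for p
  proof -
    have "p \<in> mpoly_vs.span B0"
      using B0(3) that by blast
    then show ?thesis
    proof (induction rule: mpoly_vs.span_induct_alt)
      case base
      then show ?case by (rule g0)
    next
      case (step c x y)
      then have "g x = 0"
        using gB B(1) by auto
      then show ?case
        using step(2) by (simp add: lin)
    qed
  qed
  ultimately have "is_projection g"
    using lin by (simp add: is_projection_def)
  then show ?thesis
    unfolding proj_def by (rule someI[where P = is_projection])
qed

lemma proj_add: "proj (p + q) = proj p + proj q"
  and proj_scale: "proj (mconst c * p) = mconst c * proj p"
  and diff_proj_mem: "p - proj p \<in> J"
  and proj_J: "p \<in> J \<Longrightarrow> proj p = 0"
  using proj by (auto simp: is_projection_def)

lemma proj_diff: "proj (p - q) = proj p - proj q"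
  using proj_add[of "p - q" q] by simp

lemma proj_eq_iff: "proj p = proj q \<longleftrightarrow> p - q \<in> J"
proof
  assume "proj p = proj q"
  then have "proj (p - q) = 0"
    by (simp add: proj_diff)
  then show "p - q \<in> J"
    using diff_proj_mem[of "p - q"] by simp
next
  assume "p - q \<in> J"
  then show "proj p = proj q"
    using proj_J[of "p - q"] by (simp add: proj_diff)
qed

lemma proj_in_span: "x \<in> mpoly_vs.span S \<Longrightarrow> proj x \<in> mpoly_vs.span (proj ` S)"
proof (induction rule: mpoly_vs.span_induct_alt)
  case base
  then show ?case
    using proj_J[OF zero_mem] by (simp add: mpoly_vs.span_zero)
next
  case (step c x y)
  then show ?case
    unfolding proj_add proj_scale
    by (intro mpoly_vs.span_add mpoly_vs.span_scale) (simp_all add: mpoly_vs.span_base)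
qed

text \<open>Identifies the quotient linearly with its image in a complement of \<open>J\<close>, so
  that \<open>cspan\<close> and \<open>cdim\<close> become span and dimension inside the
  polynomials.\<close>

definition rep :: "mpoly set \<Rightarrow> mpoly" where
  "rep C = proj (SOME p. p \<in> C)"

lemma rep_cls: "rep (cls p) = proj p"
proof -
  have "p \<in> cls p"
    by (simp add: mem_cls_iff zero_mem)
  then have "(SOME q. q \<in> cls p) \<in> cls p"
    by (rule someI[where P = "\<lambda>q. q \<in> cls p"])
  then show ?thesis
    by (simp add: rep_def proj_eq_iff mem_cls_iff)
qed

lemma inj_on_rep: "inj_on rep (cls ` Ch n)"
proof (rule inj_onI)
  fix a b assume "a \<in> cls ` Ch n" "b \<in> cls ` Ch n" and eq: "rep a = rep b"
  then obtain p q where pq: "a = cls p" "b = cls q"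
    by blast
  have "p - q \<in> J"
    using eq unfolding pq rep_cls proj_eq_iff .
  then show "a = b"
    unfolding pq by (simp only: cls_eq_iff)
qed

lemma cspan_subset_cls:
  assumes "B \<subseteq> cls ` Ch n" "v \<in> cspan (Vmod n J) B"
  shows "v \<in> cls ` Ch n"
  using assms(2)
proof (induction rule: cspan.induct)
  case zero
  then show ?case by (auto simp: zero_Vmod)
next
  case (add b v c)
  then obtain p q where "b = cls p" "v = cls q" "p \<in> Ch n" "q \<in> Ch n"
    using assms(1) by blast
  then show ?case
    by (auto simp: smult_Vmod add_Vmod intro!: imageI Ch_add Ch_mult)
qed

lemma rep_cspan:
  assumes B: "B \<subseteq> cls ` Ch n"
  shows "rep ` cspan (Vmod n J) B = mpoly_vs.span (rep ` B)"
proof (intro Set.set_eqI iffI)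
  have rep_step: "rep ((mconst c \<odot>\<^bsub>Vmod n J\<^esub> b) \<oplus>\<^bsub>Vmod n J\<^esub> v) = mconst c * rep b + rep v"
    if "b \<in> cls ` Ch n" "v \<in> cls ` Ch n" for b v c
    using that by (auto simp: smult_Vmod add_Vmod rep_cls proj_add proj_scale)
  have zero: "rep \<zero>\<^bsub>Vmod n J\<^esub> = 0"
    by (simp add: zero_Vmod rep_cls proj_J zero_mem)
  {
    fix x assume "x \<in> rep ` cspan (Vmod n J) B"
    then obtain v where v: "v \<in> cspan (Vmod n J) B" "x = rep v"
      by blast
    have "rep v \<in> mpoly_vs.span (rep ` B)"
      using v(1)
    proof (induction rule: cspan.induct)
      case zero
      then show ?case
        using \<open>rep \<zero>\<^bsub>Vmod n J\<^esub> = 0\<close> by (simp add: mpoly_vs.span_zero)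
    next
      case (add b v c)
      then have "b \<in> cls ` Ch n" "v \<in> cls ` Ch n"
        using B cspan_subset_cls[OF B] by auto
      show ?case
        unfolding rep_step[OF \<open>b \<in> cls ` Ch n\<close> \<open>v \<in> cls ` Ch n\<close>]
        using add by (intro mpoly_vs.span_add mpoly_vs.span_scale) (simp_all add: mpoly_vs.span_base)
    qed
    then show "x \<in> mpoly_vs.span (rep ` B)"
      using v(2) by simp
  next
    fix x assume "x \<in> mpoly_vs.span (rep ` B)"
    then show "x \<in> rep ` cspan (Vmod n J) B"
    proof (induction rule: mpoly_vs.span_induct_alt)
      case base
      then show ?case
        using zero cspan.zero by (metis imageI)
    next
      case (step c x y)
      then obtain b v where bv: "b \<in> B" "x = rep b" "v \<in> cspan (Vmod n J) B" "y = rep v"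
        by blast
      then have "mconst c * x + y = rep ((mconst c \<odot>\<^bsub>Vmod n J\<^esub> b) \<oplus>\<^bsub>Vmod n J\<^esub> v)"
        using B cspan_subset_cls[OF B] by (simp add: rep_step subset_iff)
      then show ?case
        using cspan.add[OF bv(1,3)] by blast
    qed
  }
qed

text \<open>\<open>cdim\<close> counts an arbitrarily chosen basis, so two facts are needed: all
  bases have the same cardinality, by transport along \<open>rep\<close>, and some basis exists,
  found inside S by thinning out its image.\<close>

lemma cdim_cspan:
  assumes S: "S \<subseteq> cls ` Ch n"
  shows "cdim (Vmod n J) (cspan (Vmod n J) S) = mpoly_vs.dim (rep ` S)"
proof -
  let ?V = "Vmod n J"
  let ?W = "cspan ?V S"
  have mem: "x \<in> cspan ?V B \<longleftrightarrow> rep x \<in> mpoly_vs.span (rep ` B)"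
    if "B \<subseteq> cls ` Ch n" "x \<in> cls ` Ch n" for B x
    unfolding rep_cspan[OF that(1), symmetric]
    using inj_on_image_mem_iff[OF inj_on_rep that(2), of "cspan ?V B"] cspan_subset_cls[OF that(1)] by auto
  have diff: "rep ` (B - {b}) = rep ` B - {rep b}" if "B \<subseteq> cls ` Ch n" "b \<in> B" for B b
    using inj_on_image_set_diff[OF inj_on_rep, of B "{b}"] that by auto
  have indep: "mpoly_vs.independent (rep ` B) \<longleftrightarrow> (\<forall>b\<in>B. b \<notin> cspan ?V (B - {b}))"
    if B: "B \<subseteq> cls ` Ch n" for B
    unfolding mpoly_vs.dependent_def
  proof -
    have "b \<notin> cspan ?V (B - {b}) \<longleftrightarrow> rep b \<notin> mpoly_vs.span (rep ` B - {rep b})" if "b \<in> B" for b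
      using mem[of "B - {b}" b] that B diff[OF B that] by auto
    then show "(\<not> (\<exists>a\<in>rep ` B. a \<in> mpoly_vs.span (rep ` B - {a}))) \<longleftrightarrow> (\<forall>b\<in>B. b \<notin> cspan ?V (B - {b}))"
      by auto
  qed
  have card: "card B = mpoly_vs.dim (rep ` S)" if "cbasis ?V ?W B" for B
  proof -
    have B: "B \<subseteq> cls ` Ch n" "cspan ?V B = ?W" "mpoly_vs.independent (rep ` B)"
      using that indep by (auto simp: cbasis_def carrier_Vmod)
    have "mpoly_vs.dim (rep ` S) = card (rep ` B)"
      by (rule mpoly_vs.dim_eq_card) (use B rep_cspan[OF S] rep_cspan[OF B(1)] in auto)
    also have "\<dots> = card B"
      by (rule card_image, rule inj_on_subset[OF inj_on_rep B(1)])
    finally show ?thesis ..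
  qed
  obtain B0 where B0: "B0 \<subseteq> rep ` S" "mpoly_vs.independent B0" "rep ` S \<subseteq> mpoly_vs.span B0"
    using mpoly_vs.maximal_independent_subset by blast
  then obtain B where B: "B \<subseteq> S" "B0 = rep ` B"
    by (meson subset_imageE)
  have BCh: "B \<subseteq> cls ` Ch n"
    using B(1) S by blast
  have "mpoly_vs.span (rep ` B) = mpoly_vs.span (rep ` S)"
    using B0(1,3) unfolding B(2) by (simp add: mpoly_vs.span_eq mpoly_vs.span_superset subset_trans[OF _ mpoly_vs.span_superset])
  then have "rep ` cspan ?V B = rep ` ?W"
    by (simp add: rep_cspan BCh S)
  then have "cspan ?V B = ?W"
    by (rule inj_on_image_eq_iff[OF inj_on_rep, THEN iffD1, rotated 2])
      (use cspan_subset_cls BCh S in blast)+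
  then have "cbasis ?V ?W B"
    using BCh indep[OF BCh] B0(2) B(2) by (simp add: cbasis_def carrier_Vmod)
  then have "cbasis ?V ?W (SOME B. cbasis ?V ?W B)"
    by (rule someI)
  then show ?thesis
    unfolding cdim_def by (rule card)
qed

lemma cdim_le:
  assumes P: "P \<subseteq> Ch n" and "P \<subseteq> mpoly_vs.span (G \<union> J)" and G: "finite G"
  shows "cdim (Vmod n J) (cspan (Vmod n J) (cls ` P)) \<le> card G"
proof -
  have "rep ` cls ` P \<subseteq> mpoly_vs.span (proj ` G)"
  proof
    fix x assume "x \<in> rep ` cls ` P"
    then obtain p where p: "p \<in> P" "x = proj p"
      by (auto simp: rep_cls)
    then have "x \<in> mpoly_vs.span (proj ` (G \<union> J))"
      using proj_in_span assms(2) by blast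
    also have "\<dots> \<subseteq> mpoly_vs.span (insert 0 (proj ` G))"
      by (rule mpoly_vs.span_mono) (auto simp: proj_J)
    finally show "x \<in> mpoly_vs.span (proj ` G)"
      by simp
  qed
  then have "mpoly_vs.dim (rep ` cls ` P) \<le> card (proj ` G)"
    using G by (intro mpoly_vs.dim_le_card) auto
  also have "\<dots> \<le> card G"
    using G by (rule card_image_le)
  finally show ?thesis
    using P by (simp add: cdim_cspan image_mono)
qed

text \<open>The span of X meets J only in 0, so the projection is injective on it and X stays
  independent in the quotient.\<close>

lemma cdim_ge:
  assumes P: "P \<subseteq> Ch n" "finite P" and X: "X \<subseteq> P" "mpoly_vs.independent X"
    and XJ: "\<And>p. p \<in> mpoly_vs.span X \<Longrightarrow> p \<in> J \<Longrightarrow> p = 0"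
  shows "card X \<le> cdim (Vmod n J) (cspan (Vmod n J) (cls ` P))"
proof -
  have inj: "inj_on proj (mpoly_vs.span X)"
  proof (rule inj_onI)
    fix p q assume "p \<in> mpoly_vs.span X" "q \<in> mpoly_vs.span X" "proj p = proj q"
    then show "p = q"
      using XJ[of "p - q"] mpoly_vs.span_diff[of p X q] by (simp add: proj_eq_iff)
  qed
  have "Vector_Spaces.linear (\<lambda>c p. mconst c * p) (\<lambda>c p. mconst c * p) proj"
    unfolding Vector_Spaces.linear_iff using mpoly_vs.vector_space_axioms by (simp add: proj_add proj_scale)
  then have ind: "mpoly_vs.independent (proj ` X)"
    using X(2) inj by (rule mpoly_vsp.linear_independent_injective_image)
  have rep: "rep ` cls ` P = proj ` P"
    by (simp add: image_image rep_cls)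
  obtain B where B: "B \<subseteq> proj ` P" "mpoly_vs.independent B" "proj ` P \<subseteq> mpoly_vs.span B"
      "card B = mpoly_vs.dim (proj ` P)"
    by (rule mpoly_vs.basis_exists)
  have "card X = card (proj ` X)"
    by (rule card_image[symmetric], rule inj_on_subset[OF inj mpoly_vs.span_superset])
  also have "\<dots> \<le> card B"
  proof -
    have "finite B"
      using B(1) P(2) finite_subset by blast
    moreover have "proj ` X \<subseteq> mpoly_vs.span B"
      using X(1) B(3) by blast
    ultimately show ?thesis
      using mpoly_vs.independent_span_bound[OF _ ind] by blast
  qed
  also have "\<dots> = cdim (Vmod n J) (cspan (Vmod n J) (cls ` P))"
    using P(1) B(4) by (simp add: cdim_cspan image_mono rep)
  finally show ?thesis .
qed

section \<open>Growth spaces as spans of products\<close>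

definition products :: "mpoly set \<Rightarrow> mpoly set \<Rightarrow> nat \<Rightarrow> mpoly set" where
  "products A F m = {prod_list as * p | as p. length as = m \<and> set as \<subseteq> A \<and> p \<in> F}"

lemma products_subset_Ch:
  assumes "A \<subseteq> Ch n" "F \<subseteq> Ch n"
  shows "products A F m \<subseteq> Ch n"
proof -
  have "prod_list as \<in> Ch n" if "set as \<subseteq> A" for as
    using that assms(1) by (induction as) (auto intro: Ch_mult)
  then show ?thesis
    using assms(2) by (auto simp: products_def intro!: Ch_mult)
qed

lemma finite_products:
  assumes "finite A" "finite F"
  shows "finite (products A F m)"
proof -
  have "products A F m = (\<lambda>(as, p). prod_list as * p) ` ({as. set as \<subseteq> A \<and> length as = m} \<times> F)"
    by (auto simp: products_def image_iff)
  then show ?thesis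
    using finite_lists_length_eq[OF assms(1), of m] assms(2) by simp
qed

lemma growth_space_eq:
  assumes A: "A \<subseteq> Ch n" and F: "F \<subseteq> Ch n"
  shows "growth_space (Vmod n J) A (cls ` F) m = cspan (Vmod n J) (cls ` products A F m)"
proof -
  have fold: "foldr (smult (Vmod n J)) as (cls p) = cls (prod_list as * p)" if "set as \<subseteq> A" for as p
    using that A by (induction as) (auto simp: smult_Vmod mult.assoc)
  have "{foldr (smult (Vmod n J)) as f | as f. length as = m \<and> set as \<subseteq> A \<and> f \<in> cls ` F} = cls ` products A F m"
    using fold by (fastforce simp: products_def)
  then show ?thesis
    by (simp add: growth_space_def)
qed

end

subsection \<open>Growth\<close>

lemma limsup_growth_le:
  fixes D :: "nat \<Rightarrow> nat" and C e :: nat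
  assumes C: "C > 0" and D: "\<And>m. D m \<le> C * (C * (m + 1) + 1) ^ e"
  shows "limsup (\<lambda>m. if D m = 0 then - \<infinity> else ereal (ln (real (D m)) / ln (real m))) \<le> ereal (real e)"
proof -
  let ?b = "\<lambda>m. (ln (real C) + real e * ln (real C * (real m + 1) + 1)) / ln (real m)"
  have "limsup (\<lambda>m. if D m = 0 then - \<infinity> else ereal (ln (real (D m)) / ln (real m))) \<le> limsup (\<lambda>m. ereal (?b m))"
  \<comment> \<open>From m = 2 on, ln m is positive and division by it preserves
    inequalities.\<close>
  proof (rule Limsup_mono, rule eventually_sequentiallyI[of 2])
    fix m :: nat assume m: "2 \<le> m"
    show "(if D m = 0 then - \<infinity> else ereal (ln (real (D m)) / ln (real m))) \<le> ereal (?b m)"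
    proof (cases "D m = 0")
      case False
      have "real (D m) \<le> real (C * (C * (m + 1) + 1) ^ e)"
        using D[of m] by (simp only: of_nat_le_iff)
      also have "\<dots> = real C * (real C * (real m + 1) + 1) ^ e"
        by (simp only: of_nat_mult of_nat_power of_nat_add of_nat_1)
      finally have "ln (real (D m)) \<le> ln (real C * (real C * (real m + 1) + 1) ^ e)"
        using False by simp
      also have "\<dots> = ln (real C) + real e * ln (real C * (real m + 1) + 1)"
      proof -
        have "real C * (real m + 1) + 1 > 0"
          by (intro add_nonneg_pos mult_nonneg_nonneg) auto
        then show ?thesis
          using C by (simp add: ln_mult ln_realpow)
      qed
      finally have "ln (real (D m)) / ln (real m) \<le> ?b m"
        using m by (intro divide_right_mono) auto
      then show ?thesis
        using False by simp
    qed simp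
  qed
  also have "limsup (\<lambda>m. ereal (?b m)) = ereal (real e)"
  proof (rule lim_imp_Limsup)
    have "real C > 0"
      using C by simp
    then have "?b \<longlonglongrightarrow> real e"
      by real_asymp
    then show "(\<lambda>m. ereal (?b m)) \<longlonglongrightarrow> ereal (real e)"
      by simp
  qed simp
  finally show ?thesis .
qed

lemma limsup_growth_ge:
  fixes D :: "nat \<Rightarrow> nat" and c e :: nat
  assumes c: "c > 0" and D: "\<And>m. (m div c + 1) ^ e \<le> D m"
  shows "ereal (real e) \<le> limsup (\<lambda>m. if D m = 0 then - \<infinity> else ereal (ln (real (D m)) / ln (real m)))"
proof -
  let ?b = "\<lambda>m. real e * ln (real m / real c) / ln (real m)"
  have "ereal (real e) = limsup (\<lambda>m. ereal (?b m))"
  proof (rule lim_imp_Limsup[symmetric])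
    have "real c > 0"
      using c by simp
    then have "?b \<longlonglongrightarrow> real e"
      by real_asymp
    then show "(\<lambda>m. ereal (?b m)) \<longlonglongrightarrow> ereal (real e)"
      by simp
  qed simp
  also have "\<dots> \<le> limsup (\<lambda>m. if D m = 0 then - \<infinity> else ereal (ln (real (D m)) / ln (real m)))"
  proof (rule Limsup_mono, rule eventually_sequentiallyI[of 2])
    fix m :: nat assume m: "2 \<le> m"
    have "real m / real c \<le> real (m div c + 1)"
    proof -
      have "m \<le> c * (m div c + 1)"
        using c by (metis dividend_less_times_div less_imp_le_nat mult.commute mult_Suc_right Suc_eq_plus1 add.commute)
      then have "real m \<le> real c * real (m div c + 1)"
        by (simp only: of_nat_mult[symmetric] of_nat_le_iff)
      then show ?thesis
        using c by (simp add: divide_le_eq mult.commute)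
    qed
    then have "(real m / real c) ^ e \<le> real (m div c + 1) ^ e"
      by (intro power_mono) auto
    also have "\<dots> \<le> real (D m)"
      using D[of m] by (simp only: of_nat_power[symmetric] of_nat_le_iff)
    finally have le: "(real m / real c) ^ e \<le> real (D m)" .
    have pos: "real m / real c > 0"
      using m c by simp
    have "real e * ln (real m / real c) = ln ((real m / real c) ^ e)"
      using pos by (simp add: ln_realpow)
    also have "\<dots> \<le> ln (real (D m))"
      using le pos by (intro ln_mono zero_less_power) auto
    finally have "?b m \<le> ln (real (D m)) / ln (real m)"
      using m by (intro divide_right_mono) auto
    moreover have "D m \<noteq> 0"
      using D[of m] by (metis Suc_eq_plus1 le_zero_eq nat.distinct(1) power_eq_0_iff)
    ultimately show "ereal (?b m) \<le> (if D m = 0 then - \<infinity> else ereal (ln (real (D m)) / ln (real m)))"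
      by simp
  qed
  finally show ?thesis .
qed

section \<open>The Gelfand-Kirillov dimension\<close>

subsection \<open>Degrees\<close>

definition mdeg :: "(nat \<Rightarrow>\<^sub>0 nat) \<Rightarrow> nat" where
  "mdeg m = (\<Sum>i\<in>Poly_Mapping.keys m. Poly_Mapping.lookup m i)"

lemma mdeg_superset:
  assumes "finite A" "Poly_Mapping.keys m \<subseteq> A"
  shows "mdeg m = (\<Sum>i\<in>A. Poly_Mapping.lookup m i)"
  unfolding mdeg_def by (rule sum.mono_neutral_left) (use assms in \<open>auto simp: in_keys_iff\<close>)

lemma mdeg_add: "mdeg (m + m') = mdeg m + mdeg m'"
proof -
  let ?A = "Poly_Mapping.keys m \<union> Poly_Mapping.keys m'"
  have A: "finite ?A" "Poly_Mapping.keys m \<subseteq> ?A" "Poly_Mapping.keys m' \<subseteq> ?A"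
    "Poly_Mapping.keys (m + m') \<subseteq> ?A"
    using keys_add[of m m'] by auto
  show ?thesis
    unfolding mdeg_superset[OF A(1) A(2)] mdeg_superset[OF A(1) A(3)] mdeg_superset[OF A(1) A(4)]
    by (simp add: lookup_add sum.distrib)
qed

lemma mdeg_single: "mdeg (Poly_Mapping.single i a) = a"
  by (simp add: mdeg_def)

definition deg_le :: "nat \<Rightarrow> mpoly \<Rightarrow> bool" where
  "deg_le N p \<longleftrightarrow> (\<forall>m\<in>Poly_Mapping.keys p. mdeg m \<le> N)"

lemma deg_le_mono: "deg_le N p \<Longrightarrow> N \<le> N' \<Longrightarrow> deg_le N' p"
  by (auto simp: deg_le_def)

lemma deg_le_mult:
  assumes "deg_le N p" "deg_le N' q"
  shows "deg_le (N + N') (p * q)"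
  unfolding deg_le_def
proof
  fix m assume "m \<in> Poly_Mapping.keys (p * q)"
  then obtain a b where "m = a + b" "a \<in> Poly_Mapping.keys p" "b \<in> Poly_Mapping.keys q"
    using keys_mult[of p q] by auto
  then show "mdeg m \<le> N + N'"
    using assms by (auto simp: deg_le_def mdeg_add intro: add_mono)
qed

lemma deg_le_1: "deg_le 0 1"
  by (simp add: deg_le_def mdeg_def)

lemma deg_le_single: "deg_le (mdeg m) (Poly_Mapping.single m c)"
  by (simp add: deg_le_def)

lemma deg_le_bound:
  assumes "finite A"
  obtains N where "\<And>p. p \<in> A \<Longrightarrow> deg_le N p"
proof
  fix p assume "p \<in> A"
  then show "deg_le (\<Sum>p\<in>A. \<Sum>m\<in>Poly_Mapping.keys p. mdeg m) p"
    unfolding deg_le_def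
  proof (intro ballI)
    fix m assume "m \<in> Poly_Mapping.keys p"
    then have "mdeg m \<le> (\<Sum>m\<in>Poly_Mapping.keys p. mdeg m)"
      by (intro member_le_sum) auto
    also have "\<dots> \<le> (\<Sum>p\<in>A. \<Sum>m\<in>Poly_Mapping.keys p. mdeg m)"
      using assms \<open>p \<in> A\<close> member_le_sum[of p A "\<lambda>p. \<Sum>m\<in>Poly_Mapping.keys p. mdeg m"] by simp
    finally show "mdeg m \<le> (\<Sum>p\<in>A. \<Sum>m\<in>Poly_Mapping.keys p. mdeg m)" .
  qed
qed

lemma deg_le_prod_list:
  assumes "\<And>p. p \<in> set as \<Longrightarrow> deg_le N p"
  shows "deg_le (N * length as) (prod_list as)"
  using assms
proof (induction as)
  case Nil
  then show ?case by (simp add: deg_le_1)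
next
  case (Cons a as)
  then have "deg_le (N + N * length as) (a * prod_list as)"
    by (intro deg_le_mult) auto
  then show ?case by simp
qed

text \<open>The substitution \<open>x\<^sub>i \<mapsto> x\<^sub>i t\<close>; the coefficient of \<open>t\<^sup>N\<close> is the homogeneous part of degree \<open>N\<close>.\<close>

definition grade :: "mpoly \<Rightarrow> mpoly poly" where
  "grade = msubst (\<lambda>c. [:mconst c:]) (\<lambda>i. Polynomial.monom (mvar i) 1)"

lemma coeff_hom_grade: "coeff_hom (\<lambda>c. [:mconst c:])"
  by (simp add: coeff_hom_def mconst_add mconst_mult one_pCons)

lemmas grade_simps = msubst_simps[OF coeff_hom_grade, of "\<lambda>i. Polynomial.monom (mvar i) 1", folded grade_def]

lemma grade_single: "grade (Poly_Mapping.single m c) = Polynomial.monom (Poly_Mapping.single m c) (mdeg m)"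
proof -
  have pw: "Polynomial.monom a (Suc 0) ^ k = Polynomial.monom (a ^ k) k" for a :: mpoly and k
    by (induction k) (simp_all add: mult_monom one_pCons monom_0)
  have "(\<Prod>i\<in>A. Polynomial.monom (mvar i) 1 ^ f i) = Polynomial.monom (\<Prod>i\<in>A. mvar i ^ f i) (\<Sum>i\<in>A. f i)"
    if "finite A" for A :: "nat set" and f
    using that by (induction A) (simp_all add: pw mult_monom one_pCons monom_0)
  then have *: "mon (\<lambda>i. Polynomial.monom (mvar i) 1) m = Polynomial.monom (mon mvar m) (mdeg m)"
    by (simp add: mon_def mdeg_def)
  have "grade (Poly_Mapping.single m c) = [:mconst c:] * mon (\<lambda>i. Polynomial.monom (mvar i) 1) m"
    unfolding grade_def by (rule msubst_single[OF coeff_hom_grade])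
  also have "\<dots> = Polynomial.monom (mconst c * mon mvar m) (mdeg m)"
    unfolding * by (simp add: smult_monom)
  finally show ?thesis
    by (simp only: single_eq_mconst_mon[of m c])
qed

lemma lookup_coeff_grade:
  "Poly_Mapping.lookup (coeff (grade p) N) m = (if mdeg m = N then Poly_Mapping.lookup p m else 0)"
  by (induction p rule: poly_mapping_induct)
    (auto simp: grade_single grade_simps(1) coeff_monom lookup_single when_def lookup_add)

lemma deg_le_coeff_grade: "deg_le N (coeff (grade p) N)"
  by (auto simp: deg_le_def in_keys_iff lookup_coeff_grade split: if_splits)

text \<open>Expressed through the ring homomorphism \<open>grade\<close>, so that products reduce to
  products of monomials in t; 0 is homogeneous of every degree.\<close>

definition homogeneous :: "nat \<Rightarrow> mpoly \<Rightarrow> bool" where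
  "homogeneous N p \<longleftrightarrow> grade p = Polynomial.monom p N"

lemma homogeneous_mult: "homogeneous N p \<Longrightarrow> homogeneous N' q \<Longrightarrow> homogeneous (N + N') (p * q)"
  by (simp add: homogeneous_def grade_simps mult_monom)

lemma homogeneous_sum: "(\<And>i. i \<in> A \<Longrightarrow> homogeneous N (f i)) \<Longrightarrow> homogeneous N (sum f A)"
  by (simp add: homogeneous_def grade_simps monom_sum)

lemma homogeneous_uminus: "homogeneous N p \<Longrightarrow> homogeneous N (- p)"
  by (simp add: homogeneous_def grade_simps minus_monom)

lemma homogeneous_mconst: "homogeneous 0 (mconst c)"
  by (simp add: homogeneous_def grade_simps monom_0)

lemma homogeneous_mvar: "homogeneous 1 (mvar i)"
  by (simp add: homogeneous_def grade_simps)

lemma homogeneous_power: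
  assumes "homogeneous 1 p"
  shows "homogeneous k (p ^ k)"
proof (induction k)
  case 0
  then show ?case
    using homogeneous_mconst[of 1] by simp
next
  case (Suc k)
  then show ?case
    using homogeneous_mult[OF assms Suc] by simp
qed

lemma homogeneous_power_sum: "homogeneous j (power_sum n j)"
  unfolding power_sum_def by (intro homogeneous_sum homogeneous_power homogeneous_mvar)

lemma homogeneous_gfun: "homogeneous t (gfun n s i $ t)"
proof -
  have mult: "homogeneous t ((F * G) $ t)"
    if F: "\<And>t. homogeneous t (F $ t)" and G: "\<And>t. homogeneous t (G $ t)" for F G t
    unfolding fps_mult_nth
  proof (rule homogeneous_sum)
    fix l assume "l \<in> {0..t}"
    then show "homogeneous t (F $ l * G $ (t - l))"
      using homogeneous_mult[OF F[of l] G[of "t - l"]] by simp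
  qed
  have opow: "homogeneous t (opow mconst (mvar j) s $ t)" for j s t
  proof -
    have "homogeneous (0 + t) (mconst (s gchoose t) * (- mvar j) ^ t)"
      by (intro homogeneous_mult homogeneous_mconst homogeneous_power homogeneous_uminus homogeneous_mvar)
    then show ?thesis
      by (simp add: opow_def)
  qed
  have one: "homogeneous 0 1" "homogeneous t 0" for t
    by (simp_all add: homogeneous_def grade_simps)
  have "homogeneous t ((\<Prod>j\<in>S. opow mconst (mvar j) s) $ t)" for S t
  proof (induction S arbitrary: t rule: infinite_finite_induct)
    case (insert j S)
    then show ?case
      unfolding prod.insert[OF insert.hyps] by (intro mult opow)
  qed (simp_all add: one)
  then show ?thesis
    unfolding gfun_def gpow_def geo_def by (intro mult opow)
qed

lemma homogeneous_fpoly: "homogeneous r (fpoly n r i)"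
  unfolding fpoly_eq by (intro homogeneous_uminus homogeneous_gfun)

lemma coeff_grade_mult_homogeneous:
  assumes "homogeneous j p" "j \<le> N"
  shows "coeff (grade (c * p)) N = coeff (grade c) (N - j) * p"
  using assms by (simp add: grade_simps homogeneous_def mult.commute[of _ "Polynomial.monom p j"] coeff_monom_mult)

text \<open>Ideal membership alone gives coefficients of unknown degree. As x_i^M, the f_l and the
  p_j are homogeneous, the coefficients may be replaced by homogeneous parts, that of p_j by its
  part of degree M - j.\<close>

lemma mvar_power_expansion:
  assumes n: "n > 0" and r: "r > 0"
  obtains M a b where "M \<ge> n"
    "\<And>i. i \<in> {1..n} \<Longrightarrow> mvar i ^ M =
      (\<Sum>l\<in>{1..n}. a i l * fpoly n r l) + (\<Sum>j\<in>{1..gcd r n}. b i j * power_sum n j)"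
    "\<And>i j. deg_le (M - j) (b i j)"
proof -
  let ?d = "gcd r n"
  define comb where "comb a b = (\<Sum>l\<in>{1..n}. a l * fpoly n r l) + (\<Sum>j\<in>{1..?d}. b j * power_sum n j)" for a b
  have delta: "(\<Sum>l\<in>A. (if l = k then 1 else 0) * f l) = f k" if "k \<in> A" "finite A" for A k and f :: "nat \<Rightarrow> mpoly"
    using that by (simp add: if_distrib[of "\<lambda>x. x * _"] sum.delta cong: if_cong)
  have K: "mideal (range (\<lambda>(a, b). comb a b))"
    unfolding mideal_def
  proof (intro conjI ballI allI)
    have "0 = comb (\<lambda>_. 0) (\<lambda>_. 0)"
      by (simp add: comb_def)
    then show "0 \<in> range (\<lambda>(a, b). comb a b)"
      by (metis (mono_tags) case_prod_conv rangeI)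
    fix p assume "p \<in> range (\<lambda>(a, b). comb a b)"
    then obtain a b where p: "p = comb a b"
      by auto
    have "c * p = comb (\<lambda>l. c * a l) (\<lambda>j. c * b j)" for c
      by (simp add: p comb_def distrib_left sum_distrib_left mult.assoc)
    then show "c * p \<in> range (\<lambda>(a, b). comb a b)" for c
      by (metis (mono_tags) case_prod_conv rangeI)
    fix q assume "q \<in> range (\<lambda>(a, b). comb a b)"
    then obtain a' b' where q: "q = comb a' b'"
      by auto
    have "p + q = comb (\<lambda>l. a l + a' l) (\<lambda>j. b j + b' j)"
      by (simp add: p q comb_def distrib_right sum.distrib)
    then show "p + q \<in> range (\<lambda>(a, b). comb a b)"
      by (metis (mono_tags) case_prod_conv rangeI)
  qed
  have f: "fpoly n r i \<in> range (\<lambda>(a, b). comb a b)" if "i \<in> {1..n}" for i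
  proof -
    have "fpoly n r i = comb (\<lambda>l. if l = i then 1 else 0) (\<lambda>_. 0)"
      unfolding comb_def delta[OF that finite_atLeastAtMost] by simp
    then show ?thesis
      by (metis (mono_tags) case_prod_conv rangeI)
  qed
  have ps: "power_sum n j \<in> range (\<lambda>(a, b). comb a b)" if "j \<in> {1..?d}" for j
  proof -
    have "power_sum n j = comb (\<lambda>_. 0) (\<lambda>l. if l = j then 1 else 0)"
      unfolding comb_def delta[OF that finite_atLeastAtMost] by simp
    then show ?thesis
      by (metis (mono_tags) case_prod_conv rangeI)
  qed
  obtain M where M: "M \<ge> r" "M \<ge> n" "\<And>i. i \<in> {1..n} \<Longrightarrow> mvar i ^ M \<in> range (\<lambda>(a, b). comb a b)"
    using mvar_power_in_mideal[OF n r K f ps] by blast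
  have "\<forall>i\<in>{1..n}. \<exists>ab. mvar i ^ M = comb (fst ab) (snd ab)"
    using M(3) by (fastforce simp: image_iff split_beta)
  then obtain ab where ab: "\<And>i. i \<in> {1..n} \<Longrightarrow> mvar i ^ M = comb (fst (ab i)) (snd (ab i))"
    unfolding bchoice_iff by blast
  show ?thesis
  proof (rule that[OF M(2)])
    fix i assume i: "i \<in> {1..n}"
    have coeff_sum': "coeff (grade (sum f A)) M = (\<Sum>l\<in>A. coeff (grade (f l)) M)" for f :: "nat \<Rightarrow> mpoly" and A
      by (simp add: grade_simps coeff_sum)
    have "mvar i ^ M = coeff (grade (mvar i ^ M)) M"
      using homogeneous_power[OF homogeneous_mvar, of M i] by (simp add: homogeneous_def)
    also have "\<dots> = (\<Sum>l\<in>{1..n}. coeff (grade (fst (ab i) l * fpoly n r l)) M)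
        + (\<Sum>j\<in>{1..?d}. coeff (grade (snd (ab i) j * power_sum n j)) M)"
      unfolding ab[OF i] comb_def by (simp only: grade_simps(1) coeff_add coeff_sum')
    also have "(\<Sum>l\<in>{1..n}. coeff (grade (fst (ab i) l * fpoly n r l)) M) =
        (\<Sum>l\<in>{1..n}. coeff (grade (fst (ab i) l)) (M - r) * fpoly n r l)"
      by (intro sum.cong refl coeff_grade_mult_homogeneous homogeneous_fpoly M)
    also have "(\<Sum>j\<in>{1..?d}. coeff (grade (snd (ab i) j * power_sum n j)) M) =
        (\<Sum>j\<in>{1..?d}. coeff (grade (snd (ab i) j)) (M - j) * power_sum n j)"
    proof (intro sum.cong refl coeff_grade_mult_homogeneous homogeneous_power_sum)
      fix j assume "j \<in> {1..?d}"
      moreover have "?d \<le> n"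
        using n by (intro dvd_imp_le) auto
      ultimately show "j \<le> M"
        using M(2) by simp
    qed
    finally show "mvar i ^ M = (\<Sum>l\<in>{1..n}. coeff (grade (fst (ab i) l)) (M - r) * fpoly n r l) +
        (\<Sum>j\<in>{1..?d}. coeff (grade (snd (ab i) j)) (M - j) * power_sum n j)" .
  next
    show "deg_le (M - j) (coeff (grade (snd (ab i) j)) (M - j))" for i j
      by (rule deg_le_coeff_grade)
  qed
qed

subsection \<open>Upper bound\<close>

definition theta :: "nat \<Rightarrow> nat \<Rightarrow> mpoly" where
  "theta n j = msubst mconst (centered n) (power_sum n j)"

text \<open>Each exponent is bounded by N separately, instead of the total degree; the resulting box
  is easily counted and has the same order of growth N^(d-1).\<close>

definition theta_monomials :: "nat \<Rightarrow> nat \<Rightarrow> mpoly set \<Rightarrow> nat \<Rightarrow> mpoly set" where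
  "theta_monomials n d B N = (\<lambda>(e, b). (\<Prod>j\<in>{2..d}. theta n j ^ e j) * b) ` (PiE {2..d} (\<lambda>_. {..N}) \<times> B)"

lemma finite_theta_monomials: "finite B \<Longrightarrow> finite (theta_monomials n d B N)"
  by (auto simp: theta_monomials_def intro!: finite_PiE)

lemma card_theta_monomials:
  assumes "finite B"
  shows "card (theta_monomials n d B N) \<le> (N + 1) ^ (d - 1) * card B"
proof -
  have "card (theta_monomials n d B N) \<le> card (PiE {2..d} (\<lambda>_. {..N}) \<times> B)"
    unfolding theta_monomials_def using assms by (intro card_image_le finite_cartesian_product finite_PiE) auto
  also have "\<dots> = (N + 1) ^ (d - 1) * card B"
    by (simp add: card_cartesian_product card_PiE)
  finally show ?thesis .
qed

lemma theta_monomials_mono: "N \<le> N' \<Longrightarrow> theta_monomials n d B N \<subseteq> theta_monomials n d B N'"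
  unfolding theta_monomials_def by (intro image_mono Sigma_mono PiE_mono) auto

lemma theta_mult_theta_monomials:
  assumes g: "g \<in> theta_monomials n d B N" and j: "j \<in> {2..d}"
  shows "theta n j * g \<in> theta_monomials n d B (Suc N)"
proof -
  obtain e b where e: "e \<in> PiE {2..d} (\<lambda>_. {..N})" "b \<in> B" "g = (\<Prod>j\<in>{2..d}. theta n j ^ e j) * b"
    using g by (auto simp: theta_monomials_def)
  let ?e = "e(j := Suc (e j))"
  have "(\<Prod>i\<in>{2..d}. theta n i ^ ?e i) = theta n j ^ Suc (e j) * (\<Prod>i\<in>{2..d} - {j}. theta n i ^ ?e i)"
    using j by (subst prod.remove[of "{2..d}" j]) simp_all
  also have "(\<Prod>i\<in>{2..d} - {j}. theta n i ^ ?e i) = (\<Prod>i\<in>{2..d} - {j}. theta n i ^ e i)"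
    by (rule prod.cong) auto
  also have "theta n j ^ Suc (e j) * \<dots> = theta n j * (\<Prod>i\<in>{2..d}. theta n i ^ e i)"
    by (subst prod.remove[of "{2..d}" j "\<lambda>i. theta n i ^ e i"]) (use j in \<open>simp_all add: mult.assoc\<close>)
  finally have "theta n j * g = (\<Prod>i\<in>{2..d}. theta n i ^ ?e i) * b"
    by (simp add: e(3) mult.assoc)
  moreover have "?e \<in> PiE {2..d} (\<lambda>_. {..Suc N})"
    using e(1) j by (auto simp: PiE_iff extensional_def intro: le_SucI)
  ultimately show ?thesis
    unfolding theta_monomials_def using e(2) by force
qed

text \<open>The centred coordinates sum to 0. Hence only d - 1 of the d power sums survive in C[h],
  which is where the dimension d - 1 comes from.\<close>

lemma theta_1:
  assumes "n > 0"
  shows "theta n 1 = 0"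
proof (rule mpoly_eq_0I)
  fix v
  have "peval v (theta n 1) = (\<Sum>i\<in>{1..n}. peval v (centered n i))"
    by (simp add: theta_def power_sum_def tsubst_simps peval_simps)
  also have "\<dots> = (\<Sum>i\<in>{1..n}. v i - (\<Sum>j\<in>{1..n}. v j) / of_nat n)"
    by (intro sum.cong refl peval_centered)
  also have "\<dots> = 0"
    unfolding sum_subtractf using assms by simp
  finally show "peval v (theta n 1) = 0" .
qed

text \<open>Replacing x_i^M by its expansion puts one part into the ideal and turns the rest into
  factors theta_j times polynomials of degree lower by j. Induction on the degree bound ends with
  monomials in the centred coordinates whose exponents are all below M; they form the finite set
  B.\<close>

lemma span_theta_monomials:
  assumes n: "n > 0" and r: "r > 0"
  obtains B where "finite B"
    "\<And>N p. deg_le N p \<Longrightarrow> msubst mconst (centered n) p \<in>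
      mpoly_vs.span (theta_monomials n (gcd r n) B N \<union> generated_ideal n (fpoly n r))"
proof -
  let ?d = "gcd r n" and ?J = "generated_ideal n (fpoly n r)" and ?\<sigma> = "msubst mconst (centered n)"
  have f: "fpoly n r i \<in> Ch n" if "i \<in> {1..n}" for i
    using fpoly_in_Ch[OF n r that] .
  interpret Ch_ideal n ?J
    by (rule Ch_ideal_generated_ideal[OF f])
  have d: "?d > 0" "?d \<le> n"
    using n by (auto intro: dvd_imp_le)
  obtain M a b where M: "M \<ge> n"
    and ex: "\<And>i. i \<in> {1..n} \<Longrightarrow> mvar i ^ M =
      (\<Sum>l\<in>{1..n}. a i l * fpoly n r l) + (\<Sum>j\<in>{1..?d}. b i j * power_sum n j)"
    and deg_b: "\<And>i j. deg_le (M - j) (b i j)"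
    by (rule mvar_power_expansion[OF n r]) blast
  \<comment> \<open>The retraction onto C[h] applied to the expansion: it fixes the f_l and removes
    p_1, so the second sum starts at j = 2.\<close>
  have ex': "centered n i ^ M = (\<Sum>l\<in>{1..n}. ?\<sigma> (a i l) * fpoly n r l) + (\<Sum>j\<in>{2..?d}. ?\<sigma> (b i j) * theta n j)"
    if i: "i \<in> {1..n}" for i
  proof -
    have "centered n i ^ M = ?\<sigma> (mvar i ^ M)"
      by (simp add: tsubst_simps)
    also have "\<dots> = (\<Sum>l\<in>{1..n}. ?\<sigma> (a i l) * ?\<sigma> (fpoly n r l)) + (\<Sum>j\<in>{1..?d}. ?\<sigma> (b i j) * theta n j)"
      unfolding ex[OF i] by (simp add: tsubst_simps theta_def)
    also have "(\<Sum>l\<in>{1..n}. ?\<sigma> (a i l) * ?\<sigma> (fpoly n r l)) = (\<Sum>l\<in>{1..n}. ?\<sigma> (a i l) * fpoly n r l)"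
      by (intro sum.cong refl) (simp only: msubst_centered[OF f])
    also have "(\<Sum>j\<in>{1..?d}. ?\<sigma> (b i j) * theta n j) = (\<Sum>j\<in>{2..?d}. ?\<sigma> (b i j) * theta n j)"
    proof (rule sum.mono_neutral_right)
      show "\<forall>j\<in>{1..?d} - {2..?d}. ?\<sigma> (b i j) * theta n j = 0"
      proof
        fix j assume "j \<in> {1..?d} - {2..?d}"
        then have "j = 1" by auto
        then show "?\<sigma> (b i j) * theta n j = 0"
          using theta_1[OF n] by simp
      qed
    qed auto
    finally show ?thesis .
  qed
  define B where "B = (\<lambda>g. \<Prod>i\<in>{1..n}. centered n i ^ g i) ` PiE {1..n} (\<lambda>_. {..<M})"
  let ?S = "\<lambda>N. mpoly_vs.span (theta_monomials n ?d B N \<union> ?J)"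
  \<comment> \<open>The extra factor raises one exponent by 1, hence the strictly larger box. There
    is room for it because each theta_j is paid for by a drop of the degree by j.\<close>
  have theta_span: "theta n j * x \<in> ?S N" if "x \<in> ?S N'" "N' < N" "j \<in> {2..?d}" for x N N' j
    using that(1)
  proof (induction rule: mpoly_vs.span_induct_alt)
    case base
    then show ?case by (simp add: mpoly_vs.span_zero)
  next
    case (step c x y)
    have "theta n j * x \<in> theta_monomials n ?d B N \<union> ?J"
    proof (cases "x \<in> ?J")
      case True
      then show ?thesis
        using mult_mem[OF True, of "theta n j"] by (simp add: theta_def msubst_centered_in_Ch)
    next
      case False
      then have "theta n j * x \<in> theta_monomials n ?d B (Suc N')"
        using step(1) that(3) by (intro theta_mult_theta_monomials) auto
      then show ?thesis
        using theta_monomials_mono[of "Suc N'" N n ?d B] that(2) by auto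
    qed
    then have "mconst c * (theta n j * x) + theta n j * y \<in> ?S N"
      by (intro mpoly_vs.span_add mpoly_vs.span_scale step(2)) (rule mpoly_vs.span_base)
    then show ?case
      by (simp only: distrib_left mult.left_commute)
  qed
  have main: "?\<sigma> p \<in> ?S N" if "deg_le N p" for N p
    using that
  proof (induction N arbitrary: p rule: less_induct)
    case (less N)
    have monomial: "mon (centered n) m \<in> ?S N" if m: "mdeg m \<le> N" for m
    proof (cases "Poly_Mapping.keys m \<subseteq> {1..n}")
      case False
      then obtain i where i: "i \<in> Poly_Mapping.keys m" "i \<notin> {1..n}"
        by blast
      have "centered n i = 0"
        unfolding centered_def using i(2) by (rule if_not_P)
      moreover have "Poly_Mapping.lookup m i > 0"
        using i(1) by (simp add: in_keys_iff)
      ultimately have "centered n i ^ Poly_Mapping.lookup m i = 0"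
        by (simp add: power_0_left)
      then have "mon (centered n) m = 0"
        unfolding mon_def using i(1) by (intro prod_zero) auto
      then show ?thesis
        by (simp add: mpoly_vs.span_zero)
    next
      case keys: True
      show ?thesis
      proof (cases "\<forall>i\<in>{1..n}. Poly_Mapping.lookup m i < M")
        case True
        let ?g = "restrict (Poly_Mapping.lookup m) {1..n}"
        have "mon (centered n) m = (\<Prod>i\<in>{1..n}. centered n i ^ ?g i)"
          unfolding mon_superset[OF finite_atLeastAtMost keys] by (rule prod.cong) auto
        moreover have "?g \<in> PiE {1..n} (\<lambda>_. {..<M})"
          using True by (auto simp: PiE_iff)
        ultimately have "mon (centered n) m \<in> B"
          unfolding B_def by blast
        then have "(restrict (\<lambda>_. 0) {2..?d}, mon (centered n) m) \<in> PiE {2..?d} (\<lambda>_. {..N}) \<times> B"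
          by (intro SigmaI) (auto simp: PiE_iff)
        then have "mon (centered n) m \<in> theta_monomials n ?d B N"
          unfolding theta_monomials_def by (rule image_eqI[rotated]) simp
        then show ?thesis
          by (intro mpoly_vs.span_base) blast
      next
        case False
        then obtain i where i: "i \<in> {1..n}" "M \<le> Poly_Mapping.lookup m i"
          by auto
        define m' where "m' = m - Poly_Mapping.single i M"
        have mm': "m = Poly_Mapping.single i M + m'"
          unfolding m'_def using i(2)
          by (intro poly_mapping_eqI) (auto simp: lookup_add lookup_minus lookup_single when_def)
        let ?y = "Poly_Mapping.single m' 1 :: mpoly"
        have "mon (centered n) m = centered n i ^ M * ?\<sigma> ?y"
          by (simp add: mm' mon_add msubst_single[OF coeff_hom_mconst])
        also have "\<dots> = (\<Sum>l\<in>{1..n}. ?\<sigma> (a i l) * fpoly n r l) * ?\<sigma> ?y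
            + (\<Sum>j\<in>{2..?d}. theta n j * ?\<sigma> (b i j * ?y))"
          unfolding ex'[OF i(1)] distrib_right sum_distrib_right[of _ "{2..?d}"]
          by (simp add: tsubst_simps mult_ac)
        also have "\<dots> \<in> ?S N"
        proof (rule mpoly_vs.span_add)
          have "(\<Sum>l\<in>{1..n}. ?\<sigma> (a i l) * fpoly n r l) \<in> ?J"
            unfolding generated_ideal_def
            by (intro CollectI exI[of _ "\<lambda>l. ?\<sigma> (a i l)"]) (simp add: msubst_centered_in_Ch)
          then have "?\<sigma> ?y * (\<Sum>l\<in>{1..n}. ?\<sigma> (a i l) * fpoly n r l) \<in> ?J"
            by (intro mult_mem msubst_centered_in_Ch)
          then show "(\<Sum>l\<in>{1..n}. ?\<sigma> (a i l) * fpoly n r l) * ?\<sigma> ?y \<in> ?S N"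
            by (intro mpoly_vs.span_base) (simp add: mult.commute)
          show "(\<Sum>j\<in>{2..?d}. theta n j * ?\<sigma> (b i j * ?y)) \<in> ?S N"
          proof (rule mpoly_vs.span_sum)
            fix j assume j: "j \<in> {2..?d}"
            have "mdeg m = M + mdeg m'"
              by (simp add: mm' mdeg_add mdeg_single)
            moreover have "j \<le> M"
              using j d M by auto
            ultimately have deg: "(M - j) + mdeg m' \<le> N - j" and lt: "N - j < N"
              using m j by auto
            have "deg_le (N - j) (b i j * ?y)"
              by (rule deg_le_mono[OF deg_le_mult[OF deg_b deg_le_single] deg])
            then have "?\<sigma> (b i j * ?y) \<in> ?S (N - j)"
              by (rule less.IH[OF lt])
            then show "theta n j * ?\<sigma> (b i j * ?y) \<in> ?S N"
              using lt j by (rule theta_span)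
          qed
        qed
        finally show ?thesis .
      qed
    qed
    have "?\<sigma> p = (\<Sum>m\<in>Poly_Mapping.keys p. mconst (Poly_Mapping.lookup p m) * mon (centered n) m)"
      by (simp add: msubst_def mon_def)
    also have "\<dots> \<in> ?S N"
      using less.prems by (intro mpoly_vs.span_sum mpoly_vs.span_scale monomial) (simp add: deg_le_def)
    finally show ?case .
  qed
  have "finite B"
    unfolding B_def by (intro finite_imageI finite_PiE) auto
  then show ?thesis
    using main by (rule that)
qed

lemma GK_dim_upper:
  assumes n: "n > 0" and r: "r > 0"
  shows "GK_dim (Ch_ring n) (Vmod n (generated_ideal n (fpoly n r))) \<le> ereal (real (gcd r n - 1))"
proof -
  let ?d = "gcd r n" and ?J = "generated_ideal n (fpoly n r)"
  have f: "fpoly n r i \<in> Ch n" if "i \<in> {1..n}" for i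
    using fpoly_in_Ch[OF n r that] .
  interpret Ch_ideal n ?J
    by (rule Ch_ideal_generated_ideal[OF f])
  obtain B where B: "finite B" and span: "\<And>N p. deg_le N p \<Longrightarrow> msubst mconst (centered n) p \<in>
      mpoly_vs.span (theta_monomials n ?d B N \<union> ?J)"
    by (rule span_theta_monomials[OF n r]) blast
  show ?thesis
    unfolding GK_dim_def
  proof (rule SUP_least, clarify)
    fix A F assume A: "finite A" "A \<subseteq> carrier (Ch_ring n)" and F: "finite F" "F \<subseteq> carrier (Vmod n ?J)"
    have ACh: "A \<subseteq> Ch n"
      using A(2) by (simp add: Ch_ring_def)
    obtain F0 where F0: "F0 \<subseteq> Ch n" "finite F0" "F = cls ` F0"
      using finite_subset_image[OF F(1)] F(2) by (metis carrier_Vmod)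
    obtain N0 where N0: "\<And>p. p \<in> A \<union> F0 \<Longrightarrow> deg_le N0 p"
      using deg_le_bound[of "A \<union> F0"] A(1) F0(2) by auto
    \<comment> \<open>One constant for all purposes: it dominates the size of \<open>B\<close> and
      the degree bound \<open>N0\<close> of the generators, and the summand 1 makes it
      positive.\<close>
    define C where "C = card B + N0 + 1"
    have "cdim (Vmod n ?J) (growth_space (Vmod n ?J) A F m) \<le> C * (C * (m + 1) + 1) ^ (?d - 1)" for m
    proof -
      let ?N = "N0 * (m + 1)"
      have sub: "products A F0 m \<subseteq> Ch n"
        by (rule products_subset_Ch[OF ACh F0(1)])
      have "products A F0 m \<subseteq> mpoly_vs.span (theta_monomials n ?d B ?N \<union> ?J)"
      proof
        fix x assume x: "x \<in> products A F0 m"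
        then obtain as p where as: "x = prod_list as * p" "length as = m" "set as \<subseteq> A" "p \<in> F0"
          by (auto simp: products_def)
        have "deg_le (N0 * length as + N0) (prod_list as * p)"
          by (intro deg_le_mult deg_le_prod_list N0) (use as in auto)
        then have "deg_le ?N x"
          by (simp add: as(1,2) add.commute)
        then have "msubst mconst (centered n) x \<in> mpoly_vs.span (theta_monomials n ?d B ?N \<union> ?J)"
          by (rule span)
        then show "x \<in> mpoly_vs.span (theta_monomials n ?d B ?N \<union> ?J)"
          using x sub msubst_centered by auto
      qed
      then have "cdim (Vmod n ?J) (cspan (Vmod n ?J) (cls ` products A F0 m)) \<le> card (theta_monomials n ?d B ?N)"
        by (intro cdim_le[OF sub] finite_theta_monomials B)
      also have "\<dots> \<le> (?N + 1) ^ (?d - 1) * card B"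
        by (rule card_theta_monomials[OF B])
      also have "\<dots> \<le> (C * (m + 1) + 1) ^ (?d - 1) * C"
        by (intro mult_le_mono power_mono add_right_mono mult_le_mono1) (simp_all add: C_def)
      finally show ?thesis
        by (simp only: F0(3) growth_space_eq[OF ACh F0(1)] mult.commute)
    qed
    then show "limsup (\<lambda>m. let d = cdim (Vmod n ?J) (growth_space (Vmod n ?J) A F m)
        in if d = 0 then - \<infinity> else ereal (ln (real d) / ln (real m))) \<le> ereal (real (?d - 1))"
      unfolding Let_def by (intro limsup_growth_le[of C]) (simp add: C_def)
  qed
qed

subsection \<open>Lower bound\<close>

lemma lookup_sum_single:
  assumes "finite S"
  shows "Poly_Mapping.lookup (\<Sum>b\<in>S. Poly_Mapping.single b (e b)) i = (if i \<in> S then e i else (0::nat))"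
  unfolding lookup_sum lookup_single when_def using assms by (rule sum.delta)

lemma independent_monomials: "mpoly_vs.independent ((\<lambda>k. Poly_Mapping.single k 1) ` S)"
  unfolding mpoly_vs.dependent_def
proof (rule notI, elim bexE)
  fix a :: mpoly assume "a \<in> (\<lambda>k. Poly_Mapping.single k 1) ` S"
    and span: "a \<in> mpoly_vs.span ((\<lambda>k. Poly_Mapping.single k 1) ` S - {a})"
  then obtain k where k: "a = Poly_Mapping.single k 1"
    by blast
  have "Poly_Mapping.lookup p k = 0" if "p \<in> mpoly_vs.span ((\<lambda>k. Poly_Mapping.single k 1) ` S - {a})" for p
    using that
  proof (induction rule: mpoly_vs.span_induct_alt)
    case (step c x y)
    then obtain l where "x = Poly_Mapping.single l 1" "l \<noteq> k"
      unfolding k by blast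
    then show ?case
      using step(2) by (simp add: lookup_add lookup_mconst_mult lookup_single)
  qed simp
  from this[OF span] show False
    by (simp add: k)
qed

text \<open>A growth space demands exactly m factors; a monomial of smaller degree is padded with
  the element 1 of A.\<close>

lemma power_product_list:
  fixes t :: "nat \<Rightarrow> mpoly"
  assumes "finite S" "\<And>b. b \<in> S \<Longrightarrow> t b \<in> A" "1 \<in> A" "(\<Sum>b\<in>S. e b) \<le> m"
  shows "\<exists>as. length as = m \<and> set as \<subseteq> A \<and> prod_list as = (\<Prod>b\<in>S. t b ^ e b)"
  using assms
proof (induction S arbitrary: m)
  case empty
  then show ?case
    by (intro exI[of _ "replicate m 1"]) (auto simp: prod_list_replicate)
next
  case (insert b S)
  have "\<exists>as. length as = m - e b \<and> set as \<subseteq> A \<and> prod_list as = (\<Prod>b\<in>S. t b ^ e b)"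
    using insert.prems insert.hyps by (intro insert.IH) auto
  then obtain as where as: "length as = m - e b" "set as \<subseteq> A" "prod_list as = (\<Prod>b\<in>S. t b ^ e b)"
    by blast
  show ?case
    using insert.prems insert.hyps as
    by (intro exI[of _ "replicate (e b) (t b) @ as"]) (auto simp: prod_list_replicate)
qed

lemma GK_dim_lower:
  assumes n: "n > 0" and r: "r > 0"
  shows "ereal (real (gcd r n - 1)) \<le> GK_dim (Ch_ring n) (Vmod n (generated_ideal n (fpoly n r)))"
proof -
  let ?J = "generated_ideal n (fpoly n r)"
  define d where "d = gcd r n"
  define q where "q = n div d"
  have d: "d > 0" "n = d * q" "q > 0"
  proof -
    show "d > 0"
      using n by (simp add: d_def)
    show "n = d * q"
      by (simp add: q_def d_def)
    then show "q > 0"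
      using n by (cases q) auto
  qed
  have f: "fpoly n r i \<in> Ch n" if "i \<in> {1..n}" for i
    using fpoly_in_Ch[OF n r that] .
  interpret Ch_ideal n ?J
    by (rule Ch_ideal_generated_ideal[OF f])
  \<comment> \<open>The last coordinate of block b minus that of the last block; being a difference,
    it lies in C[h].\<close>
  define t where "t b = alpha (b * q) (d * q)" for b
  have bq: "b * q \<in> {1..n}" if "b \<in> {1..d}" for b
    using that d by (auto simp: Suc_le_eq)
  have t_Ch: "t b \<in> Ch n" if "b \<in> {1..<d}" for b
  proof (rule Ch_I)
    show "t b \<in> polys_in {1..n}"
      unfolding t_def alpha_def using that d(1) by (intro polys_in_diff polys_in_mvar bq) auto
  qed (simp add: t_def peval_alpha)
  define \<tau> where "\<tau> = msubst mconst t"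
  define A where "A = insert 1 (t ` {1..<d})"
  have A: "finite A" "1 \<in> A" "A \<subseteq> Ch n"
    using t_Ch by (auto simp: A_def)
  have vanish: "peval v p = 0"
    if p: "p \<in> ?J" and v: "\<And>b s. b < d \<Longrightarrow> s < q \<Longrightarrow> v (b * q + s + 1) = c b" for p v c
  proof -
    have "n div gcd r n dvd card {i\<in>{1..n}. v i = a}" for a
    proof -
      have "n div gcd r n = q"
        by (simp only: q_def d_def)
      moreover have "card {i\<in>{1..n}. v i = a} = q * card {b. b < d \<and> c b = a}"
        using card_block_fibre[of q d v c a, OF d(3) v] unfolding d(2)[symmetric] .
      ultimately show ?thesis
        by (simp only: dvd_triv_left)
    qed
    then have "peval v (fpoly n r i) = 0" if "i \<in> {1..n}" for i
      using zero_of_fibres[OF n r _ that, of v] by blast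
    then show ?thesis
      using p by (auto simp: generated_ideal_def peval_simps)
  qed
  text \<open>The functions \<open>t\<^sub>b\<close> are coordinates on the subspace where \<open>x\<close> is constant on blocks, and \<open>J\<close> vanishes
    there.\<close>
  have \<tau>_J: "p = 0" if p: "p \<in> polys_in {1..<d}" and \<tau>p: "\<tau> p \<in> ?J" for p
  proof (rule mpoly_eq_0I)
    fix y :: "nat \<Rightarrow> complex"
    \<comment> \<open>Block values at which t_b takes the value y_b: blocks are counted from 0 in
      \<open>c\<close> but from 1 in \<open>t\<close>, and the last block gets 0.\<close>
    define c where "c b = (if Suc b < d then y (Suc b) else 0)" for b
    define v where "v i = c ((i - 1) div q)" for i
    have v: "v (b * q + s + 1) = c b" if "b < d" "s < q" for b s
      using that by (simp add: v_def)
    have vq: "v (b * q) = c (b - 1)" if b: "b > 0" for b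
    proof -
      obtain b' where b': "b = Suc b'"
        using b by (cases b) auto
      have "(b * q - 1) div q = b - 1"
        by (rule div_nat_eqI) (use d(3) in \<open>simp_all add: b' mult.commute\<close>)
      then show ?thesis
        by (simp only: v_def)
    qed
    have "peval v (\<tau> p) = peval (\<lambda>b. peval v (t b)) p"
      by (simp add: \<tau>_def peval_msubst)
    also have "\<dots> = peval y p"
    proof (rule peval_cong[OF p])
      fix b assume b: "b \<in> {1..<d}"
      then have "v (b * q) = y b" "v (d * q) = 0"
        using d(1) by (simp_all add: vq c_def)
      then show "peval v (t b) = y b"
        by (simp add: t_def peval_alpha)
    qed
    finally show "peval y p = 0"
      using vanish[where v = v and c = c, OF \<tau>p v] by simp
  qed
  have D: "(m div d + 1) ^ (d - 1) \<le> cdim (Vmod n ?J) (growth_space (Vmod n ?J) A (cls ` {1}) m)" for m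
  proof -
    \<comment> \<open>Exponents up to m/d in d - 1 variables keep the total degree at most m, so the
      monomials are products of m elements of \<open>A\<close>; their number already grows like
      m^(d-1).\<close>
    let ?E = "PiE {1..<d} (\<lambda>_. {..m div d})"
    define mm :: "(nat \<Rightarrow> nat) \<Rightarrow> (nat \<Rightarrow>\<^sub>0 nat)" where
      "mm e = (\<Sum>b\<in>{1..<d}. Poly_Mapping.single b (e b))" for e
    have lookup_mm: "Poly_Mapping.lookup (mm e) b = (if b \<in> {1..<d} then e b else 0)" for e b
      unfolding mm_def by (rule lookup_sum_single) simp
    have inj_mm: "inj_on mm ?E"
    proof (rule inj_onI)
      fix e e' assume e: "e \<in> ?E" "e' \<in> ?E" and eq: "mm e = mm e'"
      have "e b = e' b" if "b \<in> {1..<d}" for b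
        using lookup_mm[of e b] lookup_mm[of e' b] eq that by simp
      then show "e = e'"
        using e by (intro PiE_ext[OF e])
    qed
    have keys_mm: "Poly_Mapping.keys (mm e) \<subseteq> {1..<d}" for e
      by (auto simp: in_keys_iff lookup_mm split: if_splits)
    let ?Mono = "(\<lambda>k. Poly_Mapping.single k (1 :: complex)) ` mm ` ?E"
    have Mono_polys: "p \<in> polys_in {1..<d}" if "p \<in> mpoly_vs.span ?Mono" for p
      using that
    proof (induction rule: mpoly_vs.span_induct_alt)
      case (step c x y)
      then obtain e where "x = Poly_Mapping.single (mm e) 1"
        by blast
      then have "x \<in> polys_in {1..<d}"
        using keys_mm[of e] by (simp add: polys_in_def)
      then show ?case
        using step(2) by (intro polys_in_add polys_in_mult) auto
    qed simp
    have lin: "Vector_Spaces.linear (\<lambda>c p. mconst c * p) (\<lambda>c p. mconst c * p) \<tau>"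
      unfolding Vector_Spaces.linear_iff using mpoly_vs.vector_space_axioms
      by (simp add: \<tau>_def tsubst_simps)
    have inj_\<tau>: "inj_on \<tau> (mpoly_vs.span ?Mono)"
    proof (rule inj_onI)
      fix p p' assume pp: "p \<in> mpoly_vs.span ?Mono" "p' \<in> mpoly_vs.span ?Mono" and eq: "\<tau> p = \<tau> p'"
      have "\<tau> (p - p') \<in> ?J"
        using eq zero_mem by (simp add: \<tau>_def tsubst_simps)
      then have "p - p' = 0"
        using Mono_polys[OF pp(1)] Mono_polys[OF pp(2)] by (intro \<tau>_J polys_in_diff)
      then show "p = p'"
        by simp
    qed
    let ?X = "\<tau> ` ?Mono"
    have ind: "mpoly_vs.independent ?X"
      using lin independent_monomials inj_\<tau> by (rule mpoly_vsp.linear_independent_injective_image)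
    have span_X: "\<exists>p'\<in>mpoly_vs.span ?Mono. p = \<tau> p'" if "p \<in> mpoly_vs.span ?X" for p
      using that
    proof (induction rule: mpoly_vs.span_induct_alt)
      case base
      then show ?case
        by (intro bexI[of _ 0]) (simp_all add: \<tau>_def tsubst_simps mpoly_vs.span_zero)
    next
      case (step c x y)
      then obtain x' y' where "x' \<in> ?Mono" "x = \<tau> x'" "y' \<in> mpoly_vs.span ?Mono" "y = \<tau> y'"
        by blast
      then show ?case
        by (intro bexI[of _ "mconst c * x' + y'"] mpoly_vs.span_add mpoly_vs.span_scale)
          (simp_all add: \<tau>_def tsubst_simps mpoly_vs.span_base)
    qed
    have XJ: "p = 0" if p: "p \<in> mpoly_vs.span ?X" "p \<in> ?J" for p
    proof -
      obtain p' where p': "p' \<in> mpoly_vs.span ?Mono" "p = \<tau> p'"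
        using span_X[OF p(1)] by blast
      then have "p' = 0"
        using p(2) Mono_polys by (intro \<tau>_J) auto
      then show ?thesis
        by (simp add: p'(2) \<tau>_def tsubst_simps)
    qed
    have X_sub: "?X \<subseteq> products A {1} m"
    proof (clarify)
      fix e assume e: "e \<in> ?E"
      have "(\<Sum>b\<in>{1..<d}. e b) \<le> (\<Sum>b\<in>{1..<d}. m div d)"
        using e by (intro sum_mono) auto
      also have "\<dots> \<le> d * (m div d)"
        by simp
      also have "\<dots> \<le> m"
        by (rule times_div_less_eq_dividend)
      finally obtain as where as: "length as = m" "set as \<subseteq> A" "prod_list as = (\<Prod>b\<in>{1..<d}. t b ^ e b)"
        using power_product_list[of "{1..<d}" t A e m] A(2) by (auto simp: A_def)
      have "\<tau> (Poly_Mapping.single (mm e) 1) = mon t (mm e)"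
        by (simp add: \<tau>_def msubst_single[OF coeff_hom_mconst])
      also have "\<dots> = (\<Prod>b\<in>{1..<d}. t b ^ Poly_Mapping.lookup (mm e) b)"
        by (rule mon_superset[OF _ keys_mm]) simp
      also have "\<dots> = prod_list as * 1"
        unfolding as(3) mult_1_right by (rule prod.cong) (simp_all add: lookup_mm)
      finally show "\<tau> (Poly_Mapping.single (mm e) 1) \<in> products A {1} m"
        unfolding products_def using as(1,2) by blast
    qed
    have "card ?X = card ?Mono"
      by (rule card_image, rule inj_on_subset[OF inj_\<tau> mpoly_vs.span_superset])
    also have "\<dots> = card (mm ` ?E)"
      by (rule card_image, rule inj_onI, drule arg_cong[where f = Poly_Mapping.keys]) simp
    also have "\<dots> = card ?E"
      by (rule card_image[OF inj_mm])
    also have "\<dots> = (m div d + 1) ^ (d - 1)"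
      by (simp add: card_PiE)
    finally have "(m div d + 1) ^ (d - 1) = card ?X" ..
    also have "\<dots> \<le> cdim (Vmod n ?J) (cspan (Vmod n ?J) (cls ` products A {1} m))"
      using products_subset_Ch[OF A(3), of "{1}" m] finite_products[OF A(1), of "{1}" m] X_sub ind XJ
      by (intro cdim_ge) auto
    finally show ?thesis
      using growth_space_eq[OF A(3), of "{1}" m] by simp
  qed
  have "ereal (real (d - 1)) \<le> limsup (\<lambda>m. let D = cdim (Vmod n ?J) (growth_space (Vmod n ?J) A (cls ` {1}) m)
      in if D = 0 then - \<infinity> else ereal (ln (real D) / ln (real m)))"
    unfolding Let_def using d(1) D by (rule limsup_growth_ge)
  also have "\<dots> \<le> GK_dim (Ch_ring n) (Vmod n ?J)"
    unfolding GK_dim_def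
    by (rule SUP_upper2[of "(A, cls ` {1})"]) (use A in \<open>auto simp: Ch_ring_def carrier_Vmod\<close>)
  finally show ?thesis
    by (simp only: d_def)
qed

theorem theorem11p16:
  fixes n r d :: nat and k :: complex and I :: "mpoly set"
  assumes "n \<ge> 2" and "r > 0" and "\<not> n dvd r"
    and "k = of_nat r / of_nat n"
    and "d = gcd r n"
    and "I = cherednik_span n k (fpoly n r ` {1..n})"
  shows "supp n (Vmod n I) =
           (\<Union>w\<in>{w. w permutes {1..n}}. perm_hspace w ` block_subspace n d) \<and>
         GK_dim (Ch_ring n) (Vmod n I) = ereal (real (d - 1))"
proof -
  have n: "n > 0"
    using assms(1) by simp
  have I: "I = generated_ideal n (fpoly n r)"
    unfolding assms(4,6) by (rule cherednik_span_fpoly[OF n assms(2)])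
  show ?thesis
    unfolding I assms(5)
    using supp_fpoly[OF n assms(2)] antisym[OF GK_dim_upper[OF n assms(2)] GK_dim_lower[OF n assms(2)]]
    by (rule conjI)
qed

end
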